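(* Let $3\le n<\omega$. Then the frame $\mathfrak{s}^{n-3,n}$ is not weakly successful.
   Context: Hart–Shelah class $\mathbf{K}^n$ ($n\ge2$): models $M$ with sorts $I(M)$ (index set), $K(M)=[I(M)]^n$ with membership, $H\cong\mathbb{Z}_2$, $G(M)=\bigoplus_{u\in K}\mathbb{Z}_2$ with evaluation and support functions, $G^*(M)$ with projection onto $K$ and a regular $G$-action on each stalk, $H^*(M)$ with projection onto $K$ and a regular $\mathbb{Z}_2$-action on each stalk, and $Q\subseteq(G^* )^n\times H^*$ symmetric in the first $n$ arguments, holding only on compatible stalk indices (all $n$-subsets of one $(n+1)$-subset of $I$), such that moving $x_\ell$ by $\gamma_\ell\in G$ and $y\in H^*_v$ by $m\in\mathbb{Z}_2$ preserves the truth value of $Q$ iff $\gamma_1(v)+\dots+\gamma_n(v)+m\equiv0\pmod2$. It is $\mathbb{L}_{\omega_1,\omega}$-axiomatizable and ordered by $\mathbb{L}_{\omega_1,\omega}$-elementary substructure; $\mathbf{K}^n_\lambda$ = models of cardinality $\lambda$. $\mathfrak{s}^{k,n}$ ($n\ge3$, $k\le n-3$): the good $\aleph_k$-frame on $\mathbf{K}^n_{\aleph_k}$ whose basic types over $M$ are $\mathrm{gtp}(a/M;N)$ with $a\in I(N)\setminus I(M)$, and where for $M_0\le M_1\le M_2$, $\mathrm{gtp}(a/M_1;M_2)$ does not fork over $M_0$ iff $a\in I(M_2)\setminus I(M_1)$. Uniqueness triple (for a good $\lambda$-frame): $(a,M,N)$ with $M\le N$ in $\mathbf{K}_\lambda$,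 $a\in N\setminus M$, $\mathrm{gtp}(a/M;N)$ basic, such that for every $M_1\ge M$ in $\mathbf{K}_\lambda$ there is, up to equivalence over $M$, a unique amalgam $(f_1,f_2,N_1)$ ($N_1\in\mathbf{K}_\lambda$, $f_1:N\to N_1$, $f_2:M_1\to N_1$ embeddings fixing $M$) with $\mathrm{gtp}(f_1(a)/f_2[M_1];N_1)$ not forking over $M$; amalgams $(f^x_1,f^x_2,N^x)$, $x=a,b$, are equivalent over $M$ if there are $N_*\in\mathbf{K}_\lambda$, $f^x:N^x\to N_*$ with $f^af^a_\ell=f^bf^b_\ell$. Weakly successful: every basic type is $\mathrm{gtp}(a/M;N)$ for some uniqueness triple $(a,M,N)$. *)

theory Defs
  imports Main "HOL-Combinatorics.Permutations"
begin

fun isAleph :: "nat \<Rightarrow> 'a set \<Rightarrow> bool" where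
  "isAleph 0 A = ((card_of A, natLeq) \<in> ordIso)"
| "isAleph (Suc k) A = (\<exists>B \<subseteq> A. isAleph k B \<and> (card_of A, cardSuc (card_of B)) \<in> ordIso)"

record ('a, 'r) str =
  carrier :: "'a set"
  rel :: "'r \<Rightarrow> 'a list \<Rightarrow> bool"

text \<open>Formulas: atomic, equality, negation, countable conjunction, existential
  quantification.  Only formulas with finitely many free variables count as
  L_{omega_1,omega}-formulas.\<close>
datatype 'r fm =
    Atom 'r "nat list"
  | Equ nat nat
  | Neg "'r fm"
  | BigConj "nat \<Rightarrow> 'r fm"
  | Exi nat "'r fm"

primrec fv :: "'r fm \<Rightarrow> nat set" where
  "fv (Atom R vs) = set vs"
| "fv (Equ i j) = {i, j}"
| "fv (Neg \<phi>) = fv \<phi>"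
| "fv (BigConj F) = (\<Union>i. fv (F i))"
| "fv (Exi x \<phi>) = fv \<phi> - {x}"

primrec sat :: "('a, 'r, 'z) str_scheme \<Rightarrow> 'r fm \<Rightarrow> (nat \<Rightarrow> 'a) \<Rightarrow> bool" where
  "sat M (Atom R vs) s = rel M R (map s vs)"
| "sat M (Equ i j) s = (s i = s j)"
| "sat M (Neg \<phi>) s = (\<not> sat M \<phi> s)"
| "sat M (BigConj F) s = (\<forall>i. sat M (F i) s)"
| "sat M (Exi x \<phi>) s = (\<exists>a \<in> carrier M. sat M \<phi> (s(x := a)))"

definition Lfm :: "'r fm \<Rightarrow> bool" where
  "Lfm \<phi> \<longleftrightarrow> finite (fv \<phi>)"

definition elem_sub :: "('a, 'r) str \<Rightarrow> ('a, 'r) str \<Rightarrow> bool" where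
  "elem_sub M N \<longleftrightarrow> carrier M \<subseteq> carrier N \<and>
     (\<forall>\<phi> s. Lfm \<phi> \<longrightarrow> range s \<subseteq> carrier M \<longrightarrow> (sat M \<phi> s \<longleftrightarrow> sat N \<phi> s))"

definition elem_emb :: "('a \<Rightarrow> 'a) \<Rightarrow> ('a, 'r) str \<Rightarrow> ('a, 'r) str \<Rightarrow> bool" where
  "elem_emb f M N \<longleftrightarrow> f ` carrier M \<subseteq> carrier N \<and>
     (\<forall>\<phi> s. Lfm \<phi> \<longrightarrow> range s \<subseteq> carrier M \<longrightarrow> (sat M \<phi> s \<longleftrightarrow> sat N \<phi> (f \<circ> s)))"

definition img :: "('a \<Rightarrow> 'a) \<Rightarrow> ('a, 'r) str \<Rightarrow> ('a, 'r) str" where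
  "img f M = \<lparr> carrier = f ` carrier M,
      rel = (\<lambda>R ys. \<exists>xs. set xs \<subseteq> carrier M \<and> ys = map f xs \<and> rel M R xs) \<rparr>"

text \<open>Vocabulary: unary sort predicates SI (I), SK (K), SH (H), SG (G), SGs (G*),
  SHs (H*); Mem (membership I x K); HAdd (graph of addition on H);
  Eval (graph of evaluation G x K -> H); Supp (support relation G x K);
  GAdd (graph of addition on G); PiG (projection G* -> K); ActG (graph of the
  action G x G* -> G*); PiH (projection H* -> K); ActH (graph of the action
  H x H* -> H*); Qr (the (n+1)-ary relation Q).\<close>
datatype hsym = SI | SK | SH | SG | SGs | SHs | Mem | HAdd | Eval | Supp | GAdd
  | PiG | ActG | PiH | ActH | Qr

fun arity :: "nat \<Rightarrow> hsym \<Rightarrow> nat" where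
  "arity n Mem = 2" | "arity n HAdd = 3" | "arity n Eval = 3" | "arity n Supp = 2"
| "arity n GAdd = 3" | "arity n PiG = 2" | "arity n ActG = 3" | "arity n PiH = 2"
| "arity n ActH = 3" | "arity n Qr = Suc n" | "arity n _ = 1"

type_synonym 'a hstr = "('a, hsym) str"

definition srt :: "'a hstr \<Rightarrow> hsym \<Rightarrow> 'a set" where
  "srt M S = {x \<in> carrier M. rel M S [x]}"

definition memset :: "'a hstr \<Rightarrow> 'a \<Rightarrow> 'a set" where
  "memset M u = {i. rel M Mem [i, u]}"

definition piG :: "'a hstr \<Rightarrow> 'a \<Rightarrow> 'a" where
  "piG M x = (THE u. rel M PiG [x, u])"

definition piH :: "'a hstr \<Rightarrow> 'a \<Rightarrow> 'a" where
  "piH M y = (THE u. rel M PiH [y, u])"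

definition ev :: "'a hstr \<Rightarrow> 'a \<Rightarrow> 'a \<Rightarrow> 'a" where
  "ev M g u = (THE h. rel M Eval [g, u, h])"

definition compatible :: "nat \<Rightarrow> 'a hstr \<Rightarrow> 'a list \<Rightarrow> bool" where
  "compatible n M us \<longleftrightarrow> distinct us \<and>
     (\<exists>w \<subseteq> srt M SI. finite w \<and> card w = Suc n \<and>
        memset M ` set us = {A. A \<subseteq> w \<and> card A = n})"

definition hs_model :: "nat \<Rightarrow> 'a hstr \<Rightarrow> bool" where
  "hs_model n M \<longleftrightarrow>
   (let I = srt M SI; K = srt M SK; H = srt M SH; G = srt M SG;
        Gs = srt M SGs; Hs = srt M SHs; R = rel M in
   \<comment> \<open>well-formedness: relations live on the carrier, with the right arities\<close>
   (\<forall>S xs. R S xs \<longrightarrow> set xs \<subseteq> carrier M \<and> length xs = arity n S) \<and>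
   \<comment> \<open>the six sorts partition the universe\<close>
   (\<forall>x \<in> carrier M. \<exists>!S \<in> {SI, SK, SH, SG, SGs, SHs}. R S [x]) \<and>
   \<comment> \<open>K = [I]^n with membership\<close>
   (\<forall>i u. R Mem [i, u] \<longrightarrow> i \<in> I \<and> u \<in> K) \<and>
   bij_betw (memset M) K {A. A \<subseteq> I \<and> finite A \<and> card A = n} \<and>
   (\<exists>z one.
     \<comment> \<open>H is Z_2, with zero z and non-zero element o\<close>
     z \<noteq> one \<and> H = {z, one} \<and>
     (\<forall>a b c. R HAdd [a, b, c] \<longleftrightarrow> a \<in> H \<and> b \<in> H \<and> c = (if a = b then z else one)) \<and>
     \<comment> \<open>G is the direct sum of copies of Z_2 indexed by K, via evaluation\<close>
     (\<forall>g u h. R Eval [g, u, h] \<longrightarrow> g \<in> G \<and> u \<in> K \<and> h \<in> H) \<and>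
     (\<forall>g \<in> G. \<forall>u \<in> K. \<exists>!h. R Eval [g, u, h]) \<and>
     (\<forall>g \<in> G. finite {u \<in> K. ev M g u \<noteq> z}) \<and>
     (\<forall>f. (\<forall>u \<in> K. f u \<in> H) \<and> finite {u \<in> K. f u \<noteq> z} \<longrightarrow>
          (\<exists>!g. g \<in> G \<and> (\<forall>u \<in> K. ev M g u = f u))) \<and>
     (\<forall>g u. R Supp [g, u] \<longleftrightarrow> g \<in> G \<and> u \<in> K \<and> ev M g u \<noteq> z) \<and>
     (\<forall>g d e. R GAdd [g, d, e] \<longleftrightarrow> g \<in> G \<and> d \<in> G \<and> e \<in> G \<and>
          (\<forall>u \<in> K. R HAdd [ev M g u, ev M d u, ev M e u])) \<and>
     \<comment> \<open>G* with projection onto K and a regular G-action on each stalk\<close>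
     (\<forall>x u. R PiG [x, u] \<longrightarrow> x \<in> Gs \<and> u \<in> K) \<and>
     (\<forall>x \<in> Gs. \<exists>!u. R PiG [x, u]) \<and>
     (\<forall>u \<in> K. \<exists>x \<in> Gs. piG M x = u) \<and>
     (\<forall>g x x'. R ActG [g, x, x'] \<longrightarrow> g \<in> G \<and> x \<in> Gs \<and> x' \<in> Gs \<and> piG M x' = piG M x) \<and>
     (\<forall>g \<in> G. \<forall>x \<in> Gs. \<exists>!x'. R ActG [g, x, x']) \<and>
     (\<forall>g \<in> G. \<forall>x \<in> Gs. (\<forall>u \<in> K. ev M g u = z) \<longrightarrow> R ActG [g, x, x]) \<and>
     (\<forall>g d e x x1 x2. R GAdd [g, d, e] \<longrightarrow> R ActG [d, x, x1] \<longrightarrow> R ActG [g, x1, x2]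
          \<longrightarrow> R ActG [e, x, x2]) \<and>
     (\<forall>x \<in> Gs. \<forall>x' \<in> Gs. piG M x = piG M x' \<longrightarrow> (\<exists>!g. g \<in> G \<and> R ActG [g, x, x'])) \<and>
     \<comment> \<open>H* with projection onto K and a regular Z_2-action on each stalk\<close>
     (\<forall>y u. R PiH [y, u] \<longrightarrow> y \<in> Hs \<and> u \<in> K) \<and>
     (\<forall>y \<in> Hs. \<exists>!u. R PiH [y, u]) \<and>
     (\<forall>u \<in> K. \<exists>y \<in> Hs. piH M y = u) \<and>
     (\<forall>m y y'. R ActH [m, y, y'] \<longrightarrow> m \<in> H \<and> y \<in> Hs \<and> y' \<in> Hs \<and> piH M y' = piH M y) \<and>
     (\<forall>m \<in> H. \<forall>y \<in> Hs. \<exists>!y'. R ActH [m, y, y']) \<and>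
     (\<forall>y \<in> Hs. R ActH [z, y, y]) \<and>
     (\<forall>a b c y y1 y2. R HAdd [a, b, c] \<longrightarrow> R ActH [b, y, y1] \<longrightarrow> R ActH [a, y1, y2]
          \<longrightarrow> R ActH [c, y, y2]) \<and>
     (\<forall>y \<in> Hs. \<forall>y' \<in> Hs. piH M y = piH M y' \<longrightarrow> (\<exists>!m. m \<in> H \<and> R ActH [m, y, y'])) \<and>
     \<comment> \<open>Q: symmetric in the first n arguments, only on compatible stalk indices\<close>
     (\<forall>xs y. R Qr (xs @ [y]) \<longrightarrow> set xs \<subseteq> Gs \<and> y \<in> Hs \<and>
          compatible n M (map (piG M) xs @ [piH M y])) \<and>
     (\<forall>xs \<sigma> y. length xs = n \<longrightarrow> \<sigma> permutes {..<n} \<longrightarrow>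
          (R Qr (xs @ [y]) \<longleftrightarrow> R Qr (map (\<lambda>l. xs ! \<sigma> l) [0..<n] @ [y]))) \<and>
     \<comment> \<open>the twisting condition\<close>
     (\<forall>xs y gs m xs' y'. length xs = n \<longrightarrow> set xs \<subseteq> Gs \<longrightarrow> y \<in> Hs \<longrightarrow>
          compatible n M (map (piG M) xs @ [piH M y]) \<longrightarrow>
          length gs = n \<longrightarrow> set gs \<subseteq> G \<longrightarrow> m \<in> H \<longrightarrow> length xs' = n \<longrightarrow>
          (\<forall>l < n. R ActG [gs ! l, xs ! l, xs' ! l]) \<longrightarrow> R ActH [m, y, y'] \<longrightarrow>
          ((R Qr (xs @ [y]) \<longleftrightarrow> R Qr (xs' @ [y'])) \<longleftrightarrow>
           even (card {l. l < n \<and> ev M (gs ! l) (piH M y) \<noteq> z} + (if m = z then 0 else 1))))))"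

definition Klam :: "nat \<Rightarrow> nat \<Rightarrow> 'a hstr \<Rightarrow> bool" where
  "Klam n k M \<longleftrightarrow> hs_model n M \<and> isAleph k (carrier M)"

definition fixes_on :: "('a \<Rightarrow> 'a) \<Rightarrow> 'a hstr \<Rightarrow> bool" where
  "fixes_on f M \<longleftrightarrow> (\<forall>x \<in> carrier M. f x = x)"

text \<open>Atomic equivalence of triples (a, M, N), (b, M, N') over M inside K_lambda;
  Galois types are its transitive closure.\<close>
definition Eat :: "nat \<Rightarrow> nat \<Rightarrow> 'a hstr \<Rightarrow> ('a hstr \<times> 'a) \<Rightarrow> ('a hstr \<times> 'a) \<Rightarrow> bool" where
  "Eat n k M p q \<longleftrightarrow> (case p of (N, a) \<Rightarrow> case q of (N', b) \<Rightarrow>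
     Klam n k M \<and> Klam n k N \<and> Klam n k N' \<and> elem_sub M N \<and> elem_sub M N' \<and>
     a \<in> carrier N \<and> b \<in> carrier N' \<and>
     (\<exists>N'' f g. Klam n k N'' \<and> elem_emb f N N'' \<and> elem_emb g N' N'' \<and>
        fixes_on f M \<and> fixes_on g M \<and> f a = g b))"

definition gtp_eq :: "nat \<Rightarrow> nat \<Rightarrow> 'a hstr \<Rightarrow> 'a hstr \<Rightarrow> 'a \<Rightarrow> 'a hstr \<Rightarrow> 'a \<Rightarrow> bool" where
  "gtp_eq n k M N a N' b \<longleftrightarrow> (Eat n k M)\<^sup>+\<^sup>+ (N, a) (N', b)"

definition basic :: "nat \<Rightarrow> nat \<Rightarrow> 'a hstr \<Rightarrow> 'a hstr \<Rightarrow> 'a \<Rightarrow> bool" where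
  "basic n k M N a \<longleftrightarrow> (\<exists>N' c. Klam n k N' \<and> elem_sub M N' \<and>
      c \<in> srt N' SI - srt M SI \<and> gtp_eq n k M N a N' c)"

definition nonfork :: "nat \<Rightarrow> nat \<Rightarrow> 'a hstr \<Rightarrow> 'a hstr \<Rightarrow> 'a hstr \<Rightarrow> 'a \<Rightarrow> bool" where
  "nonfork n k M0 M1 M2 a \<longleftrightarrow> Klam n k M0 \<and> Klam n k M1 \<and> Klam n k M2 \<and>
     elem_sub M0 M1 \<and> elem_sub M1 M2 \<and> a \<in> srt M2 SI - srt M1 SI"

definition amalgam :: "nat \<Rightarrow> nat \<Rightarrow> 'a hstr \<Rightarrow> 'a hstr \<Rightarrow> 'a \<Rightarrow> 'a hstr \<Rightarrow>
    ('a \<Rightarrow> 'a) \<Rightarrow> ('a \<Rightarrow> 'a) \<Rightarrow> 'a hstr \<Rightarrow> bool" where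
  "amalgam n k M N a M1 f1 f2 N1 \<longleftrightarrow> Klam n k N1 \<and>
     elem_emb f1 N N1 \<and> elem_emb f2 M1 N1 \<and> fixes_on f1 M \<and> fixes_on f2 M \<and>
     nonfork n k M (img f2 M1) N1 (f1 a)"

definition amalgam_equiv :: "nat \<Rightarrow> nat \<Rightarrow> 'a hstr \<Rightarrow> 'a hstr \<Rightarrow>
    ('a \<Rightarrow> 'a) \<Rightarrow> ('a \<Rightarrow> 'a) \<Rightarrow> 'a hstr \<Rightarrow> ('a \<Rightarrow> 'a) \<Rightarrow> ('a \<Rightarrow> 'a) \<Rightarrow> 'a hstr \<Rightarrow> bool" where
  "amalgam_equiv n k N M1 fa1 fa2 Na fb1 fb2 Nb \<longleftrightarrow>
     (\<exists>Ns ga gb. Klam n k Ns \<and> elem_emb ga Na Ns \<and> elem_emb gb Nb Ns \<and>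
        (\<forall>x \<in> carrier N. ga (fa1 x) = gb (fb1 x)) \<and>
        (\<forall>x \<in> carrier M1. ga (fa2 x) = gb (fb2 x)))"

definition uniq_triple :: "nat \<Rightarrow> nat \<Rightarrow> 'a \<Rightarrow> 'a hstr \<Rightarrow> 'a hstr \<Rightarrow> bool" where
  "uniq_triple n k a M N \<longleftrightarrow> Klam n k M \<and> Klam n k N \<and> elem_sub M N \<and>
     a \<in> carrier N - carrier M \<and> basic n k M N a \<and>
     (\<forall>M1. Klam n k M1 \<and> elem_sub M M1 \<longrightarrow>
        (\<exists>f1 f2 N1. amalgam n k M N a M1 f1 f2 N1) \<and>
        (\<forall>fa1 fa2 Na fb1 fb2 Nb. amalgam n k M N a M1 fa1 fa2 Na \<longrightarrow>
            amalgam n k M N a M1 fb1 fb2 Nb \<longrightarrow>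
            amalgam_equiv n k N M1 fa1 fa2 Na fb1 fb2 Nb))"

definition weakly_successful :: "nat \<Rightarrow> nat \<Rightarrow> 'a itself \<Rightarrow> bool" where
  "weakly_successful n k (_ :: 'a itself) \<longleftrightarrow>
     (\<forall>(M :: 'a hstr) N a. Klam n k M \<and> Klam n k N \<and> elem_sub M N \<and>
        a \<in> srt N SI - srt M SI \<longrightarrow>
        (\<exists>N' b. uniq_triple n k b M N' \<and> gtp_eq n k M N a N' b))"

end

(*
The models of the class over I are classified by parities attached to pairs (w, v) with v < w,
|v| = n, |w| = n + 1: choosing a point x u in every G*-stalk and y v in every H*-stalk, the parity at
(w, v) is the truth value of Q at the x u (u < w, u # v) and y v. Replacing x u by a G-translate
changes the parity at (w, v) by the value of the translation at v, and translations have finite support.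

Let M be the standard model on an index set X of size aleph_(n-3), let (d, M, N) be a uniqueness
triple, and let M1 be the standard model on X and two further indices b, b'. Consider an amalgam P
of N and M1. If b is identified with an element of N, composing M1 -> P with the automorphism of M1
exchanging b and b' gives an inequivalent amalgam. Otherwise let p, q be the images of d and b, fix
i1 in X, and flip Q at all pairs (w, w - {i1}) with p, q, i1 in w. The result is again an amalgam: for
finitely many indices any prescribed change of parities is realised by translations, so a
back-and-forth argument shows that the two embeddings stay L_(omega_1,omega)-elementary. An
equivalence of the two amalgams would realise the flip by translations that are trivial on every x u
with u not containing both p and q. For v = r + {p, q}, comparing the equations at (v + {i0}, v) and
(v + {i1}, v) yields some j in r for which a translation at r - {j} + {p, q, i0} or r - {j} + {p, q, i1}
is nonzero at v. So no (n-2)-subset r of X is free for the finite-valued function on [X]^(n-3) given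
by the supports of these translations, contrary to Kuratowski's free set theorem.
*)
theory Submission
  imports Defs "HOL-Library.FSet"
begin

unbundle cardinal_syntax

section \<open>Cardinality and parity\<close>

text \<open>The amalgam P that a uniqueness triple supplies is arbitrary: N need not be standard, P
  may have further indices, and nothing is known about the truth values of Q on it. So the second
  amalgam is a modification of P and not a new construction: same carrier, same \<open>f1\<close>
  and \<open>f2\<close>, another Q. The image of N misses q and the image of M1 misses p, so a pair
  (w, v) with p, q in w is not seen from either image alone, and formulas with parameters in one
  image cannot detect the flip. Finitely supported translations realise the flip over each finite
  set of indices but not over X, p, q together. The free set theorem separates the two and fixes the
  cardinal: r + {p, q} has to be an index of size n, so r has n - 2 elements, and a free set of that
  size for a function on (n-3)-subsets is found in a set of size aleph_(n-3). Two points i0 and i1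
  occur because the action of Z_2 on H* can absorb any flip that depends on v alone; the flip must
  tell apart two sets w over the same v.\<close>

lemma card_of_finite_subsets:
  assumes "infinite B"
  shows "|{s. finite s \<and> s \<subseteq> B}| \<le>o |B|"
proof -
  have *: "|{s. finite s \<and> s \<subseteq> B \<and> card s = k}| \<le>o |B|" for k
  proof (induction k)
    case 0
    have "{s. finite s \<and> s \<subseteq> B \<and> card s = 0} \<subseteq> {{}}" by auto
    then have "|{s. finite s \<and> s \<subseteq> B \<and> card s = 0}| \<le>o |{{} :: 'a set}|"
      by (rule card_of_mono1)
    also have "|{{} :: 'a set}| \<le>o |B|"
      using assms by (metis card_of_singl_ordLeq finite.emptyI)
    finally show ?case .
  next
    case (Suc k)
    let ?P = "{s. finite s \<and> s \<subseteq> B \<and> card s = k}"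
    have "{s. finite s \<and> s \<subseteq> B \<and> card s = Suc k} \<subseteq> (\<lambda>(x, s). insert x s) ` (B \<times> ?P)"
    proof
      fix s assume s: "s \<in> {s. finite s \<and> s \<subseteq> B \<and> card s = Suc k}"
      then obtain x s' where "s = insert x s'" "x \<notin> s'" "card s' = k"
        by (auto simp: card_Suc_eq)
      then show "s \<in> (\<lambda>(x, s). insert x s) ` (B \<times> ?P)" using s by force
    qed
    then have "|{s. finite s \<and> s \<subseteq> B \<and> card s = Suc k}| \<le>o |(\<lambda>(x, s). insert x s) ` (B \<times> ?P)|"
      by (rule card_of_mono1)
    also have "|(\<lambda>(x, s). insert x s) ` (B \<times> ?P)| \<le>o |B \<times> ?P|" by (rule card_of_image)
    also have "|B \<times> ?P| \<le>o |B|"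
      by (rule card_of_Sigma_ordLeq_infinite[OF assms card_of_mono1[OF subset_refl] ballI[OF Suc]])
    finally show ?case .
  qed
  have "{s. finite s \<and> s \<subseteq> B} = (\<Union>k \<in> UNIV. {s. finite s \<and> s \<subseteq> B \<and> card s = k})" by auto
  also have "|\<dots>| \<le>o |B|"
    by (rule card_of_UNION_ordLeq_infinite[OF assms]) (use * assms infinite_iff_card_of_nat in auto)
  finally show ?thesis .
qed

lemma isAleph_infinite: "isAleph k A \<Longrightarrow> infinite A"
proof (induction k arbitrary: A)
  case 0
  then show ?case
    using card_of_ordIso_finite card_of_nat ordIso_symmetric ordIso_transitive
    by (metis infinite_UNIV_nat isAleph.simps(1))
next
  case (Suc k)
  then obtain B where "B \<subseteq> A" "isAleph k B" by auto
  then show ?case using Suc.IH infinite_super by blast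
qed

lemma isAleph_cong: "isAleph k A \<Longrightarrow> |A| =o |B| \<Longrightarrow> isAleph k B"
proof (induction k arbitrary: A B)
  case 0
  then show ?case using ordIso_symmetric ordIso_transitive by (metis isAleph.simps(1))
next
  case (Suc k)
  obtain C where C: "C \<subseteq> A" "isAleph k C" "|A| =o cardSuc |C|" using Suc.prems by auto
  obtain f where f: "bij_betw f A B" using Suc.prems card_of_ordIso by metis
  have "bij_betw f C (f ` C)" using C f by (meson bij_betw_subset subset_refl)
  then have fC: "|C| =o |f ` C|" using card_of_ordIso by blast
  have "isAleph k (f ` C)" by (rule Suc.IH[OF C(2) fC])
  moreover have "f ` C \<subseteq> B" using f C by (auto simp: bij_betw_def)
  moreover have "|B| =o cardSuc |f ` C|"
  proof -
    have "|B| =o |A|" using Suc.prems ordIso_symmetric by blast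
    also have "|A| =o cardSuc |C|" by (rule C(3))
    also have "cardSuc |C| =o cardSuc |f ` C|"
      by (rule iffD2[OF cardSuc_invar_ordIso[OF card_of_Card_order card_of_Card_order] fC])
    finally show ?thesis .
  qed
  ultimately show ?case by auto
qed

text \<open>Makes room for the auxiliary indices: a, b, b' are taken out of the index set and i0, i1
  out of X without lowering the aleph.\<close>

lemma isAleph_Diff_finite:
  assumes "isAleph k A" "finite F"
  shows "isAleph k (A - F)"
proof (rule isAleph_cong[OF assms(1)])
  have inf: "infinite (A - F)" using isAleph_infinite[OF assms(1)] assms(2) by simp
  have F: "|F| \<le>o |A - F|"
    by (rule ordLess_imp_ordLeq, rule finite_ordLess_infinite[OF card_of_Well_order card_of_Well_order])
      (use assms(2) inf in \<open>simp_all add: Field_card_of\<close>)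
  have "|A| \<le>o |(A - F) \<union> F|" by (rule card_of_mono1) auto
  also have "|(A - F) \<union> F| \<le>o |A - F|"
    by (intro card_of_Un_ordLeq_infinite_Field[OF _ card_of_mono1[OF subset_refl] F card_of_Card_order])
      (use inf in \<open>simp add: Field_card_of\<close>)
  finally have "|A| \<le>o |A - F|" .
  moreover have "|A - F| \<le>o |A|" by (rule card_of_mono1) auto
  ultimately show "|A| =o |A - F|" using ordIso_iff_ordLeq by blast
qed

text \<open>One direction of Kuratowski's free set theorem.\<close>
lemma isAleph_free_set:
  assumes "isAleph m X" and "\<And>s. finite (F s)"
  shows "\<exists>r \<subseteq> X. card r = Suc m \<and> (\<forall>j \<in> r. j \<notin> F (r - {j}))"
  using assms
proof (induction m arbitrary: X F)
  case 0
  then have "infinite X" using isAleph_infinite by blast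
  then obtain x where "x \<in> X" "x \<notin> F {}" using 0 by (meson finite_subset subsetI)
  then show ?case by (intro exI[of _ "{x}"]) auto
next
  case (Suc m)
  obtain B where B: "B \<subseteq> X" "isAleph m B" "|X| =o cardSuc |B|" using Suc.prems by auto
  have inf: "infinite B" using B isAleph_infinite by blast
  \<comment> \<open>Add to \<open>B\<close> the values of \<open>F\<close> at its finite subsets.
    The union still has size |B| < |X|, so some \<open>x\<close> outside of it is free over every
    finite subset of \<open>B\<close>.\<close>
  let ?U = "B \<union> (\<Union>s \<in> {s. finite s \<and> s \<subseteq> B}. F s)"
  have F: "|F s| \<le>o |B|" for s
    by (rule ordLess_imp_ordLeq, rule finite_ordLess_infinite[OF card_of_Well_order card_of_Well_order])
      (use Suc.prems inf in \<open>simp_all add: Field_card_of\<close>)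
  have "|\<Union>s \<in> {s. finite s \<and> s \<subseteq> B}. F s| \<le>o |B|"
    by (rule card_of_UNION_ordLeq_infinite[OF inf card_of_finite_subsets[OF inf]]) (use F in auto)
  then have U: "|?U| \<le>o |B|"
    by (intro card_of_Un_ordLeq_infinite_Field[OF _ card_of_mono1[OF subset_refl] _ card_of_Card_order])
      (use inf in \<open>simp_all add: Field_card_of\<close>)
  have "|B| <o |X|"
    using cardSuc_greater[OF card_of_Card_order] ordIso_symmetric[OF B(3)]
    by (rule ordLess_ordIso_trans)
  with U have "|?U| <o |X|" by (rule ordLeq_ordLess_trans)
  then have "\<not> X \<subseteq> ?U"
    using card_of_mono1 not_ordLess_ordLeq by blast
  then obtain x where x: "x \<in> X" "x \<notin> B" "\<And>s. finite s \<Longrightarrow> s \<subseteq> B \<Longrightarrow> x \<notin> F s" by auto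
  \<comment> \<open>Once \<open>x\<close> joins the set, every other \<open>j\<close> has to be free
    over a set containing \<open>x\<close>; hence the induction hypothesis is used for the function
    with \<open>x\<close> built in.\<close>
  obtain r where r: "r \<subseteq> B" "card r = Suc m" "\<forall>j \<in> r. j \<notin> F (insert x (r - {j}))"
    using Suc.IH[OF B(2), of "\<lambda>s. F (insert x s)"] Suc.prems by auto
  have fin: "finite r" using r card.infinite by fastforce
  have xr: "x \<notin> r" using x r by auto
  show ?case
  proof (intro exI[of _ "insert x r"] conjI ballI)
    show "insert x r \<subseteq> X" using r B x by auto
    show "card (insert x r) = Suc (Suc m)" using fin xr r by simp
    fix j assume "j \<in> insert x r"
    then consider "j = x" | "j \<in> r" "j \<noteq> x" by auto
    then show "j \<notin> F (insert x r - {j})"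
    proof cases
      case 1
      then show ?thesis using x(3)[OF fin r(1)] xr by simp
    next
      case 2
      then have "insert x r - {j} = insert x (r - {j})" by auto
      then show ?thesis using r 2 by simp
    qed
  qed
qed

text \<open>\<open>D u\<close> is the support of a translation of the stalk at u, and
  \<open>c w v\<close> says whether Q is to change at (w, v). The count runs over the stalks of G*
  that enter Q at (w, v); by the twisting condition its parity is the change that the translations
  cause. The index v is left out because it belongs to the argument from H*.\<close>

definition parity_solution ::
    "nat \<Rightarrow> ('i set \<Rightarrow> 'i set \<Rightarrow> bool) \<Rightarrow> ('i set \<Rightarrow> 'i set set) \<Rightarrow> 'i set \<Rightarrow> bool" where
  "parity_solution n c D W \<longleftrightarrow> (\<forall>w v. w \<subseteq> W \<longrightarrow> finite w \<longrightarrow> card w = Suc n \<longrightarrow> v \<subseteq> w \<longrightarrow> card v = n \<longrightarrow>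
     (c w v \<longleftrightarrow> odd (card {u. u \<subseteq> w \<and> card u = n \<and> u \<noteq> v \<and> v \<in> D u})))"

text \<open>The equation for \<open>(w, v)\<close> can be corrected through any \<open>u \<subseteq> w\<close> that is not
  contained in \<open>W\<close>; no two equations compete, because \<open>w = u \<union> v\<close>.\<close>
lemma parity_solution_extend:
  assumes n: "2 \<le> n" and fin: "finite W'" and W: "W \<subseteq> W'"
    and sol: "parity_solution n c D W" and D: "\<forall>u. finite (D u)"
  obtains D' where "parity_solution n c D' W'" "\<And>u. u \<subseteq> W \<Longrightarrow> D' u = D u" "\<forall>u. finite (D' u)"
proof -
  define F where "F w v = (SOME u. u \<subseteq> w \<and> card u = n \<and> u \<noteq> v \<and> \<not> u \<subseteq> W)" for w v
  have F: "F w v \<subseteq> w \<and> card (F w v) = n \<and> F w v \<noteq> v \<and> \<not> F w v \<subseteq> W"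
    if w: "finite w" "card w = Suc n" "\<not> w \<subseteq> W" for w v
  proof -
    obtain p where p: "p \<in> w" "p \<notin> W" using w by auto
    have "card (w - {p}) = n" using w p by simp
    \<comment> \<open>Both \<open>w - {j}\<close> and \<open>w - {k}\<close> keep \<open>p\<close>,
      hence are not contained in \<open>W\<close>, and \<open>v\<close> equals at most one of them.
      Two points besides \<open>p\<close> exist because n is at least 2.\<close>
    then obtain j where j: "j \<in> w - {p}"
      using n by (metis card.empty all_not_in_conv not_numeral_le_zero)
    have "card (w - {p} - {j}) = n - 1" using j \<open>card (w - {p}) = n\<close> w by simp
    then have "w - {p} - {j} \<noteq> {}" using n by (metis card.empty diff_is_0_eq not_less_eq_eq numeral_2_eq_2 One_nat_def)
    then obtain k where "k \<in> w - {p} - {j}" by auto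
    with j have jk: "j \<in> w" "k \<in> w" "j \<noteq> p" "k \<noteq> p" "j \<noteq> k" by auto
    then have "w - {j} \<noteq> w - {k}" by auto
    then obtain i where "i \<in> {j, k}" "w - {i} \<noteq> v" by (cases "w - {j} = v") auto
    then have "w - {i} \<subseteq> w \<and> card (w - {i}) = n \<and> w - {i} \<noteq> v \<and> \<not> w - {i} \<subseteq> W"
      using jk p w by auto
    then show ?thesis unfolding F_def by (rule someI)
  qed
  let ?old = "\<lambda>w v. {u. u \<subseteq> w \<and> card u = n \<and> u \<noteq> v \<and> u \<subseteq> W \<and> v \<in> D u}"
  \<comment> \<open>A new \<open>u\<close> becomes nonzero at \<open>v\<close> only if it is the
    chosen corrector for \<open>(u \<union> v, v)\<close> and the indices inside \<open>W\<close>
    give the wrong parity there. Restricting \<open>v\<close> to subsets of \<open>W'\<close> keeps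
    the support finite.\<close>
  define D' where "D' u = (if u \<subseteq> W then D u else
      {v. v \<subseteq> W' \<and> card v = n \<and> card (u \<union> v) = Suc n \<and> u = F (u \<union> v) v \<and>
          (c (u \<union> v) v \<longleftrightarrow> even (card (?old (u \<union> v) v)))})" for u
  have "parity_solution n c D' W'"
    unfolding parity_solution_def
  proof (intro allI impI)
    fix w v assume w: "w \<subseteq> W'" "finite w" "card w = Suc n" and v: "v \<subseteq> w" "card v = n"
    show "c w v \<longleftrightarrow> odd (card {u. u \<subseteq> w \<and> card u = n \<and> u \<noteq> v \<and> v \<in> D' u})"
    proof (cases "w \<subseteq> W")
      case True
      then have "{u. u \<subseteq> w \<and> card u = n \<and> u \<noteq> v \<and> v \<in> D' u} =
          {u. u \<subseteq> w \<and> card u = n \<and> u \<noteq> v \<and> v \<in> D u}"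
        unfolding D'_def by auto
      then show ?thesis using sol True w v unfolding parity_solution_def by auto
    next
      case False
      note Fw = F[OF w(2,3) False, of v]
      have un: "u \<union> v = w" if "u \<subseteq> w" "card u = n" "u \<noteq> v" for u
      proof -
        have fu: "finite u" "finite v" using that v w finite_subset by blast+
        have "\<not> u \<subseteq> v" using that v fu card_subset_eq by metis
        then have "v \<subset> u \<union> v" by auto
        then have "card v < card (u \<union> v)" using fu by (simp add: psubset_card_mono)
        then show ?thesis
          using card_seteq[of w "u \<union> v"] that v w by auto
      qed
      let ?b = "c w v \<longleftrightarrow> even (card (?old w v))"
      have "{u. u \<subseteq> w \<and> card u = n \<and> u \<noteq> v \<and> v \<in> D' u} =
          ?old w v \<union> (if ?b then {F w v} else {})" (is "?L = ?R")
      proof (rule set_eqI)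
        fix u
        show "u \<in> ?L \<longleftrightarrow> u \<in> ?R"
        proof (cases "u \<subseteq> w \<and> card u = n \<and> u \<noteq> v")
          case True
          then have "u \<union> v = w" using un by blast
          then show ?thesis using True Fw v w unfolding D'_def by auto
        next
          case False
          then show ?thesis using Fw by auto
        qed
      qed
      moreover have "finite (?old w v)"
        using w by (auto intro: finite_subset[of _ "Pow w"])
      moreover have "F w v \<notin> ?old w v" using Fw by auto
      ultimately show ?thesis by auto
    qed
  qed
  moreover have "finite (D' u)" for u
  proof -
    have "{v. v \<subseteq> W' \<and> P v} \<subseteq> Pow W'" for P by auto
    then show ?thesis unfolding D'_def using D fin
      by (auto intro: finite_subset[of _ "Pow W'"])
  qed
  ultimately show ?thesis using that[of D'] unfolding D'_def by auto
qed

text \<open>\<open>D A\<close> is the support of the translation at \<open>A\<close>; \<open>par\<close> accounts for the action of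
  \<open>H\<close> on the stalks of \<open>H*\<close>, which depends on \<open>v\<close> only and hence cancels between
  \<open>v \<union> {i0}\<close> and \<open>v \<union> {i1}\<close>.\<close>
lemma no_parity_solution:
  fixes D :: "'i set \<Rightarrow> 'i set set" and par :: "'i set \<Rightarrow> nat"
  assumes n: "3 \<le> n" and X: "isAleph (n - 3) (X - {i0, i1})" and i: "i0 \<in> X" "i1 \<in> X" "i0 \<noteq> i1"
    and pq: "p \<notin> X" "q \<notin> X" "p \<noteq> q"
    and fin: "\<And>A. finite (D A)" and mixed: "\<And>A. D A \<noteq> {} \<Longrightarrow> p \<in> A \<and> q \<in> A"
    and eq: "\<And>w v. w \<subseteq> insert p (insert q X) \<Longrightarrow> finite w \<Longrightarrow> card w = Suc n \<Longrightarrow> v \<subseteq> w \<Longrightarrow> card v = n \<Longrightarrow>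
      (p \<in> w \<and> q \<in> w \<and> i1 \<in> w \<and> v = w - {i1}) \<longleftrightarrow>
        odd (card {A. A \<subseteq> w \<and> card A = n \<and> A \<noteq> v \<and> v \<in> D A} + par v)"
  shows False
proof -
  let ?B = "\<lambda>s. insert p (insert q s)"
  \<comment> \<open>\<open>F s\<close> collects the \<open>j\<close> that would spoil the
    comparison: some translation at \<open>s\<close>, p, q and one of i0, i1 is nonzero at the index
    formed by \<open>s\<close>, p, q and \<open>j\<close>. It is finite because \<open>j\<close> can
    be read off from that index.\<close>
  define F where "F s = {j. j \<notin> ?B s \<and> (\<exists>\<epsilon> \<in> {i0, i1}. insert j (?B s) \<in> D (insert \<epsilon> (?B s)))}" for s
  have "finite (F s)" for s
  proof -
    have "(\<lambda>j. insert j (?B s)) ` F s \<subseteq> D (insert i0 (?B s)) \<union> D (insert i1 (?B s))"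
      unfolding F_def by auto
    then have "finite ((\<lambda>j. insert j (?B s)) ` F s)" by (rule finite_subset) (simp add: fin)
    moreover have "inj_on (\<lambda>j. insert j (?B s)) (F s)"
    proof (rule inj_onI)
      fix i j assume "i \<in> F s" "insert i (?B s) = insert j (?B s)"
      then have "i \<notin> ?B s" "i \<in> insert j (?B s)" unfolding F_def by blast+
      then show "i = j" by simp
    qed
    ultimately show ?thesis by (rule finite_imageD)
  qed
  then have "\<exists>r \<subseteq> X - {i0, i1}. card r = Suc (n - 3) \<and> (\<forall>j \<in> r. j \<notin> F (r - {j}))"
    by (rule isAleph_free_set[OF X])
  then obtain r where r: "r \<subseteq> X - {i0, i1}" "card r = Suc (n - 3)" "\<forall>j \<in> r. j \<notin> F (r - {j})"
    by (elim exE conjE)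
  have fr: "finite r" using r(2) card.infinite by fastforce
  let ?v = "?B r"
  have v: "finite ?v" "card ?v = n" using fr r(1,2) pq n by (auto simp: card_insert_if)
  \<comment> \<open>A contributing \<open>A\<close> contains \<epsilon> and omits exactly one
    \<open>j\<close> of \<open>?v\<close>. It contains p and q by \<open>mixed\<close>, so
    \<open>j\<close> lies in \<open>r\<close> and would belong to \<open>F (r - {j})\<close>,
    against freeness.\<close>
  have *: "{A. A \<subseteq> insert \<epsilon> ?v \<and> card A = n \<and> A \<noteq> ?v \<and> ?v \<in> D A} = {}" if \<epsilon>: "\<epsilon> \<in> {i0, i1}" for \<epsilon>
  proof (rule ccontr)
    assume "\<not> ?thesis"
    then obtain A where A: "A \<subseteq> insert \<epsilon> ?v" "card A = n" "A \<noteq> ?v" "?v \<in> D A" by auto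
    have \<epsilon>v: "\<epsilon> \<notin> ?v" using \<epsilon> r(1) i pq by auto
    have "finite A" by (rule finite_subset[OF A(1)]) (simp add: fr)
    have "\<epsilon> \<in> A"
    proof (rule ccontr)
      assume "\<epsilon> \<notin> A"
      then have "A \<subseteq> ?v" using A(1) by blast
      then show False using card_subset_eq[OF v(1)] A(2,3) v(2) by simp
    qed
    have "\<not> ?v \<subseteq> A"
    proof
      assume "?v \<subseteq> A"
      then have "card (insert \<epsilon> ?v) \<le> card A" using \<open>\<epsilon> \<in> A\<close> by (intro card_mono[OF \<open>finite A\<close>]) auto
      then show False using \<epsilon>v v A(2) by simp
    qed
    then obtain j where j: "j \<in> ?v" "j \<notin> A" by blast
    have "p \<in> A" "q \<in> A" using mixed[of A] A(4) by auto
    then have jr: "j \<in> r" using j by auto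
    have "A \<subseteq> insert \<epsilon> ?v - {j}" using A(1) j by blast
    moreover have "card (insert \<epsilon> ?v - {j}) = n" using j(1) \<epsilon>v v by auto
    ultimately have "A = insert \<epsilon> ?v - {j}" using card_subset_eq[of "insert \<epsilon> ?v - {j}" A] v(1) A(2) by simp
    also have "\<dots> = insert \<epsilon> (?B (r - {j}))" using jr r(1) pq \<epsilon> by auto
    finally have A': "A = insert \<epsilon> (?B (r - {j}))" .
    have "?v = insert j (?B (r - {j}))" using jr by auto
    then have "insert j (?B (r - {j})) \<in> D (insert \<epsilon> (?B (r - {j})))" using A(4) A' by simp
    moreover have "j \<notin> ?B (r - {j})" using jr r(1) pq by auto
    ultimately have "j \<in> F (r - {j})" unfolding F_def using \<epsilon> by blast
    then show False using r(3) jr by blast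
  qed
  \<comment> \<open>With no contributions left, a flip at (v + \<epsilon>, v) is equivalent to
    \<open>par ?v\<close> being odd. That side is the same for i0 and i1, whereas the flip occurs
    for i1 only.\<close>
  have e: "(p \<in> insert \<epsilon> ?v \<and> q \<in> insert \<epsilon> ?v \<and> i1 \<in> insert \<epsilon> ?v \<and> ?v = insert \<epsilon> ?v - {i1}) \<longleftrightarrow> odd (par ?v)"
    if \<epsilon>: "\<epsilon> \<in> {i0, i1}" for \<epsilon>
  proof -
    have "\<epsilon> \<notin> ?v" using \<epsilon> r(1) i pq by auto
    then have "card (insert \<epsilon> ?v) = Suc n" using v by simp
    moreover have "insert \<epsilon> ?v \<subseteq> insert p (insert q X)" using r(1) \<epsilon> i by auto
    ultimately show ?thesis using eq[of "insert \<epsilon> ?v" ?v] v *[OF \<epsilon>] by auto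
  qed
  have "i1 \<notin> insert i0 ?v" using r(1) i pq by auto
  moreover have "?v = insert i1 ?v - {i1}" using r(1) i pq by auto
  ultimately show False using e[of i0] e[of i1] by auto
qed

section \<open>Infinitary elementary equivalence\<close>

lemma sat_cong: "(\<And>i. i \<in> fv \<phi> \<Longrightarrow> s i = t i) \<Longrightarrow> sat M \<phi> s \<longleftrightarrow> sat M \<phi> t"
proof (induction \<phi> arbitrary: s t)
  case (Atom R vs)
  then have "map s vs = map t vs" by auto
  then show ?case by (simp only: sat.simps)
next
  case (BigConj F)
  then have "sat M (F i) s \<longleftrightarrow> sat M (F i) t" for i by (metis UN_I UNIV_I fv.simps(4) rangeI)
  then show ?case by simp
next
  case (Exi x \<phi>)
  then have "sat M \<phi> (s(x := a)) \<longleftrightarrow> sat M \<phi> (t(x := a))" for a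
    by (intro Exi.IH) auto
  then show ?case by simp
next
  case (Neg \<phi>)
  have "sat M \<phi> s \<longleftrightarrow> sat M \<phi> t" by (rule Neg.IH) (use Neg.prems in simp)
  then show ?case by simp
qed simp

text \<open>Domains may be infinite, but an extension has to agree with the old map only on a finite
  \<open>Y\<close>. This suffices because a formula with finitely many free variables has only such
  subformulas, so at each quantifier just finitely many values of the assignment are at stake. The
  maps \<open>lift \<pi>\<close> between standard models do change elsewhere.\<close>

lemma back_and_forth:
  assumes F: "\<And>X h. (X, h) \<in> F \<Longrightarrow> inj_on h X \<and>
      (\<forall>R xs. set xs \<subseteq> X \<longrightarrow> (rel M R xs \<longleftrightarrow> rel N R (map h xs)))"
    and fwd: "\<And>X h Y a. (X, h) \<in> F \<Longrightarrow> finite Y \<Longrightarrow> Y \<subseteq> X \<Longrightarrow> a \<in> carrier M \<Longrightarrow>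
      \<exists>X' h'. (X', h') \<in> F \<and> insert a Y \<subseteq> X' \<and> (\<forall>y \<in> Y. h' y = h y) \<and> h' a \<in> carrier N"
    and bwd: "\<And>X h Y b. (X, h) \<in> F \<Longrightarrow> finite Y \<Longrightarrow> Y \<subseteq> X \<Longrightarrow> b \<in> carrier N \<Longrightarrow>
      \<exists>X' h' a. (X', h') \<in> F \<and> insert a Y \<subseteq> X' \<and> (\<forall>y \<in> Y. h' y = h y) \<and> a \<in> carrier M \<and> h' a = b"
    and "finite (fv \<phi>)" "(X, h) \<in> F" "s ` fv \<phi> \<subseteq> X"
  shows "sat M \<phi> s \<longleftrightarrow> sat N \<phi> (h \<circ> s)"
  using assms(4-)
proof (induction \<phi> arbitrary: s X h)
  case (Atom R vs)
  then have "set (map s vs) \<subseteq> X" by auto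
  then have "rel M R (map s vs) \<longleftrightarrow> rel N R (map h (map s vs))" using F[OF Atom(2)] by blast
  then show ?case by (simp add: comp_def)
next
  case (Equ i j)
  then show ?case using F[OF Equ(2)] by (auto simp: inj_on_def)
next
  case (BigConj G)
  have "sat M (G i) s \<longleftrightarrow> sat N (G i) (h \<circ> s)" for i
  proof (rule BigConj.IH)
    have *: "fv (G i) \<subseteq> fv (BigConj G)" by auto
    show "finite (fv (G i))" using * BigConj.prems(1) by (rule finite_subset)
    show "s ` fv (G i) \<subseteq> X" using * BigConj.prems(3) by blast
  qed (use BigConj.prems in simp_all)
  then show ?case by (simp add: comp_def)
next
  case (Exi x \<phi>)
  let ?Y = "s ` (fv \<phi> - {x})"
  have Y: "finite ?Y" "?Y \<subseteq> X" and fin: "finite (fv \<phi>)" using Exi.prems by auto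
  have step: "sat M \<phi> (s(x := a)) \<longleftrightarrow> sat N \<phi> ((h \<circ> s)(x := h' a))"
    if h': "(X', h') \<in> F" "insert a ?Y \<subseteq> X'" "\<forall>y \<in> ?Y. h' y = h y" for X' h' a
  proof -
    have "sat M \<phi> (s(x := a)) \<longleftrightarrow> sat N \<phi> (h' \<circ> s(x := a))"
      by (rule Exi.IH[OF fin h'(1)]) (use h' in auto)
    also have "\<dots> \<longleftrightarrow> sat N \<phi> ((h \<circ> s)(x := h' a))"
      by (rule sat_cong) (use h' in auto)
    finally show ?thesis .
  qed
  show ?case
  proof
    assume "sat M (Exi x \<phi>) s"
    then obtain a where a: "a \<in> carrier M" "sat M \<phi> (s(x := a))" by auto
    obtain X' h' where "(X', h') \<in> F" "insert a ?Y \<subseteq> X'" "\<forall>y \<in> ?Y. h' y = h y" "h' a \<in> carrier N"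
      using fwd[OF Exi.prems(2) Y a(1)] by blast
    then show "sat N (Exi x \<phi>) (h \<circ> s)" using step a by fastforce
  next
    assume "sat N (Exi x \<phi>) (h \<circ> s)"
    then obtain b where b: "b \<in> carrier N" "sat N \<phi> ((h \<circ> s)(x := b))" by auto
    obtain X' h' a where "(X', h') \<in> F" "insert a ?Y \<subseteq> X'" "\<forall>y \<in> ?Y. h' y = h y"
        "a \<in> carrier M" "h' a = b"
      using bwd[OF Exi.prems(2) Y b(1)] by blast
    then show "sat M (Exi x \<phi>) s" using step b by fastforce
  qed
qed simp

definition embedding :: "('a \<Rightarrow> 'a) \<Rightarrow> ('a, 'r) str \<Rightarrow> ('a, 'r) str \<Rightarrow> bool" where
  "embedding f M N \<longleftrightarrow> f ` carrier M \<subseteq> carrier N \<and> inj_on f (carrier M) \<and>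
     (\<forall>R xs. set xs \<subseteq> carrier M \<longrightarrow> (rel M R xs \<longleftrightarrow> rel N R (map f xs)))"

lemma elem_emb_embedding:
  assumes "elem_emb f M N" "carrier M \<noteq> {}"
  shows "embedding f M N"
  unfolding embedding_def
proof (intro conjI allI impI)
  have sat: "sat M \<phi> s \<longleftrightarrow> sat N \<phi> (f \<circ> s)" if "finite (fv \<phi>)" "range s \<subseteq> carrier M" for \<phi> s
    using assms that unfolding elem_emb_def Lfm_def by blast
  show "f ` carrier M \<subseteq> carrier N" using assms unfolding elem_emb_def by blast
  show "inj_on f (carrier M)"
  proof (rule inj_onI)
    fix x y assume "x \<in> carrier M" "y \<in> carrier M" "f x = f y"
    then show "x = y"
      using sat[of "Equ 0 1" "\<lambda>i. if i = 0 then x else y"] by (auto split: if_splits)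
  qed
  fix R xs assume xs: "set xs \<subseteq> carrier M"
  obtain d where d: "d \<in> carrier M" using assms by auto
  \<comment> \<open>Assignments are total and must take all values in the carrier, so the variables
    beyond \<open>xs\<close> receive an arbitrary element \<open>d\<close>; hence the nonemptiness
    assumption.\<close>
  let ?s = "\<lambda>i. if i < length xs then xs ! i else d"
  have "range ?s \<subseteq> carrier M" using xs d by (auto dest: nth_mem)
  then have "sat M (Atom R [0..<length xs]) ?s \<longleftrightarrow> sat N (Atom R [0..<length xs]) (f \<circ> ?s)"
    by (intro sat) auto
  moreover have "map ?s [0..<length xs] = xs" by (auto intro: nth_equalityI)
  moreover have "map (f \<circ> ?s) [0..<length xs] = map f xs" by (auto intro: nth_equalityI)
  ultimately show "rel M R xs \<longleftrightarrow> rel N R (map f xs)" by simp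
qed

lemma elem_sub_iff_elem_emb: "elem_sub M N \<longleftrightarrow> elem_emb (\<lambda>x. x) M N"
  by (simp add: elem_sub_def elem_emb_def comp_def)

text \<open>An isomorphism alone is already a back-and-forth system.\<close>

lemma sat_isomorphism:
  assumes "bij_betw f (carrier M) (carrier N)"
    and "\<And>R xs. set xs \<subseteq> carrier M \<Longrightarrow> rel M R xs \<longleftrightarrow> rel N R (map f xs)"
    and "finite (fv \<phi>)" "s ` fv \<phi> \<subseteq> carrier M"
  shows "sat M \<phi> s \<longleftrightarrow> sat N \<phi> (f \<circ> s)"
proof (rule back_and_forth[where F = "{(carrier M, f)}"])
  show "\<exists>X' h' a. (X', h') \<in> {(carrier M, f)} \<and> insert a Y \<subseteq> X' \<and> (\<forall>y \<in> Y. h' y = h y) \<and>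
      a \<in> carrier M \<and> h' a = b"
    if "(X, h) \<in> {(carrier M, f)}" "Y \<subseteq> X" "b \<in> carrier N" for X h Y b
  proof -
    have "b \<in> f ` carrier M" using that(3) assms(1) by (simp add: bij_betw_def)
    then obtain a where "a \<in> carrier M" "f a = b" by blast
    then show ?thesis using that by auto
  qed
qed (use assms in \<open>auto simp: bij_betw_def\<close>)

section \<open>Members of the Hart-Shelah class and their elementary properties\<close>

locale hs =
  fixes n :: nat and M :: "'a hstr" and z one :: 'a
  assumes wf: "\<forall>S xs. rel M S xs \<longrightarrow> set xs \<subseteq> carrier M \<and> length xs = arity n S"
    and sorts: "\<forall>x \<in> carrier M. \<exists>!S \<in> {SI, SK, SH, SG, SGs, SHs}. rel M S [x]"
    and mem_sorts: "\<forall>i u. rel M Mem [i, u] \<longrightarrow> i \<in> srt M SI \<and> u \<in> srt M SK"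
    and mem_bij: "bij_betw (memset M) (srt M SK) {A. A \<subseteq> srt M SI \<and> finite A \<and> card A = n}"
    and z_one: "z \<noteq> one"
    and H: "srt M SH = {z, one}"
    and HAdd: "\<forall>a b c. rel M HAdd [a, b, c] \<longleftrightarrow>
      a \<in> srt M SH \<and> b \<in> srt M SH \<and> c = (if a = b then z else one)"
    and Eval_sorts: "\<forall>g u h. rel M Eval [g, u, h] \<longrightarrow> g \<in> srt M SG \<and> u \<in> srt M SK \<and> h \<in> srt M SH"
    and Eval_total: "\<forall>g \<in> srt M SG. \<forall>u \<in> srt M SK. \<exists>!h. rel M Eval [g, u, h]"
    and G_finite: "\<forall>g \<in> srt M SG. finite {u \<in> srt M SK. ev M g u \<noteq> z}"
    and G_full: "\<forall>f. (\<forall>u \<in> srt M SK. f u \<in> srt M SH) \<and> finite {u \<in> srt M SK. f u \<noteq> z} \<longrightarrow>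
      (\<exists>!g. g \<in> srt M SG \<and> (\<forall>u \<in> srt M SK. ev M g u = f u))"
    and Supp: "\<forall>g u. rel M Supp [g, u] \<longleftrightarrow> g \<in> srt M SG \<and> u \<in> srt M SK \<and> ev M g u \<noteq> z"
    and GAdd: "\<forall>g d e. rel M GAdd [g, d, e] \<longleftrightarrow> g \<in> srt M SG \<and> d \<in> srt M SG \<and> e \<in> srt M SG \<and>
      (\<forall>u \<in> srt M SK. rel M HAdd [ev M g u, ev M d u, ev M e u])"
    and PiG_sorts: "\<forall>x u. rel M PiG [x, u] \<longrightarrow> x \<in> srt M SGs \<and> u \<in> srt M SK"
    and PiG_total: "\<forall>x \<in> srt M SGs. \<exists>!u. rel M PiG [x, u]"
    and PiG_onto: "\<forall>u \<in> srt M SK. \<exists>x \<in> srt M SGs. piG M x = u"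
    and ActG_sorts: "\<forall>g x x'. rel M ActG [g, x, x'] \<longrightarrow>
      g \<in> srt M SG \<and> x \<in> srt M SGs \<and> x' \<in> srt M SGs \<and> piG M x' = piG M x"
    and ActG_total: "\<forall>g \<in> srt M SG. \<forall>x \<in> srt M SGs. \<exists>!x'. rel M ActG [g, x, x']"
    and ActG_zero: "\<forall>g \<in> srt M SG. \<forall>x \<in> srt M SGs. (\<forall>u \<in> srt M SK. ev M g u = z) \<longrightarrow>
      rel M ActG [g, x, x]"
    and ActG_add: "\<forall>g d e x x1 x2. rel M GAdd [g, d, e] \<longrightarrow> rel M ActG [d, x, x1] \<longrightarrow>
      rel M ActG [g, x1, x2] \<longrightarrow> rel M ActG [e, x, x2]"
    and ActG_regular: "\<forall>x \<in> srt M SGs. \<forall>x' \<in> srt M SGs. piG M x = piG M x' \<longrightarrow>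
      (\<exists>!g. g \<in> srt M SG \<and> rel M ActG [g, x, x'])"
    and PiH_sorts: "\<forall>y u. rel M PiH [y, u] \<longrightarrow> y \<in> srt M SHs \<and> u \<in> srt M SK"
    and PiH_total: "\<forall>y \<in> srt M SHs. \<exists>!u. rel M PiH [y, u]"
    and PiH_onto: "\<forall>u \<in> srt M SK. \<exists>y \<in> srt M SHs. piH M y = u"
    and ActH_sorts: "\<forall>m y y'. rel M ActH [m, y, y'] \<longrightarrow>
      m \<in> srt M SH \<and> y \<in> srt M SHs \<and> y' \<in> srt M SHs \<and> piH M y' = piH M y"
    and ActH_total: "\<forall>m \<in> srt M SH. \<forall>y \<in> srt M SHs. \<exists>!y'. rel M ActH [m, y, y']"
    and ActH_zero: "\<forall>y \<in> srt M SHs. rel M ActH [z, y, y]"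
    and ActH_add: "\<forall>a b c y y1 y2. rel M HAdd [a, b, c] \<longrightarrow> rel M ActH [b, y, y1] \<longrightarrow>
      rel M ActH [a, y1, y2] \<longrightarrow> rel M ActH [c, y, y2]"
    and ActH_regular: "\<forall>y \<in> srt M SHs. \<forall>y' \<in> srt M SHs. piH M y = piH M y' \<longrightarrow>
      (\<exists>!m. m \<in> srt M SH \<and> rel M ActH [m, y, y'])"
    and Q_compatible: "\<forall>xs y. rel M Qr (xs @ [y]) \<longrightarrow> set xs \<subseteq> srt M SGs \<and> y \<in> srt M SHs \<and>
      compatible n M (map (piG M) xs @ [piH M y])"
    and Q_symmetric: "\<forall>xs \<sigma> y. length xs = n \<longrightarrow> \<sigma> permutes {..<n} \<longrightarrow>
      (rel M Qr (xs @ [y]) \<longleftrightarrow> rel M Qr (map (\<lambda>l. xs ! \<sigma> l) [0..<n] @ [y]))"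
    and Q_twist: "\<forall>xs y gs m xs' y'. length xs = n \<longrightarrow> set xs \<subseteq> srt M SGs \<longrightarrow> y \<in> srt M SHs \<longrightarrow>
      compatible n M (map (piG M) xs @ [piH M y]) \<longrightarrow>
      length gs = n \<longrightarrow> set gs \<subseteq> srt M SG \<longrightarrow> m \<in> srt M SH \<longrightarrow> length xs' = n \<longrightarrow>
      (\<forall>l < n. rel M ActG [gs ! l, xs ! l, xs' ! l]) \<longrightarrow> rel M ActH [m, y, y'] \<longrightarrow>
      ((rel M Qr (xs @ [y]) \<longleftrightarrow> rel M Qr (xs' @ [y'])) \<longleftrightarrow>
       even (card {l. l < n \<and> ev M (gs ! l) (piH M y) \<noteq> z} + (if m = z then 0 else 1)))"

text \<open>\<open>hs_model\<close> hides the two elements of H behind a quantifier. With names for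
  them, several models, each with its own zero, can be interpreted side by side.\<close>

lemma hs_model_iff: "hs_model n M \<longleftrightarrow> (\<exists>z one. hs n M z one)"
  unfolding hs_model_def hs_def Let_def 
  by (rule iffI; elim exE conjE; intro exI conjI; assumption)

context hs
begin

lemma rel_carrier: "rel M S xs \<Longrightarrow> x \<in> set xs \<Longrightarrow> x \<in> carrier M"
  using wf by blast

lemma srtI: "rel M S [x] \<Longrightarrow> x \<in> srt M S"
  using wf by (fastforce simp: srt_def)

lemma srt_carrier: "x \<in> srt M S \<Longrightarrow> x \<in> carrier M"
  by (simp add: srt_def)

lemma carrier_nonempty: "carrier M \<noteq> {}"
  using H by (auto simp: srt_def)

lemma sort_disjoint:
  assumes "x \<in> srt M S" "x \<in> srt M T" "S \<in> {SI, SK, SH, SG, SGs, SHs}" "T \<in> {SI, SK, SH, SG, SGs, SHs}"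
  shows "S = T"
  using sorts assms unfolding srt_def by blast

lemma memset_sub: "u \<in> srt M SK \<Longrightarrow> memset M u \<subseteq> srt M SI"
  and memset_finite: "u \<in> srt M SK \<Longrightarrow> finite (memset M u)"
  and memset_card: "u \<in> srt M SK \<Longrightarrow> card (memset M u) = n"
  using mem_bij by (auto simp: bij_betw_def)

lemma memset_inj: "inj_on (memset M) (srt M SK)"
  using mem_bij by (simp add: bij_betw_def)

lemma memset_obtain:
  assumes "A \<subseteq> srt M SI" "finite A" "card A = n"
  obtains u where "u \<in> srt M SK" "memset M u = A"
proof -
  have "A \<in> memset M ` srt M SK" using mem_bij assms by (simp add: bij_betw_def)
  then show ?thesis using that by auto
qed

lemma piG_eq: "rel M PiG [x, u] \<Longrightarrow> piG M x = u"
  unfolding piG_def using PiG_total PiG_sorts by (metis (no_types, lifting) the_equality)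

lemma PiG_piG: "x \<in> srt M SGs \<Longrightarrow> rel M PiG [x, piG M x]"
  using PiG_total piG_eq by metis

lemma piG_K: "x \<in> srt M SGs \<Longrightarrow> piG M x \<in> srt M SK"
  using PiG_piG PiG_sorts by blast

lemma piH_eq: "rel M PiH [x, u] \<Longrightarrow> piH M x = u"
  unfolding piH_def using PiH_total PiH_sorts by (metis (no_types, lifting) the_equality)

lemma PiH_piH: "x \<in> srt M SHs \<Longrightarrow> rel M PiH [x, piH M x]"
  using PiH_total piH_eq by metis

lemma piH_K: "x \<in> srt M SHs \<Longrightarrow> piH M x \<in> srt M SK"
  using PiH_piH PiH_sorts by blast

lemma ev_H: "g \<in> srt M SG \<Longrightarrow> u \<in> srt M SK \<Longrightarrow> ev M g u = z \<or> ev M g u = one"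
proof -
  assume g: "g \<in> srt M SG" "u \<in> srt M SK"
  then have "\<exists>!h. rel M Eval [g, u, h]" using Eval_total by blast
  then have "rel M Eval [g, u, ev M g u]" unfolding ev_def by (rule theI')
  then show ?thesis using Eval_sorts H by blast
qed

text \<open>G is the full direct sum. \<open>D\<close> may contain sets that are no index at all;
  these are ignored, so supports can be handled as arbitrary finite families of sets.\<close>

lemma G_of_support:
  assumes "finite D"
  shows "\<exists>g \<in> srt M SG. \<forall>u \<in> srt M SK. ev M g u \<noteq> z \<longleftrightarrow> memset M u \<in> D"
proof -
  let ?f = "\<lambda>u. if memset M u \<in> D then one else z"
  have "{u \<in> srt M SK. ?f u \<noteq> z} = {u \<in> srt M SK. memset M u \<in> D}" using z_one by auto
  also have "finite \<dots>"
    using memset_inj assms finite_vimage_IntI[OF assms memset_inj]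
    by (auto simp: vimage_def Int_def conj_commute)
  finally have "\<exists>!g. g \<in> srt M SG \<and> (\<forall>u \<in> srt M SK. ev M g u = ?f u)"
    using G_full[rule_format, of ?f] H by simp
  then show ?thesis using z_one by (metis (full_types))
qed

lemma GAdd_comm: "rel M GAdd [g, d, e] \<Longrightarrow> rel M GAdd [d, g, e]"
  using GAdd HAdd by (simp add: eq_commute)

lemma GAdd_ex:
  assumes g: "g \<in> srt M SG" "d \<in> srt M SG"
  shows "\<exists>e. rel M GAdd [g, d, e]"
proof -
  let ?f = "\<lambda>u. if ev M g u = ev M d u then z else one"
  have "{u \<in> srt M SK. ?f u \<noteq> z} \<subseteq> {u \<in> srt M SK. ev M g u \<noteq> z} \<union> {u \<in> srt M SK. ev M d u \<noteq> z}"
    by auto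
  then have "finite {u \<in> srt M SK. ?f u \<noteq> z}"
    using G_finite g by (meson finite_UnI finite_subset)
  then have "\<exists>!e. e \<in> srt M SG \<and> (\<forall>u \<in> srt M SK. ev M e u = ?f u)"
    using G_full[rule_format, of ?f] H by simp
  then obtain e where e: "e \<in> srt M SG" "\<forall>u \<in> srt M SK. ev M e u = ?f u" by blast
  have "rel M HAdd [ev M g u, ev M d u, ev M e u]" if "u \<in> srt M SK" for u
    using HAdd e that ev_H g H by simp
  then show ?thesis using GAdd e g by blast
qed

section \<open>The action of G on the stalks of G*\<close>

definition act :: "'a \<Rightarrow> 'a \<Rightarrow> 'a" where
  "act g x = (THE x'. rel M ActG [g, x, x'])"

lemma act_eq: "rel M ActG [g, x, x'] \<longleftrightarrow> g \<in> srt M SG \<and> x \<in> srt M SGs \<and> act g x = x'"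
proof -
  have "rel M ActG [g, x, act g x]" if "g \<in> srt M SG" "x \<in> srt M SGs"
    unfolding act_def using ActG_total that by (metis (no_types, lifting) theI')
  then show ?thesis using ActG_total ActG_sorts by metis
qed

lemma act_Gs: "g \<in> srt M SG \<Longrightarrow> x \<in> srt M SGs \<Longrightarrow> act g x \<in> srt M SGs"
  and piG_act: "g \<in> srt M SG \<Longrightarrow> x \<in> srt M SGs \<Longrightarrow> piG M (act g x) = piG M x"
  using ActG_sorts act_eq by metis+

lemma act_zero: "g \<in> srt M SG \<Longrightarrow> x \<in> srt M SGs \<Longrightarrow> (\<And>u. u \<in> srt M SK \<Longrightarrow> ev M g u = z) \<Longrightarrow> act g x = x"
  using ActG_zero act_eq by metis

text \<open>G is abelian, as addition on H is symmetric. Because of this a translation that is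
  constant on a stalk respects the relation \<open>ActG\<close>.\<close>

lemma act_commute:
  assumes "g \<in> srt M SG" "d \<in> srt M SG" "x \<in> srt M SGs"
  shows "act g (act d x) = act d (act g x)"
proof -
  obtain e where e: "rel M GAdd [g, d, e]" using GAdd_ex assms by blast
  have "rel M ActG [e, x, act g (act d x)]" "rel M ActG [e, x, act d (act g x)]"
    using ActG_add[rule_format, OF e] ActG_add[rule_format, OF GAdd_comm[OF e]] assms
    by (simp_all add: act_eq act_Gs)
  then show ?thesis by (simp add: act_eq)
qed

text \<open>G has exponent 2. Hence stalkwise translations are their own inverses, which gives the
  backward half of the back-and-forth argument.\<close>

lemma act_involutive:
  assumes g: "g \<in> srt M SG" and x: "x \<in> srt M SGs"
  shows "act g (act g x) = x"
proof -
  obtain e where e: "rel M GAdd [g, g, e]" using GAdd_ex g by blast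
  then have "e \<in> srt M SG" "\<And>u. u \<in> srt M SK \<Longrightarrow> ev M e u = z" using GAdd HAdd by auto
  then have "act e x = x" using act_zero x by blast
  moreover have "rel M ActG [e, x, act g (act g x)]"
    using ActG_add[rule_format, OF e] g x by (simp add: act_eq act_Gs)
  ultimately show ?thesis by (simp add: act_eq)
qed

end

section \<open>Twisting the relation Q\<close>

text \<open>The set w is not an argument of Q; this recovers it from the stalk indices. A point of w
  survives the removal of any other point, and n >= 1 provides another one.\<close>

lemma Union_subsets_card:
  assumes "finite w" "card w = Suc n" "1 \<le> n"
  shows "\<Union>{A. A \<subseteq> w \<and> card A = n} = w"
proof (intro equalityI subsetI)
  fix x assume x: "x \<in> w"
  have "w - {x} \<noteq> {}"
  proof
    assume "w - {x} = {}"
    then have "w = {x}" using x by auto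
    then show False using assms by simp
  qed
  then obtain y where y: "y \<in> w" "y \<noteq> x" by auto
  then have "x \<in> w - {y}" "card (w - {y}) = n" using x assms by auto
  then show "x \<in> \<Union>{A. A \<subseteq> w \<and> card A = n}" by blast
qed auto

text \<open>Flips \<open>Q\<close> over the pairs \<open>(w, v)\<close> with \<open>c w v\<close>, where \<open>v\<close> is the index of the stalk of
  \<open>H*\<close> and \<open>w\<close> is the union of all stalk indices.\<close>
definition twist :: "nat \<Rightarrow> ('a set \<Rightarrow> 'a set \<Rightarrow> bool) \<Rightarrow> 'a hstr \<Rightarrow> 'a hstr" where
  "twist n c M = \<lparr> carrier = carrier M,
     rel = (\<lambda>R ts. if R = Qr
       then \<exists>xs y. ts = xs @ [y] \<and> length xs = n \<and> set xs \<subseteq> srt M SGs \<and> y \<in> srt M SHs \<and>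
         compatible n M (map (piG M) xs @ [piH M y]) \<and>
         (rel M Qr ts \<longleftrightarrow>
           \<not> c (\<Union>(memset M ` set (map (piG M) xs @ [piH M y]))) (memset M (piH M y)))
       else rel M R ts) \<rparr>"

lemma carrier_twist [simp]: "carrier (twist n c M) = carrier M"
  and rel_twist [simp]: "R \<noteq> Qr \<Longrightarrow> rel (twist n c M) R = rel M R"
  and srt_twist [simp]: "R \<noteq> Qr \<Longrightarrow> srt (twist n c M) R = srt M R"
  by (simp_all add: twist_def srt_def fun_eq_iff)

lemma memset_twist [simp]: "memset (twist n c M) = memset M"
  and piG_twist [simp]: "piG (twist n c M) = piG M"
  and piH_twist [simp]: "piH (twist n c M) = piH M"
  and ev_twist [simp]: "ev (twist n c M) = ev M"
  and compatible_twist [simp]: "compatible n (twist n c M) = compatible n M"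
  by (simp_all add: memset_def piG_def piH_def ev_def compatible_def fun_eq_iff)

text \<open>Sorts and compatibility are stated again on the right because a flip turns falsity into
  truth, while Q has to stay false on ill-formed tuples.\<close>

lemma rel_twist_Qr:
  "rel (twist n c M) Qr (xs @ [y]) \<longleftrightarrow> length xs = n \<and> set xs \<subseteq> srt M SGs \<and> y \<in> srt M SHs \<and>
     compatible n M (map (piG M) xs @ [piH M y]) \<and>
     (rel M Qr (xs @ [y]) \<longleftrightarrow>
       \<not> c (\<Union>(memset M ` set (map (piG M) xs @ [piH M y]))) (memset M (piH M y)))"
  by (auto simp: twist_def)

context hs
begin

text \<open>Whether Q is flipped depends only on the set of stalk indices and on the index of the
  last argument. Permuting the first n arguments or moving points within their stalks changes
  neither, so both sides of the symmetry and twisting conditions flip together; every other clause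
  speaks of unchanged relations.\<close>

lemma twist_hs: "hs n (twist n c M) z one"
proof
  show "\<forall>S xs. rel (twist n c M) S xs \<longrightarrow> set xs \<subseteq> carrier (twist n c M) \<and> length xs = arity n S"
  proof (intro allI impI)
    fix S xs assume "rel (twist n c M) S xs"
    then show "set xs \<subseteq> carrier (twist n c M) \<and> length xs = arity n S"
      using wf by (cases "S = Qr") (auto simp: twist_def srt_def split: if_splits)
  qed
  have "S \<in> {SI, SK, SH, SG, SGs, SHs} \<and> rel (twist n c M) S [x] \<longleftrightarrow>
      S \<in> {SI, SK, SH, SG, SGs, SHs} \<and> rel M S [x]" for S x
    by auto
  then show "\<forall>x \<in> carrier (twist n c M). \<exists>!S \<in> {SI, SK, SH, SG, SGs, SHs}. rel (twist n c M) S [x]"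
    using sorts by (simp only: carrier_twist)
  show "\<forall>xs y. rel (twist n c M) Qr (xs @ [y]) \<longrightarrow>
      set xs \<subseteq> srt (twist n c M) SGs \<and> y \<in> srt (twist n c M) SHs \<and>
      compatible n (twist n c M) (map (piG (twist n c M)) xs @ [piH (twist n c M) y])"
    by (simp add: rel_twist_Qr)
  show "\<forall>xs \<sigma> y. length xs = n \<longrightarrow> \<sigma> permutes {..<n} \<longrightarrow>
      (rel (twist n c M) Qr (xs @ [y]) \<longleftrightarrow>
       rel (twist n c M) Qr (map (\<lambda>l. xs ! \<sigma> l) [0..<n] @ [y]))"
  proof (intro allI impI)
    fix xs :: "'a list" and \<sigma> and y :: 'a assume len: "length xs = n" and \<sigma>: "\<sigma> permutes {..<n}"
    let ?xs = "map (\<lambda>l. xs ! \<sigma> l) [0..<n]"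
    have m: "mset ?xs = mset xs"
      using mset_permute_list[of \<sigma> xs] len \<sigma> by (simp add: permute_list_def)
    then have s: "set ?xs = set xs" by (metis mset_eq_setD)
    have "mset (map (piG M) ?xs @ [piH M y :: 'a]) = mset (map (piG M) xs @ [piH M y])"
      using m by (simp only: mset_append mset_map)
    then have "distinct (map (piG M) ?xs @ [piH M y]) \<longleftrightarrow> distinct (map (piG M) xs @ [piH M y])"
      by (rule mset_eq_imp_distinct_iff)
    moreover have s': "set (map (piG M) ?xs @ [piH M y]) = set (map (piG M) xs @ [piH M y])"
      using s by (simp only: set_append set_map)
    ultimately have "compatible n M (map (piG M) ?xs @ [piH M y]) \<longleftrightarrow>
        compatible n M (map (piG M) xs @ [piH M y])"
      unfolding compatible_def by (simp only:)
    then show "rel (twist n c M) Qr (xs @ [y]) \<longleftrightarrow> rel (twist n c M) Qr (?xs @ [y])"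
      unfolding rel_twist_Qr s s' using Q_symmetric[rule_format, OF len \<sigma>, of y] len by simp
  qed
  show "\<forall>xs y gs m xs' y'. length xs = n \<longrightarrow> set xs \<subseteq> srt (twist n c M) SGs \<longrightarrow>
      y \<in> srt (twist n c M) SHs \<longrightarrow>
      compatible n (twist n c M) (map (piG (twist n c M)) xs @ [piH (twist n c M) y]) \<longrightarrow>
      length gs = n \<longrightarrow> set gs \<subseteq> srt (twist n c M) SG \<longrightarrow> m \<in> srt (twist n c M) SH \<longrightarrow>
      length xs' = n \<longrightarrow>
      (\<forall>l < n. rel (twist n c M) ActG [gs ! l, xs ! l, xs' ! l]) \<longrightarrow>
      rel (twist n c M) ActH [m, y, y'] \<longrightarrow>
      ((rel (twist n c M) Qr (xs @ [y]) \<longleftrightarrow> rel (twist n c M) Qr (xs' @ [y'])) \<longleftrightarrow>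
       even (card {l. l < n \<and> ev (twist n c M) (gs ! l) (piH (twist n c M) y) \<noteq> z} +
         (if m = z then 0 else 1)))"
  proof (intro allI impI)
    fix xs y gs m xs' y'
    assume "length xs = n" "set xs \<subseteq> srt (twist n c M) SGs" "y \<in> srt (twist n c M) SHs"
      "compatible n (twist n c M) (map (piG (twist n c M)) xs @ [piH (twist n c M) y])"
      "length gs = n" "set gs \<subseteq> srt (twist n c M) SG" "m \<in> srt (twist n c M) SH"
      "length xs' = n" "\<forall>l < n. rel (twist n c M) ActG [gs ! l, xs ! l, xs' ! l]"
      "rel (twist n c M) ActH [m, y, y']"
    then have a: "length xs = n" "set xs \<subseteq> srt M SGs" "y \<in> srt M SHs"
      "compatible n M (map (piG M) xs @ [piH M y])" "length gs = n" "set gs \<subseteq> srt M SG"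
      "m \<in> srt M SH" "length xs' = n" "\<forall>l < n. rel M ActG [gs ! l, xs ! l, xs' ! l]"
      "rel M ActH [m, y, y']"
      by simp_all
    have a': "\<forall>l < n. xs' ! l \<in> srt M SGs \<and> piG M (xs' ! l) = piG M (xs ! l)"
      using a(9) ActG_sorts by blast
    then have "map (piG M) xs' = map (piG M) xs"
      using a by (intro nth_equalityI) auto
    moreover have "set xs' \<subseteq> srt M SGs"
      using a a' by (auto simp: in_set_conv_nth)
    moreover have "y' \<in> srt M SHs" "piH M y' = piH M y" using a ActH_sorts by blast+
    ultimately have "(rel (twist n c M) Qr (xs @ [y]) \<longleftrightarrow> rel (twist n c M) Qr (xs' @ [y'])) \<longleftrightarrow>
        (rel M Qr (xs @ [y]) \<longleftrightarrow> rel M Qr (xs' @ [y']))"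
      unfolding rel_twist_Qr using a(1-4,8) by (simp only: True_implies_equals simp_thms) blast
    also have "\<dots> \<longleftrightarrow> even (card {l. l < n \<and> ev M (gs ! l) (piH M y) \<noteq> z} + (if m = z then 0 else 1))"
      by (rule Q_twist[rule_format, OF a(1-8) a(9)[rule_format] a(10)])
    finally show "(rel (twist n c M) Qr (xs @ [y]) \<longleftrightarrow> rel (twist n c M) Qr (xs' @ [y'])) \<longleftrightarrow>
       even (card {l. l < n \<and> ev (twist n c M) (gs ! l) (piH (twist n c M) y) \<noteq> z} +
         (if m = z then 0 else 1))"
      by (simp only: ev_twist piH_twist)
  qed
qed ((simp only: carrier_twist srt_twist rel_twist memset_twist piG_twist piH_twist ev_twist
      hsym.distinct not_False_eq_True simp_thms)?,
    rule mem_sorts mem_bij z_one H HAdd Eval_sorts Eval_total G_finite G_full Supp GAdd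
      PiG_sorts PiG_total PiG_onto ActG_sorts ActG_total ActG_zero ActG_add ActG_regular
      PiH_sorts PiH_total PiH_onto ActH_sorts ActH_total ActH_zero ActH_add ActH_regular)+

text \<open>The bridge from argument positions in Q to the parity equations: in a compatible tuple
  the first n indices run exactly once through the n-subsets of w other than the last index, so
  counting positions amounts to counting sets.\<close>

lemma compatible_subsets:
  fixes us v
  defines "w \<equiv> \<Union>(memset M ` set (us @ [v]))"
  assumes c: "compatible n M (us @ [v])" and K: "set us \<subseteq> srt M SK" "v \<in> srt M SK"
    and len: "length us = n" and n: "1 \<le> n"
  shows "w \<subseteq> srt M SI" "finite w" "card w = Suc n" "memset M v \<subseteq> w"
    and "card {l. l < n \<and> P (memset M (us ! l))} =
      card {A. A \<subseteq> w \<and> card A = n \<and> A \<noteq> memset M v \<and> P A}"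
proof -
  obtain w' where w': "w' \<subseteq> srt M SI" "finite w'" "card w' = Suc n"
      "memset M ` set (us @ [v]) = {A. A \<subseteq> w' \<and> card A = n}"
    using c unfolding compatible_def by blast
  have d: "distinct us" "v \<notin> set us" using c unfolding compatible_def by auto
  have w: "w = w'" unfolding w_def w'(4) by (rule Union_subsets_card[OF w'(2,3) n])
  show "w \<subseteq> srt M SI" "finite w" "card w = Suc n"
    using w w'(1-3) by simp_all
  show "memset M v \<subseteq> w" by (simp add: w_def)
  have us: "memset M ` set us = {A. A \<subseteq> w \<and> card A = n \<and> A \<noteq> memset M v}"
  proof -
    have "memset M v \<notin> memset M ` set us"
      using memset_inj K d by (auto dest: inj_onD)
    then have "memset M ` set us = memset M ` set (us @ [v]) - {memset M v}" by auto
    also have "\<dots> = {A. A \<subseteq> w \<and> card A = n \<and> A \<noteq> memset M v}"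
      unfolding w'(4) w by blast
    finally show ?thesis .
  qed
  have "bij_betw (\<lambda>l. memset M (us ! l)) {l. l < n \<and> P (memset M (us ! l))}
      {A. A \<subseteq> w \<and> card A = n \<and> A \<noteq> memset M v \<and> P A}"
    unfolding bij_betw_def
  proof
    show "inj_on (\<lambda>l. memset M (us ! l)) {l. l < n \<and> P (memset M (us ! l))}"
    proof (rule inj_onI)
      fix i j assume ij: "i \<in> {l. l < n \<and> P (memset M (us ! l))}" "j \<in> {l. l < n \<and> P (memset M (us ! l))}"
        "memset M (us ! i) = memset M (us ! j)"
      then have "us ! i \<in> srt M SK" "us ! j \<in> srt M SK" using K len nth_mem by auto
      then have "us ! i = us ! j" using memset_inj ij by (auto dest: inj_onD)
      then show "i = j" using d len ij by (auto simp: nth_eq_iff_index_eq)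
    qed
    have "{A. A \<subseteq> w \<and> card A = n \<and> A \<noteq> memset M v \<and> P A} = {A \<in> memset M ` set us. P A}"
      using us by auto
    also have "\<dots> = (\<lambda>l. memset M (us ! l)) ` {l. l < n \<and> P (memset M (us ! l))}"
      using len by (auto simp: set_conv_nth)
    finally show "(\<lambda>l. memset M (us ! l)) ` {l. l < n \<and> P (memset M (us ! l))} =
      {A. A \<subseteq> w \<and> card A = n \<and> A \<noteq> memset M v \<and> P A}" by simp
  qed
  then show "card {l. l < n \<and> P (memset M (us ! l))} =
      card {A. A \<subseteq> w \<and> card A = n \<and> A \<noteq> memset M v \<and> P A}"
    by (rule bij_betw_same_card)
qed

section \<open>Stalkwise translations and their effect on Q\<close>

definition stalk :: "'a \<Rightarrow> 'a set" where
  "stalk x = (if x \<in> srt M SGs then memset M (piG M x)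
     else if x \<in> srt M SHs then memset M (piH M x) else {})"

lemma finite_stalk: "finite (stalk x)"
  by (simp add: stalk_def memset_finite piG_K piH_K)

definition G_elem :: "'a set set \<Rightarrow> 'a" where
  "G_elem D = (SOME g. g \<in> srt M SG \<and> (\<forall>u \<in> srt M SK. ev M g u \<noteq> z \<longleftrightarrow> memset M u \<in> D))"

lemma G_elem:
  assumes "finite D"
  shows "G_elem D \<in> srt M SG" "u \<in> srt M SK \<Longrightarrow> ev M (G_elem D) u \<noteq> z \<longleftrightarrow> memset M u \<in> D"
  using someI_ex[of "\<lambda>g. g \<in> srt M SG \<and> (\<forall>u \<in> srt M SK. ev M g u \<noteq> z \<longleftrightarrow> memset M u \<in> D)"]
    G_of_support[OF assms] unfolding G_elem_def by blast+

text \<open>One translation for each stalk of G*, prescribed by its support; all other sorts, H*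
  included, stay pointwise fixed. Translations of G* alone can solve the parity equations over
  finite index sets.\<close>

definition shift :: "('a set \<Rightarrow> 'a set set) \<Rightarrow> 'a \<Rightarrow> 'a" where
  "shift D x = (if x \<in> srt M SGs then act (G_elem (D (memset M (piG M x)))) x else x)"

lemma shift_Gs:
  assumes "\<forall>u. finite (D u)"
  shows "shift D x \<in> srt M SGs \<longleftrightarrow> x \<in> srt M SGs"
    and "x \<in> srt M SGs \<Longrightarrow> piG M (shift D x) = piG M x"
  using assms by (auto simp: shift_def act_Gs piG_act G_elem)

lemma shift_involutive: "(\<forall>u. finite (D u)) \<Longrightarrow> shift D (shift D x) = x"
  using shift_Gs[of D x] by (auto simp: shift_def act_involutive G_elem piG_act)

lemma shift_carrier:
  assumes "\<forall>u. finite (D u)"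
  shows "x \<in> carrier M \<Longrightarrow> shift D x \<in> carrier M"
  using shift_Gs(1)[OF assms, of x] srt_carrier by (auto simp: shift_def)

lemma stalk_shift: "(\<forall>u. finite (D u)) \<Longrightarrow> stalk (shift D x) = stalk x"
  using shift_Gs[of D x] by (simp add: stalk_def) (simp add: shift_def)

lemma shift_other: "x \<in> srt M S \<Longrightarrow> S \<in> {SI, SK, SH, SG, SHs} \<Longrightarrow> shift D x = x"
  using sort_disjoint[of x S SGs] by (auto simp: shift_def)

text \<open>Apart from the sort G* itself, only \<open>PiG\<close> and \<open>ActG\<close> involve
  moved elements. A shift stays within each stalk, which settles \<open>PiG\<close>; it is a single
  translation on each stalk and G is abelian, which settles \<open>ActG\<close>.\<close>

lemma rel_shift:
  assumes D: "\<forall>u. finite (D u)" and R: "R \<noteq> Qr" and rel: "rel M R xs"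
  shows "rel M R (map (shift D) xs)"
proof -
  have len: "length xs = arity n R" using wf rel by blast
  have unary: "rel M R (map (shift D) xs)" if "R \<in> {SI, SK, SH, SG, SHs, SGs}"
  proof -
    have "length xs = Suc 0" using len that by auto
    then obtain a where xs: "xs = [a]" by (auto simp: length_Suc_conv)
    then have "a \<in> srt M R" using rel srtI by blast
    then show ?thesis
      using that xs rel shift_other[of a R D] shift_Gs[OF D, of a] by (auto simp: srt_def)
  qed
  have l2: "\<exists>a b. xs = [a, b]" if "arity n R = 2"
    using len that by (auto simp: numeral_2_eq_2 length_Suc_conv)
  have l3: "\<exists>a b c. xs = [a, b, c]" if "arity n R = 3"
    using len that by (auto simp: numeral_3_eq_3 length_Suc_conv)
  note fx = shift_other[of _ SI D, simplified] shift_other[of _ SK D, simplified]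
    shift_other[of _ SH D, simplified] shift_other[of _ SG D, simplified]
    shift_other[of _ SHs D, simplified]
  show ?thesis
  proof (cases R)
    case Mem
    then obtain a b where xs: "xs = [a, b]" using l2 by auto
    then have r: "rel M Mem [a, b]" using rel Mem by simp
    then have "a \<in> srt M SI" "b \<in> srt M SK" using mem_sorts by blast+
    then show ?thesis using r Mem fx xs by simp
  next
    case HAdd
    then obtain a b c where xs: "xs = [a, b, c]" using l3 by auto
    then have r: "rel M HAdd [a, b, c]" using rel HAdd by simp
    then have "a \<in> srt M SH" "b \<in> srt M SH" "c = (if a = b then z else one)"
      using hs.HAdd[OF hs_axioms] by blast+
    moreover have "c \<in> srt M SH" using \<open>c = _\<close> H by simp
    ultimately show ?thesis using r HAdd fx xs by simp
  next
    case Eval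
    then obtain a b c where xs: "xs = [a, b, c]" using l3 by auto
    then have r: "rel M Eval [a, b, c]" using rel Eval by simp
    then have "a \<in> srt M SG" "b \<in> srt M SK" "c \<in> srt M SH" using Eval_sorts by blast+
    then show ?thesis using r Eval fx xs by simp
  next
    case Supp
    then obtain a b where xs: "xs = [a, b]" using l2 by auto
    then have r: "rel M Supp [a, b]" using rel Supp by simp
    then have "a \<in> srt M SG" "b \<in> srt M SK" using hs.Supp[OF hs_axioms] by blast+
    then show ?thesis using r Supp fx xs by simp
  next
    case GAdd
    then obtain a b c where xs: "xs = [a, b, c]" using l3 by auto
    then have r: "rel M GAdd [a, b, c]" using rel GAdd by simp
    then have "a \<in> srt M SG" "b \<in> srt M SG" "c \<in> srt M SG" using hs.GAdd[OF hs_axioms] by blast+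
    then show ?thesis using r GAdd fx xs by simp
  next
    case PiG
    then obtain a b where xs: "xs = [a, b]" using l2 by auto
    then have r: "rel M PiG [a, b]" using rel PiG by simp
    then have a: "a \<in> srt M SGs" "b \<in> srt M SK" "piG M a = b"
      using PiG_sorts piG_eq by blast+
    then have "rel M PiG [shift D a, b]" using PiG_piG[of "shift D a"] shift_Gs[OF D] by simp
    then show ?thesis using a fx xs PiG by simp
  next
    case ActG
    then obtain g x y where xs: "xs = [g, x, y]" using l3 by auto
    then have "rel M ActG [g, x, y]" using rel ActG by simp
    then have a: "g \<in> srt M SG" "x \<in> srt M SGs" "act g x = y" using act_eq by blast+
    let ?d = "G_elem (D (memset M (piG M x)))"
    have "act g (act ?d x) = act ?d (act g x)"
      using act_commute a G_elem(1) D by blast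
    then have "act g (shift D x) = shift D y"
      using a act_Gs piG_act by (auto simp: shift_def)
    then have "rel M ActG [g, shift D x, shift D y]" using a act_eq shift_Gs[OF D] by blast
    then show ?thesis using a fx xs ActG by simp
  next
    case PiH
    then obtain a b where xs: "xs = [a, b]" using l2 by auto
    then have r: "rel M PiH [a, b]" using rel PiH by simp
    then have "a \<in> srt M SHs" "b \<in> srt M SK" using PiH_sorts by blast+
    then show ?thesis using r PiH fx xs by simp
  next
    case ActH
    then obtain a b c where xs: "xs = [a, b, c]" using l3 by auto
    then have r: "rel M ActH [a, b, c]" using rel ActH by simp
    then have "a \<in> srt M SH" "b \<in> srt M SHs" "c \<in> srt M SHs" using ActH_sorts by blast+
    then show ?thesis using r ActH fx xs by simp
  qed (use unary R in auto)
qed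

lemma rel_shift_iff:
  assumes D: "\<forall>u. finite (D u)" and R: "R \<noteq> Qr"
  shows "rel M R (map (shift D) xs) \<longleftrightarrow> rel M R xs"
  using rel_shift[OF D R, of xs] rel_shift[OF D R, of "map (shift D) xs"] shift_involutive[OF D]
  by (auto simp: comp_def)

text \<open>The twisting condition with the zero of H acting on the last argument, its count
  rewritten from positions to index sets.\<close>

lemma Qr_shift:
  assumes D: "\<forall>u. finite (D u)" and n: "1 \<le> n" and xs: "length xs = n" "set xs \<subseteq> srt M SGs"
    and y: "y \<in> srt M SHs" and c: "compatible n M (map (piG M) xs @ [piH M y])"
  shows "(rel M Qr (xs @ [y]) \<longleftrightarrow> rel M Qr (map (shift D) xs @ [shift D y])) \<longleftrightarrow>
    even (card {A. A \<subseteq> \<Union>(memset M ` set (map (piG M) xs @ [piH M y])) \<and> card A = n \<and>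
      A \<noteq> memset M (piH M y) \<and> memset M (piH M y) \<in> D A})"
proof -
  let ?g = "\<lambda>x. G_elem (D (memset M (piG M x)))"
  let ?v = "piH M y"
  have vK: "?v \<in> srt M SK" using y piH_K by blast
  have y': "shift D y = y" using shift_other y by blast
  have zH: "z \<in> srt M SH" using H by simp
  have act: "\<forall>l < n. rel M ActG [map ?g xs ! l, xs ! l, map (shift D) xs ! l]"
  proof (intro allI impI)
    fix l assume l: "l < n"
    then have "xs ! l \<in> srt M SGs" using xs nth_mem by fastforce
    then show "rel M ActG [map ?g xs ! l, xs ! l, map (shift D) xs ! l]"
      using l xs act_eq G_elem(1) D by (auto simp: shift_def)
  qed
  have "(rel M Qr (xs @ [y]) \<longleftrightarrow> rel M Qr (map (shift D) xs @ [y])) \<longleftrightarrow>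
      even (card {l. l < n \<and> ev M (map ?g xs ! l) ?v \<noteq> z} + (if z = z then 0 else 1))"
    using act ActH_zero y xs G_elem D zH c
    by (intro Q_twist[rule_format, where m = z and gs = "map ?g xs"]) auto
  also have "{l. l < n \<and> ev M (map ?g xs ! l) ?v \<noteq> z} =
      {l. l < n \<and> memset M ?v \<in> D (memset M (map (piG M) xs ! l))}"
  proof -
    have e: "ev M (G_elem (D u)) ?v = z \<longleftrightarrow> memset M ?v \<notin> D u" for u
      using G_elem(2)[OF D[rule_format] vK] by blast
    show ?thesis using xs e by auto
  qed
  also have "card \<dots> = card {A. A \<subseteq> \<Union>(memset M ` set (map (piG M) xs @ [?v])) \<and> card A = n \<and>
      A \<noteq> memset M ?v \<and> memset M ?v \<in> D A}"
    by (rule compatible_subsets(5)[OF c]) (use xs piG_K vK n in auto)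
  finally show ?thesis by (simp add: y')
qed

text \<open>The partial isomorphisms are the shifts whose supports solve the parity problem posed by \<open>c\<close>
  on a finite index set \<open>W\<close>, restricted to the elements with stalk index inside \<open>W\<close>.\<close>
lemma sat_twist:
  assumes n: "2 \<le> n" and fv: "finite (fv \<phi>)" and s: "s ` fv \<phi> \<subseteq> carrier M"
    and Z: "\<And>i. i \<in> fv \<phi> \<Longrightarrow> stalk (s i) \<subseteq> Z" and c: "\<And>w v. w \<subseteq> Z \<Longrightarrow> \<not> c w v"
  shows "sat M \<phi> s \<longleftrightarrow> sat (twist n c M) \<phi> s"
proof -
  \<comment> \<open>\<open>stalk\<close> is empty outside G* and H*, so every domain contains all
    elements of the other sorts; shifts fix them anyway.\<close>
  define dom where "dom W = {x \<in> carrier M. stalk x \<subseteq> W}" for W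
  define F where "F = {(dom W, shift D) | D W. finite W \<and> (\<forall>u. finite (D u)) \<and> parity_solution n c D W}"
  have agree: "shift D' y = shift D y"
    if "y \<in> dom W" "\<And>u. u \<subseteq> W \<Longrightarrow> D' u = D u" for D D' y W
    using that unfolding dom_def stalk_def by (auto simp: shift_def)
  have FI: "(dom W, shift D) \<in> F" if "finite W" "\<forall>u. finite (D u)" "parity_solution n c D W" for D W
    using that unfolding F_def by blast
  have rels: "inj_on h X \<and> (\<forall>R xs. set xs \<subseteq> X \<longrightarrow>
      (rel M R xs \<longleftrightarrow> rel (twist n c M) R (map h xs)))" if Xh: "(X, h) \<in> F" for X h
  proof -
    obtain D W where X: "X = dom W" and h: "h = shift D" and W: "finite W"
      and D: "\<forall>u. finite (D u)" and sol: "parity_solution n c D W"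
      using Xh unfolding F_def by blast
    have inj: "inj_on h X" unfolding h by (rule inj_on_inverseI) (rule shift_involutive[OF D])
    have "rel M R xs \<longleftrightarrow> rel (twist n c M) R (map h xs)" if xs: "set xs \<subseteq> X" for R xs
    proof (cases "R = Qr")
      case False
      then show ?thesis using rel_shift_iff[OF D] h by simp
    next
      case True
      let ?comp = "\<lambda>ys y. xs = ys @ [y] \<and> length ys = n \<and> set ys \<subseteq> srt M SGs \<and> y \<in> srt M SHs \<and>
          compatible n M (map (piG M) ys @ [piH M y])"
      have hy: "shift D y = y" if "y \<in> srt M SHs" for y using shift_other that by blast
      \<comment> \<open>Q fails on ill-formed tuples in both structures, so only well-formed ones
        need the parity computation. The second alternative pulls well-formedness back along
        \<open>h\<close>.\<close>
      have comp: "\<exists>ys y. ?comp ys y" if "rel M R xs \<or> rel (twist n c M) R (map h xs)"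
        using that
      proof
        assume r: "rel M R xs"
        then have len: "length xs = Suc n" using wf True by fastforce
        then obtain ys y where "xs = ys @ [y]" by (metis length_Suc_conv_rev)
        then show ?thesis using r True Q_compatible len by auto
      next
        assume r: "rel (twist n c M) R (map h xs)"
        interpret T: hs n "twist n c M" z one by (rule twist_hs)
        have len: "length xs = Suc n" using T.wf r True by fastforce
        then obtain ys y where ys: "xs = ys @ [y]" by (metis length_Suc_conv_rev)
        then have r': "rel (twist n c M) Qr (map h ys @ [h y])" using r True by simp
        then have c: "set (map h ys) \<subseteq> srt M SGs" "h y \<in> srt M SHs"
            "compatible n M (map (piG M) (map h ys) @ [piH M (h y)])"
          unfolding rel_twist_Qr by blast+
        have ysG: "set ys \<subseteq> srt M SGs" using c(1) shift_Gs(1)[OF D] h by auto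
        \<comment> \<open>It is not yet known that \<open>y\<close> lies in H*, only that
          \<open>h y\<close> does. Then \<open>h\<close> fixes \<open>h y\<close>, and involutivity
          yields \<open>h y = y\<close>.\<close>
        have "h (h y) = y" using shift_involutive[OF D] h by simp
        then have hy': "h y = y" using hy[OF c(2)] h by simp
        have "map (piG M) (map h ys) = map (piG M) ys"
          using ysG shift_Gs(2)[OF D] h by auto
        then have "compatible n M (map (piG M) ys @ [piH M y])" using c(3) hy' by (simp only:)
        then show ?thesis using c(2) ysG hy' len ys by auto
      qed
      show ?thesis
      proof (cases "\<exists>ys y. ?comp ys y")
        case False
        then show ?thesis using comp by blast
      next
        case True': True
        then obtain ys y where ys: "?comp ys y" by blast
        let ?us = "map (piG M) ys" and ?v = "piH M y"
        let ?w = "\<Union>(memset M ` set (?us @ [?v]))"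
        have c: "compatible n M (?us @ [?v])" using ys by blast
        have K: "set ?us \<subseteq> srt M SK" "?v \<in> srt M SK" using ys piG_K piH_K by auto
        have len: "length ?us = n" using ys by simp
        have n1: "1 \<le> n" using n by simp
        note w = compatible_subsets(1-4)[OF c K len n1]
        have wW: "?w \<subseteq> W"
        proof -
          have dW: "stalk x \<subseteq> W" if "x \<in> set xs" for x
            using that xs unfolding X dom_def by blast
          have "memset M (piG M x) \<subseteq> W" if "x \<in> set ys" for x
          proof -
            have "x \<in> srt M SGs" "x \<in> set xs" using that ys by auto
            then show ?thesis using dW[of x] by (simp add: stalk_def)
          qed
          moreover have "memset M ?v \<subseteq> W"
          proof -
            have "y \<notin> srt M SGs" "y \<in> srt M SHs" "y \<in> set xs"
              using ys sort_disjoint[of y SGs SHs] by auto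
            then show ?thesis using dW[of y] by (simp add: stalk_def)
          qed
          ultimately show ?thesis by auto
        qed
        \<comment> \<open>The solution makes the shift change Q at (w, v) exactly when
          \<open>c w v\<close> holds, and the twist changes it back.\<close>
        have "c ?w (memset M ?v) \<longleftrightarrow> odd (card {u. u \<subseteq> ?w \<and> card u = n \<and> u \<noteq> memset M ?v \<and> memset M ?v \<in> D u})"
          using sol wW w(2-4) memset_card[OF K(2)] unfolding parity_solution_def by blast
        moreover have "(rel M Qr (ys @ [y]) \<longleftrightarrow> rel M Qr (map h ys @ [h y])) \<longleftrightarrow>
            even (card {u. u \<subseteq> ?w \<and> card u = n \<and> u \<noteq> memset M ?v \<and> memset M ?v \<in> D u})"
          unfolding h by (rule Qr_shift[OF D n1]) (use ys in auto)
        moreover have "rel (twist n c M) Qr (map h ys @ [h y]) \<longleftrightarrow>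
            (rel M Qr (map h ys @ [h y]) \<longleftrightarrow> \<not> c ?w (memset M ?v))"
        proof -
          have m: "map (piG M) (map h ys) = ?us" using ys shift_Gs(2)[OF D] h by auto
          have hyy: "h y = y" using hy ys h by simp
          have "set (map h ys) \<subseteq> srt M SGs" using ys shift_Gs(1)[OF D] h by auto
          then show ?thesis unfolding rel_twist_Qr m hyy using ys by simp
        qed
        ultimately show ?thesis using ys True by auto
      qed
    qed
    with inj show ?thesis by blast
  qed
  \<comment> \<open>Adjoining the stalk index of \<open>a\<close> to \<open>W\<close> suffices. The
    extended solution keeps the translations over \<open>W\<close>, so the new shift agrees with the
    old one on the old domain.\<close>
  have ext: "\<exists>X' D'. (X', shift D') \<in> F \<and> insert a Y \<subseteq> X' \<and> (\<forall>y \<in> Y. shift D' y = h y) \<and>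
      (\<forall>u. finite (D' u))"
    if Xh: "(X, h) \<in> F" and Y: "Y \<subseteq> X" and a: "a \<in> carrier M" for X h Y a
  proof -
    obtain D W where X: "X = dom W" and h: "h = shift D" and W: "finite W"
      and D: "\<forall>u. finite (D u)" and sol: "parity_solution n c D W"
      using Xh unfolding F_def by blast
    have fW: "finite (W \<union> stalk a)" using W finite_stalk by simp
    obtain D' where D': "parity_solution n c D' (W \<union> stalk a)" "\<And>u. u \<subseteq> W \<Longrightarrow> D' u = D u"
        "\<forall>u. finite (D' u)"
      using parity_solution_extend[OF n fW Un_upper1 sol D] by blast
    show ?thesis
    proof (intro exI conjI)
      show "(dom (W \<union> stalk a), shift D') \<in> F" by (rule FI[OF fW D'(3,1)])
      show "insert a Y \<subseteq> dom (W \<union> stalk a)" using a Y X by (auto simp: dom_def)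
      show "\<forall>y \<in> Y. shift D' y = h y" using agree[of _ W D' D] D'(2) Y X h by blast
      show "\<forall>u. finite (D' u)" by (rule D'(3))
    qed
  qed
  \<comment> \<open>All parameters lie over subsets of \<open>Z\<close>, where \<open>c\<close>
    vanishes. There the empty supports solve the parity problem, so the identity is a legitimate
    starting map.\<close>
  let ?W = "\<Union>(stalk ` s ` fv \<phi>)"
  have 0: "shift (\<lambda>_. {}) x = x" for x
    using act_zero[of "G_elem {}" x] G_elem[of "{}"] by (auto simp: shift_def)
  have "sat M \<phi> s \<longleftrightarrow> sat (twist n c M) \<phi> (shift (\<lambda>_. {}) \<circ> s)"
  proof (rule back_and_forth[where F = F and X = "dom ?W"])
    show "(dom ?W, shift (\<lambda>_. {})) \<in> F"
    proof (rule FI)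
      show "finite ?W" using fv finite_stalk by auto
      have "?W \<subseteq> Z" using Z by auto
      then show "parity_solution n c (\<lambda>_. {}) ?W" using c unfolding parity_solution_def by auto
    qed simp
    show "s ` fv \<phi> \<subseteq> dom ?W" using s by (auto simp: dom_def)
    show "\<exists>X' h'. (X', h') \<in> F \<and> insert a Y \<subseteq> X' \<and> (\<forall>y \<in> Y. h' y = h y) \<and> h' a \<in> carrier (twist n c M)"
      if "(X, h) \<in> F" "Y \<subseteq> X" "a \<in> carrier M" for X h Y a
      using ext[OF that] shift_carrier that(3) by (metis carrier_twist)
    show "\<exists>X' h' a. (X', h') \<in> F \<and> insert a Y \<subseteq> X' \<and> (\<forall>y \<in> Y. h' y = h y) \<and>
        a \<in> carrier M \<and> h' a = b"
      if Xh: "(X, h) \<in> F" and Y: "Y \<subseteq> X" and b: "b \<in> carrier (twist n c M)" for X h Y b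
    proof -
      obtain X' D' where D': "(X', shift D') \<in> F" "insert b Y \<subseteq> X'" "\<forall>y \<in> Y. shift D' y = h y"
          "\<forall>u. finite (D' u)"
        using ext[OF Xh Y, of b] b by auto
      obtain W' where X': "X' = dom W'" using D'(1) unfolding F_def by blast
      \<comment> \<open>A shift is an involution that preserves stalk indices, so once the stalk
        index of \<open>b\<close> is covered, the preimage of \<open>b\<close> is
        \<open>shift D' b\<close>.\<close>
      have "shift D' b \<in> X'"
        using D'(2) shift_carrier[OF D'(4)] stalk_shift[OF D'(4)] unfolding X' dom_def by auto
      moreover have "shift D' (shift D' b) = b" by (rule shift_involutive[OF D'(4)])
      moreover have "shift D' b \<in> carrier M" using b shift_carrier[OF D'(4)] by simp
      ultimately show ?thesis using D' by blast
    qed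
  qed (use rels fv in auto)
  also have "shift (\<lambda>_. {}) \<circ> s = s" using 0 by auto
  finally show ?thesis .
qed

end

section \<open>Standard models\<close>

lemma subsets_image:
  assumes "inj_on f w"
  shows "{B. B \<subseteq> f ` w \<and> card B = n} = (image f) ` {A. A \<subseteq> w \<and> card A = n}"
  using assms by (auto simp: subset_image_iff card_image inj_on_subset)

lemma list_in_image: "set ys \<subseteq> f ` A \<Longrightarrow> \<exists>xs. ys = map f xs \<and> set xs \<subseteq> A"
  by (metis (no_types, lifting) lists_eq_set lists_image mem_Collect_eq imageE)

lemma even_card_xor:
  "even (card {l. l < n \<and> (P l \<noteq> Q l)}) \<longleftrightarrow>
    (even (card {l. l < n \<and> P l}) \<longleftrightarrow> even (card {l. l < (n::nat) \<and> Q l}))"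
proof (induction n)
  case (Suc n)
  have *: "card {l. l < Suc n \<and> R l} = card {l. l < n \<and> R l} + (if R n then 1 else 0)" for R
  proof -
    have "{l. l < Suc n \<and> R l} = {l. l < n \<and> R l} \<union> (if R n then {n} else {})"
      by (auto simp: less_Suc_eq)
    then show ?thesis by auto
  qed
  show ?case using Suc unfolding * by auto
qed simp

text \<open>Symbolic elements of the standard model: a finitely supported function \<open>K \<rightarrow> Z\<^sub>2\<close> is
  represented by its support, \<open>G*\<close> is \<open>K \<times> G\<close> and \<open>H*\<close> is \<open>K \<times> H\<close>.\<close>
datatype 'a elt = EI 'a | EK "'a fset" | EH bool | EG "'a fset fset"
  | EGs "'a fset" "'a fset fset" | EHs "'a fset" bool

fun well_sized :: "nat \<Rightarrow> 'a elt \<Rightarrow> bool" where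
  "well_sized n (EI i) = True"
| "well_sized n (EK u) = (fcard u = n)"
| "well_sized n (EH b) = True"
| "well_sized n (EG \<gamma>) = (\<forall>u \<in> fset \<gamma>. fcard u = n)"
| "well_sized n (EGs u \<gamma>) = (fcard u = n \<and> (\<forall>u \<in> fset \<gamma>. fcard u = n))"
| "well_sized n (EHs u b) = (fcard u = n)"

definition elts :: "nat \<Rightarrow> 'a set \<Rightarrow> 'a elt set" where
  "elts n I = {t. well_sized n t \<and> set_elt t \<subseteq> I}"

text \<open>Addition in a direct sum of copies of Z_2, read on supports.\<close>

definition sdiff :: "'a fset \<Rightarrow> 'a fset \<Rightarrow> 'a fset" where
  "sdiff \<gamma> \<delta> = (\<gamma> |-| \<delta>) |\<union>| (\<delta> |-| \<gamma>)"

lemma mem_sdiff [simp]: "u |\<in>| sdiff \<gamma> \<delta> \<longleftrightarrow> (u |\<in>| \<gamma>) \<noteq> (u |\<in>| \<delta>)"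
  by (auto simp: sdiff_def)

text \<open>\<open>compatible\<close> for symbolic indices. There is no bound on w by an index set:
  for n >= 1, w is the union of the listed sets and lies wherever they do. So the relations on
  symbols are the same for all index sets, and enlarging the index set extends the standard
  model.\<close>

definition full_simplex :: "nat \<Rightarrow> 'a fset list \<Rightarrow> bool" where
  "full_simplex n us \<longleftrightarrow> distinct us \<and>
    (\<exists>w. finite w \<and> card w = Suc n \<and> fset ` set us = {A. A \<subseteq> w \<and> card A = n})"

text \<open>The clause for Q says that the values at v of the n group coordinates, plus the
  H-coordinate \<open>b\<close>, sum to 0 in Z_2. Relative to the points with zero coordinates Q
  holds at every (w, v), and the twisting condition is additivity of parity.\<close>

fun elt_rel :: "nat \<Rightarrow> hsym \<Rightarrow> 'a elt list \<Rightarrow> bool" where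
  "elt_rel n SI xs = (\<exists>i. xs = [EI i])"
| "elt_rel n SK xs = (\<exists>u. xs = [EK u])"
| "elt_rel n SH xs = (\<exists>b. xs = [EH b])"
| "elt_rel n SG xs = (\<exists>\<gamma>. xs = [EG \<gamma>])"
| "elt_rel n SGs xs = (\<exists>u \<gamma>. xs = [EGs u \<gamma>])"
| "elt_rel n SHs xs = (\<exists>u b. xs = [EHs u b])"
| "elt_rel n Mem xs = (\<exists>i u. xs = [EI i, EK u] \<and> i |\<in>| u)"
| "elt_rel n HAdd xs = (\<exists>a b. xs = [EH a, EH b, EH (a \<noteq> b)])"
| "elt_rel n Eval xs = (\<exists>\<gamma> u. xs = [EG \<gamma>, EK u, EH (u |\<in>| \<gamma>)])"
| "elt_rel n Supp xs = (\<exists>\<gamma> u. xs = [EG \<gamma>, EK u] \<and> u |\<in>| \<gamma>)"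
| "elt_rel n GAdd xs = (\<exists>\<gamma> \<delta>. xs = [EG \<gamma>, EG \<delta>, EG (sdiff \<gamma> \<delta>)])"
| "elt_rel n PiG xs = (\<exists>u \<gamma>. xs = [EGs u \<gamma>, EK u])"
| "elt_rel n ActG xs = (\<exists>\<gamma> u \<delta>. xs = [EG \<gamma>, EGs u \<delta>, EGs u (sdiff \<gamma> \<delta>)])"
| "elt_rel n PiH xs = (\<exists>u b. xs = [EHs u b, EK u])"
| "elt_rel n ActH xs = (\<exists>a u b. xs = [EH a, EHs u b, EHs u (a \<noteq> b)])"
| "elt_rel n Qr xs = (\<exists>ps v b. xs = map (\<lambda>p. EGs (fst p) (snd p)) ps @ [EHs v b] \<and> length ps = n \<and>
    full_simplex n (map fst ps @ [v]) \<and>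
    even (length (filter (\<lambda>p. v |\<in>| snd p) ps) + of_bool b))"

text \<open>The cardinality hypothesis concerns \<open>'a\<close> itself, so the models have to be coded into it.\<close>
locale coding =
  fixes e :: "'a elt \<Rightarrow> 'a" and n :: nat
  assumes inj: "inj e" and n: "1 \<le> n"
begin

definition std :: "'a set \<Rightarrow> 'a hstr" where
  "std I = \<lparr> carrier = e ` elts n I,
     rel = (\<lambda>R xs. \<exists>ts. xs = map e ts \<and> set ts \<subseteq> elts n I \<and> elt_rel n R ts) \<rparr>"

lemma e_eq [simp]: "e s = e t \<longleftrightarrow> s = t"
  using inj by (auto dest: injD)

lemma carrier_std: "carrier (std I) = e ` elts n I"
  by (simp add: std_def)

lemma rel_std: "rel (std I) R xs \<longleftrightarrow> (\<exists>ts. xs = map e ts \<and> set ts \<subseteq> elts n I \<and> elt_rel n R ts)"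
  by (simp add: std_def)

lemma rel_std_map: "rel (std I) R (map e ts) \<longleftrightarrow> set ts \<subseteq> elts n I \<and> elt_rel n R ts"
  using inj by (auto simp: rel_std inj_map_eq_map)

lemma rel_std_lists:
  "rel (std I) R [x] \<longleftrightarrow> (\<exists>t \<in> elts n I. x = e t \<and> elt_rel n R [t])"
  "rel (std I) R [x, y] \<longleftrightarrow> (\<exists>t \<in> elts n I. \<exists>t' \<in> elts n I. x = e t \<and> y = e t' \<and> elt_rel n R [t, t'])"
  "rel (std I) R [x, y, w] \<longleftrightarrow> (\<exists>t \<in> elts n I. \<exists>t' \<in> elts n I. \<exists>t'' \<in> elts n I.
    x = e t \<and> y = e t' \<and> w = e t'' \<and> elt_rel n R [t, t', t''])"
  unfolding rel_std by (auto simp: Cons_eq_map_conv simp del: elt_rel.simps)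

definition KK :: "'a set \<Rightarrow> 'a fset set" where
  "KK I = {u. fset u \<subseteq> I \<and> fcard u = n}"

definition GG :: "'a set \<Rightarrow> 'a fset fset set" where
  "GG I = {\<gamma>. fset \<gamma> \<subseteq> KK I}"

lemma elts_simps [simp]:
  "EI i \<in> elts n I \<longleftrightarrow> i \<in> I"
  "EK u \<in> elts n I \<longleftrightarrow> u \<in> KK I"
  "EH b \<in> elts n I"
  "EG \<gamma> \<in> elts n I \<longleftrightarrow> \<gamma> \<in> GG I"
  "EGs u \<gamma> \<in> elts n I \<longleftrightarrow> u \<in> KK I \<and> \<gamma> \<in> GG I"
  "EHs u b \<in> elts n I \<longleftrightarrow> u \<in> KK I"
  unfolding elts_def KK_def GG_def by auto

lemma sdiff_GG: "\<gamma> \<in> GG I \<Longrightarrow> \<delta> \<in> GG I \<Longrightarrow> sdiff \<gamma> \<delta> \<in> GG I"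
  by (auto simp: GG_def sdiff_def)

lemma srt_std:
  "srt (std I) SI = (\<lambda>i. e (EI i)) ` I"
  "srt (std I) SK = (\<lambda>u. e (EK u)) ` KK I"
  "srt (std I) SH = range (\<lambda>b. e (EH b))"
  "srt (std I) SG = (\<lambda>\<gamma>. e (EG \<gamma>)) ` GG I"
  "srt (std I) SGs = (\<lambda>p. e (EGs (fst p) (snd p))) ` (KK I \<times> GG I)"
  "srt (std I) SHs = (\<lambda>p. e (EHs (fst p) (snd p))) ` (KK I \<times> UNIV)"
  unfolding srt_def carrier_std rel_std_lists by (auto simp: image_iff)

lemma mem_srt_std [simp]:
  "e (EI i) \<in> srt (std I) SI \<longleftrightarrow> i \<in> I"
  "e (EK u) \<in> srt (std I) SK \<longleftrightarrow> u \<in> KK I"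
  "e (EH b) \<in> srt (std I) SH"
  "e (EG \<gamma>) \<in> srt (std I) SG \<longleftrightarrow> \<gamma> \<in> GG I"
  "e (EGs u \<gamma>) \<in> srt (std I) SGs \<longleftrightarrow> u \<in> KK I \<and> \<gamma> \<in> GG I"
  "e (EHs u b) \<in> srt (std I) SHs \<longleftrightarrow> u \<in> KK I"
  unfolding srt_def carrier_std rel_std_lists by auto

lemma rel_std_args:
  "rel (std I) Mem [x, y] \<longleftrightarrow> (\<exists>i \<in> I. \<exists>u \<in> KK I. x = e (EI i) \<and> y = e (EK u) \<and> i |\<in>| u)"
  "rel (std I) HAdd [x, y, t] \<longleftrightarrow> (\<exists>a b. x = e (EH a) \<and> y = e (EH b) \<and> t = e (EH (a \<noteq> b)))"
  "rel (std I) Eval [x, y, t] \<longleftrightarrow>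
    (\<exists>\<gamma> \<in> GG I. \<exists>u \<in> KK I. x = e (EG \<gamma>) \<and> y = e (EK u) \<and> t = e (EH (u |\<in>| \<gamma>)))"
  "rel (std I) Supp [x, y] \<longleftrightarrow> (\<exists>\<gamma> \<in> GG I. \<exists>u \<in> KK I. x = e (EG \<gamma>) \<and> y = e (EK u) \<and> u |\<in>| \<gamma>)"
  "rel (std I) GAdd [x, y, t] \<longleftrightarrow>
    (\<exists>\<gamma> \<in> GG I. \<exists>\<delta> \<in> GG I. x = e (EG \<gamma>) \<and> y = e (EG \<delta>) \<and> t = e (EG (sdiff \<gamma> \<delta>)))"
  "rel (std I) PiG [x, y] \<longleftrightarrow> (\<exists>u \<in> KK I. \<exists>\<gamma> \<in> GG I. x = e (EGs u \<gamma>) \<and> y = e (EK u))"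
  "rel (std I) ActG [x, y, t] \<longleftrightarrow> (\<exists>\<gamma> \<in> GG I. \<exists>u \<in> KK I. \<exists>\<delta> \<in> GG I.
    x = e (EG \<gamma>) \<and> y = e (EGs u \<delta>) \<and> t = e (EGs u (sdiff \<gamma> \<delta>)))"
  "rel (std I) PiH [x, y] \<longleftrightarrow> (\<exists>u \<in> KK I. \<exists>b. x = e (EHs u b) \<and> y = e (EK u))"
  "rel (std I) ActH [x, y, t] \<longleftrightarrow>
    (\<exists>a. \<exists>u \<in> KK I. \<exists>b. x = e (EH a) \<and> y = e (EHs u b) \<and> t = e (EHs u (a \<noteq> b)))"
  unfolding rel_std_lists using sdiff_GG by auto

lemma memset_std: "u \<in> KK I \<Longrightarrow> memset (std I) (e (EK u)) = (\<lambda>i. e (EI i)) ` fset u"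
  by (auto simp: memset_def rel_std_args KK_def)

lemma ev_std: "\<gamma> \<in> GG I \<Longrightarrow> u \<in> KK I \<Longrightarrow> ev (std I) (e (EG \<gamma>)) (e (EK u)) = e (EH (u |\<in>| \<gamma>))"
  by (simp add: ev_def rel_std_args)

lemma piG_std: "u \<in> KK I \<Longrightarrow> \<gamma> \<in> GG I \<Longrightarrow> piG (std I) (e (EGs u \<gamma>)) = e (EK u)"
  by (auto simp: piG_def rel_std_args)

lemma piH_std: "u \<in> KK I \<Longrightarrow> piH (std I) (e (EHs u b)) = e (EK u)"
  by (auto simp: piH_def rel_std_args)

lemma compatible_std:
  assumes "set us \<subseteq> KK I"
  shows "compatible n (std I) (map (\<lambda>u. e (EK u)) us) \<longleftrightarrow> full_simplex n us"
proof -
  let ?f = "\<lambda>i. e (EI i)"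
  have f: "inj ?f" by (auto intro: injI)
  have "distinct (map (\<lambda>u. e (EK u)) us) \<longleftrightarrow> distinct us"
    by (auto simp: distinct_map inj_on_def)
  moreover have m: "memset (std I) ` set (map (\<lambda>u. e (EK u)) us) = image ?f ` (fset ` set us)"
  proof -
    have "memset (std I) (e (EK u)) = ?f ` fset u" if "u \<in> set us" for u
      using that assms memset_std by blast
    then have "(\<lambda>u. memset (std I) (e (EK u))) ` set us = (\<lambda>u. ?f ` fset u) ` set us"
      by (rule image_cong[OF refl])
    then show ?thesis by (simp only: set_map image_image)
  qed
  have fi: "inj_on ?f w" for w by (auto simp: inj_on_def)
  have inj: "inj (image ?f)" using f by (simp add: inj_image_eq_iff inj_on_def)
  have sub: "{A. A \<subseteq> ?f ` w \<and> card A = n} = image ?f ` {A. A \<subseteq> w \<and> card A = n}" for w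
    by (rule subsets_image[OF fi])
  have "(\<exists>w \<subseteq> ?f ` I. finite w \<and> card w = Suc n \<and>
        image ?f ` (fset ` set us) = {A. A \<subseteq> w \<and> card A = n}) \<longleftrightarrow>
      (\<exists>w. finite w \<and> card w = Suc n \<and> fset ` set us = {A. A \<subseteq> w \<and> card A = n})"
    (is "?L \<longleftrightarrow> ?R")
  proof
    assume ?L
    then obtain w where w: "w \<subseteq> ?f ` I" "finite w" "card w = Suc n"
      "image ?f ` (fset ` set us) = {A. A \<subseteq> w \<and> card A = n}" by blast
    from w(1) obtain w' where w': "w = ?f ` w'" by (rule subset_imageE)
    have "finite w'" using w(2) unfolding w' finite_image_iff[OF fi] .
    moreover have "card w' = Suc n" using w(3) unfolding w' card_image[OF fi] .
    moreover have "fset ` set us = {A. A \<subseteq> w' \<and> card A = n}"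
      using w(4) unfolding w' sub inj_image_eq_iff[OF inj] .
    ultimately show ?R by blast
  next
    assume ?R
    then obtain w where w: "finite w" "card w = Suc n" "fset ` set us = {A. A \<subseteq> w \<and> card A = n}"
      by blast
    have "w = \<Union>(fset ` set us)" unfolding w(3) using Union_subsets_card[OF w(1,2) n] by simp
    then have "w \<subseteq> I" using assms unfolding KK_def by auto
    moreover have "finite (?f ` w)" "card (?f ` w) = Suc n"
      using w(1,2) card_image[OF fi, of w] by simp_all
    moreover have "image ?f ` (fset ` set us) = {A. A \<subseteq> ?f ` w \<and> card A = n}"
      unfolding w(3) sub by (rule refl)
    ultimately show ?L by (intro exI[of _ "?f ` w"] conjI image_mono)
  qed
  ultimately show ?thesis
    unfolding compatible_def full_simplex_def m srt_std(1) by simp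
qed

lemma Qr_std:
  assumes ps: "set ps \<subseteq> KK I \<times> GG I" "length ps = n" and v: "v \<in> KK I"
  defines "xs \<equiv> map (\<lambda>p. e (EGs (fst p) (snd p))) ps"
  shows "rel (std I) Qr (xs @ [e (EHs v b)]) \<longleftrightarrow>
      compatible n (std I) (map (piG (std I)) xs @ [piH (std I) (e (EHs v b))]) \<and>
      even (length (filter (\<lambda>p. v |\<in>| snd p) ps) + of_bool b)"
    and "map (piG (std I)) xs @ [piH (std I) (e (EHs v b))] = map (\<lambda>u. e (EK u)) (map fst ps @ [v])"
    and "compatible n (std I) (map (piG (std I)) xs @ [piH (std I) (e (EHs v b))]) \<longleftrightarrow>
      full_simplex n (map fst ps @ [v])"
proof -
  show pi: "map (piG (std I)) xs @ [piH (std I) (e (EHs v b))] = map (\<lambda>u. e (EK u)) (map fst ps @ [v])"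
    using ps(1) v by (auto simp: xs_def piG_std piH_std)
  show c: "compatible n (std I) (map (piG (std I)) xs @ [piH (std I) (e (EHs v b))]) \<longleftrightarrow>
      full_simplex n (map fst ps @ [v])"
    unfolding pi by (rule compatible_std) (use ps(1) v in auto)
  let ?ts = "map (\<lambda>p. EGs (fst p) (snd p)) ps @ [EHs v b]"
  have "xs @ [e (EHs v b)] = map e ?ts" by (simp add: xs_def)
  then have 1: "rel (std I) Qr (xs @ [e (EHs v b)]) \<longleftrightarrow> set ?ts \<subseteq> elts n I \<and> elt_rel n Qr ?ts"
    by (simp only: rel_std_map)
  have 2: "set ?ts \<subseteq> elts n I" using ps(1) v by auto
  \<comment> \<open>The pairs can be read off the symbolic tuple, so the quantifier in the clause
    for Q has just one possible witness.\<close>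
  have "ps = qs" if "map (\<lambda>p. EGs (fst p) (snd p)) ps = map (\<lambda>p. EGs (fst p) (snd p)) qs" for qs
    using that by (rule map_injective) (auto intro: injI prod_eqI)
  then have "elt_rel n Qr ?ts \<longleftrightarrow> full_simplex n (map fst ps @ [v]) \<and>
      even (length (filter (\<lambda>p. v |\<in>| snd p) ps) + of_bool b)"
    using ps by auto
  with 1 2 c show "rel (std I) Qr (xs @ [e (EHs v b)]) \<longleftrightarrow>
      compatible n (std I) (map (piG (std I)) xs @ [piH (std I) (e (EHs v b))]) \<and>
      even (length (filter (\<lambda>p. v |\<in>| snd p) ps) + of_bool b)"
    by blast
qed

lemma GG_eqI: "(\<And>u. u \<in> KK I \<Longrightarrow> u |\<in>| \<gamma> \<longleftrightarrow> u |\<in>| \<delta>) \<Longrightarrow> \<gamma> \<in> GG I \<Longrightarrow> \<delta> \<in> GG I \<Longrightarrow> \<gamma> = \<delta>"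
  by (rule fset_eqI) (auto simp: GG_def)

lemma finite_KK_image: "finite S \<Longrightarrow> S \<subseteq> KK I \<Longrightarrow> \<exists>\<gamma> \<in> GG I. \<forall>u. u |\<in>| \<gamma> \<longleftrightarrow> u \<in> S"
  by (rule bexI[of _ "Abs_fset S"]) (auto simp: GG_def Abs_fset_inverse)

text \<open>Three points carry content: a finitely supported function on K is a finite set of
  indices, so G is the full direct sum; symmetric difference is a group operation of exponent 2, so
  the action is regular; and the parity defining Q is additive, which is the twisting
  condition.\<close>

lemma hs_std: "hs n (std I) (e (EH False)) (e (EH True))"
proof
  show "\<forall>S xs. rel (std I) S xs \<longrightarrow> set xs \<subseteq> carrier (std I) \<and> length xs = arity n S"
  proof (intro allI impI)
    fix S xs assume "rel (std I) S xs"
    then obtain ts where ts: "xs = map e ts" "set ts \<subseteq> elts n I" "elt_rel n S ts"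
      unfolding rel_std by blast
    have "length ts = arity n S" using ts(3) by (cases S) auto
    then show "set xs \<subseteq> carrier (std I) \<and> length xs = arity n S"
      using ts(1,2) by (auto simp: carrier_std)
  qed
  show "\<forall>x \<in> carrier (std I). \<exists>!S \<in> {SI, SK, SH, SG, SGs, SHs}. rel (std I) S [x]"
  proof
    fix x assume "x \<in> carrier (std I)"
    then obtain t where t: "t \<in> elts n I" "x = e t" by (auto simp: carrier_std)
    then have r: "rel (std I) S [x] \<longleftrightarrow> elt_rel n S [t]" for S
      by (simp add: rel_std_lists del: elt_rel.simps)
    define S where "S = (case t of EI _ \<Rightarrow> SI | EK _ \<Rightarrow> SK | EH _ \<Rightarrow> SH | EG _ \<Rightarrow> SG
      | EGs _ _ \<Rightarrow> SGs | EHs _ _ \<Rightarrow> SHs)"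
    show "\<exists>!S \<in> {SI, SK, SH, SG, SGs, SHs}. rel (std I) S [x]"
      unfolding r by (rule ex1I[of _ S]; cases t) (auto simp: S_def)
  qed
  show "bij_betw (memset (std I)) (srt (std I) SK) {A. A \<subseteq> srt (std I) SI \<and> finite A \<and> card A = n}"
    unfolding bij_betw_def
  proof
    have fi: "inj_on (\<lambda>i. e (EI i)) w" for w by (auto simp: inj_on_def)
    show "inj_on (memset (std I)) (srt (std I) SK)"
    proof (rule inj_onI)
      fix x y assume "x \<in> srt (std I) SK" "y \<in> srt (std I) SK" "memset (std I) x = memset (std I) y"
      then obtain u v where "u \<in> KK I" "v \<in> KK I" "x = e (EK u)" "y = e (EK v)"
          "(\<lambda>i. e (EI i)) ` fset u = (\<lambda>i. e (EI i)) ` fset v"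
        unfolding srt_std using memset_std by auto
      then show "x = y" using inj_image_eq_iff[OF fi] by (simp add: fset_inject)
    qed
    show "memset (std I) ` srt (std I) SK = {A. A \<subseteq> srt (std I) SI \<and> finite A \<and> card A = n}"
    proof (intro equalityI subsetI)
      fix A assume "A \<in> memset (std I) ` srt (std I) SK"
      then obtain u where u: "u \<in> KK I" "A = (\<lambda>i. e (EI i)) ` fset u"
        unfolding srt_std using memset_std by auto
      then show "A \<in> {A. A \<subseteq> srt (std I) SI \<and> finite A \<and> card A = n}"
        using card_image[OF fi] by (auto simp: srt_std KK_def fcard.rep_eq)
    next
      fix A assume "A \<in> {A. A \<subseteq> srt (std I) SI \<and> finite A \<and> card A = n}"
      then have A: "A \<subseteq> (\<lambda>i. e (EI i)) ` I" "finite A" "card A = n" by (auto simp: srt_std)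
      from A(1) obtain B where B: "B \<subseteq> I" "A = (\<lambda>i. e (EI i)) ` B" by (rule subset_imageE)
      have "finite B" "card B = n"
        using A(2,3) card_image[OF fi, of B] unfolding B(2) finite_image_iff[OF fi] by simp_all
      then have "Abs_fset B \<in> KK I" "fset (Abs_fset B) = B"
        using B(1) by (simp_all add: KK_def fcard.rep_eq Abs_fset_inverse)
      then show "A \<in> memset (std I) ` srt (std I) SK"
        unfolding srt_std using memset_std B(2) by (metis (no_types, lifting) image_eqI)
    qed
  qed
  show "\<forall>g \<in> srt (std I) SG. finite {u \<in> srt (std I) SK. ev (std I) g u \<noteq> e (EH False)}"
  proof
    fix g assume "g \<in> srt (std I) SG"
    then obtain \<gamma> where g: "\<gamma> \<in> GG I" "g = e (EG \<gamma>)" unfolding srt_std by blast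
    have "{u \<in> srt (std I) SK. ev (std I) g u \<noteq> e (EH False)} \<subseteq> (\<lambda>u. e (EK u)) ` fset \<gamma>"
      using g by (auto simp: srt_std ev_std)
    then show "finite {u \<in> srt (std I) SK. ev (std I) g u \<noteq> e (EH False)}"
      by (rule finite_subset) simp
  qed
  show "\<forall>f. (\<forall>u \<in> srt (std I) SK. f u \<in> srt (std I) SH) \<and> finite {u \<in> srt (std I) SK. f u \<noteq> e (EH False)} \<longrightarrow>
      (\<exists>!g. g \<in> srt (std I) SG \<and> (\<forall>u \<in> srt (std I) SK. ev (std I) g u = f u))"
  proof (intro allI impI; elim conjE)
    fix f assume f: "\<forall>u \<in> srt (std I) SK. f u \<in> srt (std I) SH"
      "finite {u \<in> srt (std I) SK. f u \<noteq> e (EH False)}"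
    \<comment> \<open>The support of \<open>f\<close> as a set of symbolic indices; as a finite set
      of sets it is itself the symbol of the required element of G.\<close>
    let ?S = "{k \<in> KK I. f (e (EK k)) \<noteq> e (EH False)}"
    have "(\<lambda>k. e (EK k)) ` ?S \<subseteq> {u \<in> srt (std I) SK. f u \<noteq> e (EH False)}" by (auto simp: srt_std)
    then have "finite ((\<lambda>k. e (EK k)) ` ?S)" using f(2) finite_subset by blast
    then have "finite ?S" by (rule finite_imageD) (auto simp: inj_on_def)
    then obtain \<gamma> where \<gamma>: "\<gamma> \<in> GG I" "\<forall>u. u |\<in>| \<gamma> \<longleftrightarrow> u \<in> ?S"
      using finite_KK_image[of ?S I] by auto
    have fv: "f (e (EK k)) = e (EH (k |\<in>| \<gamma>))" if "k \<in> KK I" for k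
    proof -
      have "f (e (EK k)) \<in> srt (std I) SH" using f(1) that unfolding srt_std by blast
      then obtain b where "f (e (EK k)) = e (EH b)" unfolding srt_std by blast
      then show ?thesis using \<gamma>(2) that by (cases b) auto
    qed
    show "\<exists>!g. g \<in> srt (std I) SG \<and> (\<forall>u \<in> srt (std I) SK. ev (std I) g u = f u)"
    proof (rule ex1I[of _ "e (EG \<gamma>)"])
      show "e (EG \<gamma>) \<in> srt (std I) SG \<and> (\<forall>u \<in> srt (std I) SK. ev (std I) (e (EG \<gamma>)) u = f u)"
        using \<gamma>(1) fv by (auto simp: srt_std ev_std)
      fix g assume g: "g \<in> srt (std I) SG \<and> (\<forall>u \<in> srt (std I) SK. ev (std I) g u = f u)"
      then obtain \<delta> where d: "\<delta> \<in> GG I" "g = e (EG \<delta>)" unfolding srt_std by blast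
      have "u |\<in>| \<delta> \<longleftrightarrow> u |\<in>| \<gamma>" if "u \<in> KK I" for u
        using g d that fv ev_std[OF d(1) that] unfolding srt_std by auto
      then have "\<delta> = \<gamma>" by (rule GG_eqI[OF _ d(1) \<gamma>(1)])
      then show "g = e (EG \<gamma>)" using d(2) by simp
    qed
  qed
  show "\<forall>g d ea. rel (std I) GAdd [g, d, ea] \<longleftrightarrow> g \<in> srt (std I) SG \<and> d \<in> srt (std I) SG \<and> ea \<in> srt (std I) SG \<and>
      (\<forall>u \<in> srt (std I) SK. rel (std I) HAdd [ev (std I) g u, ev (std I) d u, ev (std I) ea u])"
  proof (intro allI iffI)
    fix g d h assume "rel (std I) GAdd [g, d, h]"
    then show "g \<in> srt (std I) SG \<and> d \<in> srt (std I) SG \<and> h \<in> srt (std I) SG \<and>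
      (\<forall>u \<in> srt (std I) SK. rel (std I) HAdd [ev (std I) g u, ev (std I) d u, ev (std I) h u])"
      unfolding rel_std_args srt_std using sdiff_GG by (auto simp: ev_std)
  next
    fix g d h assume a: "g \<in> srt (std I) SG \<and> d \<in> srt (std I) SG \<and> h \<in> srt (std I) SG \<and>
      (\<forall>u \<in> srt (std I) SK. rel (std I) HAdd [ev (std I) g u, ev (std I) d u, ev (std I) h u])"
    then obtain \<gamma> \<delta> \<eta> where g: "\<gamma> \<in> GG I" "\<delta> \<in> GG I" "\<eta> \<in> GG I" "g = e (EG \<gamma>)" "d = e (EG \<delta>)" "h = e (EG \<eta>)"
      unfolding srt_std by blast
    have "u |\<in>| \<eta> \<longleftrightarrow> u |\<in>| sdiff \<gamma> \<delta>" if "u \<in> KK I" for u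
      using a that unfolding srt_std rel_std_args g(4-6) by (auto simp: ev_std g(1-3))
    then have "\<eta> = sdiff \<gamma> \<delta>" by (rule GG_eqI[OF _ g(3) sdiff_GG[OF g(1,2)]])
    then show "rel (std I) GAdd [g, d, h]" unfolding rel_std_args using g by blast
  qed
  show "\<forall>g \<in> srt (std I) SG. \<forall>x \<in> srt (std I) SGs.
      (\<forall>u \<in> srt (std I) SK. ev (std I) g u = e (EH False)) \<longrightarrow> rel (std I) ActG [g, x, x]"
  proof (intro ballI impI)
    fix g x assume a: "g \<in> srt (std I) SG" "x \<in> srt (std I) SGs"
      "\<forall>u \<in> srt (std I) SK. ev (std I) g u = e (EH False)"
    then obtain \<gamma> u \<delta> where g: "\<gamma> \<in> GG I" "u \<in> KK I" "\<delta> \<in> GG I" "g = e (EG \<gamma>)" "x = e (EGs u \<delta>)"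
      unfolding srt_std by auto
    have "\<not> k |\<in>| \<gamma>" if "k \<in> KK I" for k
    proof -
      have "e (EK k) \<in> srt (std I) SK" using that unfolding srt_std by blast
      then show ?thesis using a(3) ev_std[OF g(1) that] unfolding g(4) by auto
    qed
    then have "sdiff \<gamma> \<delta> = \<delta>"
      by (intro GG_eqI[OF _ sdiff_GG[OF g(1,3)] g(3)]) simp
    then have "e (EGs u \<delta>) = e (EGs u (sdiff \<gamma> \<delta>))" by simp
    then show "rel (std I) ActG [g, x, x]" unfolding rel_std_args using g by blast
  qed
  show "\<forall>x \<in> srt (std I) SGs. \<forall>x' \<in> srt (std I) SGs. piG (std I) x = piG (std I) x' \<longrightarrow>
      (\<exists>!g. g \<in> srt (std I) SG \<and> rel (std I) ActG [g, x, x'])"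
  proof (intro ballI impI)
    fix x x' assume a: "x \<in> srt (std I) SGs" "x' \<in> srt (std I) SGs" "piG (std I) x = piG (std I) x'"
    then obtain u \<delta> \<epsilon> where x: "u \<in> KK I" "\<delta> \<in> GG I" "\<epsilon> \<in> GG I" "x = e (EGs u \<delta>)" "x' = e (EGs u \<epsilon>)"
      unfolding srt_std by (auto simp: piG_std)
    have eq: "\<epsilon> = sdiff \<gamma> \<delta> \<longleftrightarrow> \<gamma> = sdiff \<delta> \<epsilon>" for \<gamma>
      by (auto simp: fset_eq_iff)
    then show "\<exists>!g. g \<in> srt (std I) SG \<and> rel (std I) ActG [g, x, x']"
      using sdiff_GG[OF x(2,3)] x unfolding rel_std_args srt_std
      by (intro ex1I[of _ "e (EG (sdiff \<delta> \<epsilon>))"]) auto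
  qed
  show "\<forall>g d ea x x1 x2. rel (std I) GAdd [g, d, ea] \<longrightarrow> rel (std I) ActG [d, x, x1] \<longrightarrow>
      rel (std I) ActG [g, x1, x2] \<longrightarrow> rel (std I) ActG [ea, x, x2]"
  proof (intro allI impI)
    fix g d h x x1 x2
    assume a: "rel (std I) GAdd [g, d, h]" "rel (std I) ActG [d, x, x1]" "rel (std I) ActG [g, x1, x2]"
    have "sdiff \<gamma> (sdiff \<delta> \<epsilon>) = sdiff (sdiff \<gamma> \<delta>) \<epsilon>" for \<gamma> \<delta> \<epsilon> :: "'a fset fset"
      by (auto simp: fset_eq_iff)
    then show "rel (std I) ActG [h, x, x2]"
      using a unfolding rel_std_args using sdiff_GG by auto
  qed
  show "\<forall>y \<in> srt (std I) SHs. \<forall>y' \<in> srt (std I) SHs. piH (std I) y = piH (std I) y' \<longrightarrow>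
      (\<exists>!m. m \<in> srt (std I) SH \<and> rel (std I) ActH [m, y, y'])"
  proof (intro ballI impI)
    fix x x' assume a: "x \<in> srt (std I) SHs" "x' \<in> srt (std I) SHs" "piH (std I) x = piH (std I) x'"
    then obtain u b c where x: "u \<in> KK I" "x = e (EHs u b)" "x' = e (EHs u c)"
      unfolding srt_std by (auto simp: piH_std)
    then show "\<exists>!m. m \<in> srt (std I) SH \<and> rel (std I) ActH [m, x, x']"
      unfolding rel_std_args srt_std
      by (intro ex1I[of _ "e (EH (b \<noteq> c))"]) auto
  qed
  show "\<forall>u \<in> srt (std I) SK. \<exists>x \<in> srt (std I) SGs. piG (std I) x = u"
  proof
    fix u assume "u \<in> srt (std I) SK"
    then obtain k where k: "k \<in> KK I" "u = e (EK k)" unfolding srt_std by blast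
    have "{||} \<in> GG I" by (simp add: GG_def)
    then show "\<exists>x \<in> srt (std I) SGs. piG (std I) x = u"
      using k piG_std[of k I "{||}"] by (intro bexI[of _ "e (EGs k {||})"]) (force simp: srt_std)+
  qed
  show "\<forall>u \<in> srt (std I) SK. \<exists>x \<in> srt (std I) SHs. piH (std I) x = u"
    unfolding srt_std by (auto simp: piH_std)
  show "\<forall>x u. rel (std I) PiG [x, u] \<longrightarrow> x \<in> srt (std I) SGs \<and> u \<in> srt (std I) SK"
    "\<forall>y u. rel (std I) PiH [y, u] \<longrightarrow> y \<in> srt (std I) SHs \<and> u \<in> srt (std I) SK"
    unfolding rel_std_args by auto
  show "\<forall>g x x'. rel (std I) ActG [g, x, x'] \<longrightarrow>
      g \<in> srt (std I) SG \<and> x \<in> srt (std I) SGs \<and> x' \<in> srt (std I) SGs \<and> piG (std I) x' = piG (std I) x"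
    unfolding rel_std_args using sdiff_GG by (auto simp: piG_std)
  show "\<forall>m y y'. rel (std I) ActH [m, y, y'] \<longrightarrow>
      m \<in> srt (std I) SH \<and> y \<in> srt (std I) SHs \<and> y' \<in> srt (std I) SHs \<and> piH (std I) y' = piH (std I) y"
    unfolding rel_std_args by (auto simp: piH_std)
  show "\<forall>g u. rel (std I) Supp [g, u] \<longleftrightarrow> g \<in> srt (std I) SG \<and> u \<in> srt (std I) SK \<and> ev (std I) g u \<noteq> e (EH False)"
    unfolding rel_std_args srt_std by (auto simp: ev_std)
  have list: "\<exists>ps v b. xs = map (\<lambda>p. e (EGs (fst p) (snd p))) ps \<and> y = e (EHs v b) \<and>
      set ps \<subseteq> KK I \<times> GG I \<and> v \<in> KK I"
    if "set xs \<subseteq> srt (std I) SGs" "y \<in> srt (std I) SHs" for xs y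
    using that list_in_image[of xs _ "KK I \<times> GG I"] unfolding srt_std by fastforce
  have Qc: "set xs \<subseteq> srt (std I) SGs \<and> length xs = n \<and> y \<in> srt (std I) SHs \<and>
      compatible n (std I) (map (piG (std I)) xs @ [piH (std I) y])"
    if r: "rel (std I) Qr (xs @ [y])" for xs y
  proof -
    obtain ts where ts: "xs @ [y] = map e ts" "set ts \<subseteq> elts n I" "elt_rel n Qr ts"
      using r unfolding rel_std by blast
    then obtain ps v b where p: "ts = map (\<lambda>p. EGs (fst p) (snd p)) ps @ [EHs v b]" "length ps = n"
      by auto
    have xs: "xs = map (\<lambda>p. e (EGs (fst p) (snd p))) ps" "y = e (EHs v b)"
      using ts(1) unfolding p(1) by simp_all
    have ps: "set ps \<subseteq> KK I \<times> GG I" "v \<in> KK I" using ts(2) unfolding p(1) by auto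
    have "set xs \<subseteq> srt (std I) SGs" "y \<in> srt (std I) SHs" using ps by (auto simp: xs)
    moreover have "length xs = n" using p(2) by (simp add: xs)
    ultimately show ?thesis
      using r Qr_std(1)[OF ps(1) p(2) ps(2), of b] unfolding xs by blast
  qed
  then show "\<forall>xs y. rel (std I) Qr (xs @ [y]) \<longrightarrow> set xs \<subseteq> srt (std I) SGs \<and> y \<in> srt (std I) SHs \<and>
      compatible n (std I) (map (piG (std I)) xs @ [piH (std I) y])"
    by blast
  show "\<forall>xs \<sigma> y. length xs = n \<longrightarrow> \<sigma> permutes {..<n} \<longrightarrow>
      (rel (std I) Qr (xs @ [y]) \<longleftrightarrow> rel (std I) Qr (map (\<lambda>l. xs ! \<sigma> l) [0..<n] @ [y]))"
  proof (intro allI impI)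
    fix xs :: "'a list" and \<sigma> and y :: 'a assume len: "length xs = n" and \<sigma>: "\<sigma> permutes {..<n}"
    let ?xs = "map (\<lambda>l. xs ! \<sigma> l) [0..<n]"
    have xs: "?xs = permute_list \<sigma> xs" using len by (simp add: permute_list_def)
    have "set ?xs = set xs" unfolding xs using \<sigma> len by simp
    show "rel (std I) Qr (xs @ [y]) \<longleftrightarrow> rel (std I) Qr (?xs @ [y])"
    proof (cases "set xs \<subseteq> srt (std I) SGs \<and> y \<in> srt (std I) SHs")
      case False
      then show ?thesis using Qc[of xs y] Qc[of ?xs y] \<open>set ?xs = set xs\<close> by blast
    next
      case True
      then obtain ps v b where p: "xs = map (\<lambda>p. e (EGs (fst p) (snd p))) ps" "y = e (EHs v b)"
          "set ps \<subseteq> KK I \<times> GG I" "v \<in> KK I" using list by blast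
      let ?ps = "permute_list \<sigma> ps"
      have len': "length ps = n" using len p(1) by simp
      have \<sigma>': "\<sigma> permutes {..<length ps}" using \<sigma> len' by simp
      have m: "mset ?ps = mset ps" by (rule mset_permute_list[OF \<sigma>'])
      have ps': "set ?ps \<subseteq> KK I \<times> GG I" "length ?ps = n"
        using p(3) len' \<sigma>' by simp_all
      have xs': "?xs = map (\<lambda>p. e (EGs (fst p) (snd p))) ?ps"
        using xs permute_list_map[OF \<sigma>'] unfolding p(1) by simp
      have ms: "mset (map fst ?ps @ [v]) = mset (map fst ps @ [v])" using m by (simp only: mset_append mset_map)
      have "full_simplex n (map fst ?ps @ [v]) \<longleftrightarrow> full_simplex n (map fst ps @ [v])"
        unfolding full_simplex_def mset_eq_imp_distinct_iff[OF ms] mset_eq_setD[OF ms] ..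
      moreover have "length (filter (\<lambda>p. v |\<in>| snd p) ?ps) = length (filter (\<lambda>p. v |\<in>| snd p) ps)"
        using m by (metis mset_filter size_mset)
      ultimately show ?thesis
        using Qr_std(1,3)[OF ps' p(4), of b] Qr_std(1,3)[OF p(3) len' p(4), of b]
        unfolding xs' unfolding p(1,2) by argo
    qed
  qed
  show "\<forall>xs y gs m xs' y'. length xs = n \<longrightarrow> set xs \<subseteq> srt (std I) SGs \<longrightarrow> y \<in> srt (std I) SHs \<longrightarrow>
      compatible n (std I) (map (piG (std I)) xs @ [piH (std I) y]) \<longrightarrow>
      length gs = n \<longrightarrow> set gs \<subseteq> srt (std I) SG \<longrightarrow> m \<in> srt (std I) SH \<longrightarrow> length xs' = n \<longrightarrow>
      (\<forall>l < n. rel (std I) ActG [gs ! l, xs ! l, xs' ! l]) \<longrightarrow> rel (std I) ActH [m, y, y'] \<longrightarrow>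
      ((rel (std I) Qr (xs @ [y]) \<longleftrightarrow> rel (std I) Qr (xs' @ [y'])) \<longleftrightarrow>
       even (card {l. l < n \<and> ev (std I) (gs ! l) (piH (std I) y) \<noteq> e (EH False)} +
         (if m = e (EH False) then 0 else 1)))"
  proof (intro allI impI)
    fix xs y gs m xs' y'
    assume a: "length xs = n" "set xs \<subseteq> srt (std I) SGs" "y \<in> srt (std I) SHs"
      "compatible n (std I) (map (piG (std I)) xs @ [piH (std I) y])" "length gs = n"
      "set gs \<subseteq> srt (std I) SG" "m \<in> srt (std I) SH" "length xs' = n"
      "\<forall>l < n. rel (std I) ActG [gs ! l, xs ! l, xs' ! l]" "rel (std I) ActH [m, y, y']"
    obtain ps v b where p: "xs = map (\<lambda>p. e (EGs (fst p) (snd p))) ps" "y = e (EHs v b)"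
        "set ps \<subseteq> KK I \<times> GG I" "v \<in> KK I" using list a by blast
    obtain hs where h: "gs = map (\<lambda>\<gamma>. e (EG \<gamma>)) hs" "set hs \<subseteq> GG I"
      using list_in_image[OF a(6)[unfolded srt_std]] by blast
    obtain c where c: "m = e (EH c)" using a(7) unfolding srt_std by blast
    have len: "length ps = n" "length hs = n" using a p(1) h(1) by simp_all
    \<comment> \<open>The coordinates of \<open>xs'\<close>: acting by \<open>hs ! l\<close> keeps
      the stalk index and adds \<open>hs ! l\<close> to the group coordinate. Both Q-values thereby
      become explicit parities.\<close>
    let ?qs = "map (\<lambda>l. (fst (ps ! l), sdiff (hs ! l) (snd (ps ! l)))) [0..<n]"
    have mem: "ps ! l \<in> KK I \<times> GG I" "hs ! l \<in> GG I" if "l < n" for l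
      by (rule subsetD[OF p(3)] subsetD[OF h(2)]; use that len in simp)+
    have "(fst (ps ! l), sdiff (hs ! l) (snd (ps ! l))) \<in> KK I \<times> GG I" if "l < n" for l
      using mem[OF that] sdiff_GG by (simp add: mem_Times_iff)
    then have qs: "set ?qs \<subseteq> KK I \<times> GG I" "length ?qs = n" by auto
    have xs': "xs' = map (\<lambda>p. e (EGs (fst p) (snd p))) ?qs"
    proof (rule nth_equalityI)
      show "length xs' = length (map (\<lambda>p. e (EGs (fst p) (snd p))) ?qs)" using a(8) by simp
      fix l assume "l < length xs'"
      then have l: "l < n" using a(8) by simp
      then have "rel (std I) ActG [gs ! l, xs ! l, xs' ! l]" using a(9) by blast
      then show "xs' ! l = map (\<lambda>p. e (EGs (fst p) (snd p))) ?qs ! l"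
        unfolding rel_std_args p(1) h(1) using l len by auto
    qed
    have y': "y' = e (EHs v (c \<noteq> b))" using a(10) unfolding rel_std_args p(2) c by auto
    have "map fst ?qs = map fst ps" using len by (auto intro: nth_equalityI)
    then have comp: "compatible n (std I) (map (piG (std I)) xs' @ [piH (std I) y'])"
      using a(4) unfolding xs' y' p(1,2) Qr_std(2)[OF qs p(4)] Qr_std(2)[OF p(3) len(1) p(4)]
      by (simp only:)
    have "ev (std I) (gs ! l) (piH (std I) y) \<noteq> e (EH False) \<longleftrightarrow> v |\<in>| hs ! l" if l: "l < n" for l
    proof -
      have "gs ! l = e (EG (hs ! l))" using l len(2) unfolding h(1) by simp
      then show ?thesis unfolding p(2) piH_std[OF p(4)] using ev_std[OF mem(2)[OF l] p(4)] by simp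
    qed
    then have "{l. l < n \<and> ev (std I) (gs ! l) (piH (std I) y) \<noteq> e (EH False)} = {l. l < n \<and> v |\<in>| hs ! l}"
      by blast
    moreover have "length (filter (\<lambda>p. v |\<in>| snd p) ?qs) =
        card {l. l < n \<and> (v |\<in>| hs ! l) \<noteq> (v |\<in>| snd (ps ! l))}"
      unfolding length_filter_conv_card by (rule arg_cong[where f = card]) auto
    moreover have "length (filter (\<lambda>p. v |\<in>| snd p) ps) = card {l. l < n \<and> v |\<in>| snd (ps ! l)}"
      unfolding length_filter_conv_card len ..
    moreover have "rel (std I) Qr (xs @ [y]) \<longleftrightarrow> even (length (filter (\<lambda>p. v |\<in>| snd p) ps) + of_bool b)"
      using a(4) Qr_std(1)[OF p(3) len(1) p(4)] unfolding p(1,2) by blast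
    moreover have "rel (std I) Qr (xs' @ [y']) \<longleftrightarrow>
        even (length (filter (\<lambda>p. v |\<in>| snd p) ?qs) + of_bool (c \<noteq> b))"
      using comp Qr_std(1)[OF qs p(4)] unfolding xs' y' by blast
    ultimately show "(rel (std I) Qr (xs @ [y]) \<longleftrightarrow> rel (std I) Qr (xs' @ [y'])) \<longleftrightarrow>
       even (card {l. l < n \<and> ev (std I) (gs ! l) (piH (std I) y) \<noteq> e (EH False)} +
         (if m = e (EH False) then 0 else 1))"
      using even_card_xor[of n "\<lambda>l. v |\<in>| hs ! l" "\<lambda>l. v |\<in>| snd (ps ! l)"] c
      by (cases b; cases c; simp; blast)
  qed
qed (auto simp: rel_std_args srt_std ev_std piG_std piH_std sdiff_GG)

end

text \<open>Each point of \<open>D\<close> not yet sent into \<open>I\<close> is exchanged with a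
  fresh point of the infinite set \<open>I\<close>. The exchange respects \<open>E\<close>, since
  the displaced point lies outside \<open>I\<close> and the fresh one is chosen off
  \<open>E\<close>.\<close>

lemma permutation_moving_into:
  assumes I: "infinite I" "I \<subseteq> J" and E: "finite E" "E \<subseteq> I" and D: "finite D" "D \<subseteq> J"
  shows "\<exists>\<pi>. bij \<pi> \<and> \<pi> ` J = J \<and> (\<forall>x \<in> E. \<pi> x = x) \<and> \<pi> ` D \<subseteq> I"
  using D
proof (induction rule: finite_induct)
  case empty
  show ?case using bij_id by (intro exI[of _ id]) (auto simp: id_def)
next
  case (insert d D)
  then obtain \<pi> where \<pi>: "bij \<pi>" "\<pi> ` J = J" "\<forall>x \<in> E. \<pi> x = x" "\<pi> ` D \<subseteq> I" by auto
  show ?case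
  proof (cases "\<pi> d \<in> I")
    case True
    then show ?thesis using \<pi> by (intro exI[of _ \<pi>]) auto
  next
    case False
    have "infinite (I - (E \<union> \<pi> ` D))" using I E insert.hyps by simp
    then obtain y where y: "y \<in> I" "y \<notin> E" "y \<notin> \<pi> ` D" by (meson DiffE UnI1 UnI2 finite.emptyI finite_subset subsetI)
    let ?\<rho> = "transpose (\<pi> d) y \<circ> \<pi>"
    have dJ: "\<pi> d \<in> J" using \<pi> insert.prems by auto
    have inj: "inj \<pi>" using \<pi>(1) bij_is_inj by blast
    have "?\<rho> x = \<pi> x" if "x \<in> D" for x
    proof -
      have "\<pi> x \<noteq> \<pi> d" using that insert.hyps inj by (auto dest: injD)
      moreover have "\<pi> x \<noteq> y" using that y by auto
      ultimately show ?thesis by (simp add: transpose_def)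
    qed
    then have "?\<rho> ` insert d D \<subseteq> I" using \<pi>(4) y(1) by auto
    moreover have "?\<rho> x = x" if "x \<in> E" for x
      using that False y E \<pi>(3) by (auto simp: transpose_def)
    moreover have "bij ?\<rho>" using \<pi>(1) by (simp add: bij_comp)
    moreover have "?\<rho> ` J = J"
    proof -
      have "transpose (\<pi> d) y ` J = J" using permutes_swap_id[OF dJ] y I permutes_image by blast
      then show ?thesis unfolding image_comp[symmetric] \<pi>(2) .
    qed
    ultimately show ?thesis by blast
  qed
qed

section \<open>Renaming indices in symbolic elements\<close>

lemma finite_set_elt: "finite (set_elt t)"
  by (cases t) auto

lemma fcard_fimage: "inj \<pi> \<Longrightarrow> fcard (\<pi> |`| u) = fcard u"
  by (simp add: fcard.rep_eq card_image inj_on_subset[OF _ subset_UNIV])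

lemma well_sized_map: "inj \<pi> \<Longrightarrow> well_sized n (map_elt \<pi> t) \<longleftrightarrow> well_sized n t"
  by (cases t) (auto simp: fcard_fimage)

lemma fimage_sdiff: "inj f \<Longrightarrow> f |`| sdiff \<gamma> \<delta> = sdiff (f |`| \<gamma>) (f |`| \<delta>)"
  by (rule fset_eqI) (auto simp: sdiff_def dest: injD)

lemma inj_fimage: "inj \<pi> \<Longrightarrow> inj (fimage \<pi>)"
  by (rule fset.inj_map)

lemma full_simplex_map:
  assumes \<pi>: "inj \<pi>" and s: "full_simplex n us"
  shows "full_simplex n (map (fimage \<pi>) us)"
proof -
  obtain w where w: "distinct us" "finite w" "card w = Suc n" "fset ` set us = {A. A \<subseteq> w \<and> card A = n}"
    using s unfolding full_simplex_def by blast
  have fi: "inj_on \<pi> w" using \<pi> by (rule inj_on_subset) simp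
  have "distinct (map (fimage \<pi>) us)"
    using w(1) inj_fimage[OF \<pi>] by (simp add: distinct_map inj_on_subset[OF _ subset_UNIV])
  moreover have "fset ` set (map (fimage \<pi>) us) = image \<pi> ` (fset ` set us)"
    by (simp add: image_image)
  then have "fset ` set (map (fimage \<pi>) us) = {A. A \<subseteq> \<pi> ` w \<and> card A = n}"
    unfolding w(4) subsets_image[OF fi] .
  moreover have "finite (\<pi> ` w)" "card (\<pi> ` w) = Suc n" using w(2,3) card_image[OF fi] by simp_all
  ultimately show ?thesis unfolding full_simplex_def by blast
qed

text \<open>The relations on symbols mention indices only through equality, membership and
  cardinality, all of which survive an injective renaming.\<close>

lemma elt_rel_map:
  assumes \<pi>: "inj \<pi>" and r: "elt_rel n R ts"
  shows "elt_rel n R (map (map_elt \<pi>) ts)"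
proof -
  have mem: "fimage \<pi> v |\<in>| fimage (fimage \<pi>) \<gamma> \<longleftrightarrow> v |\<in>| \<gamma>" for v \<gamma>
    using inj_fimage[OF \<pi>] by (auto dest: injD)
  show ?thesis
  proof (cases R)
  case Qr
  obtain ps v b where ts: "ts = map (\<lambda>p. EGs (fst p) (snd p)) ps @ [EHs v b]" "length ps = n"
      "full_simplex n (map fst ps @ [v])" "even (length (filter (\<lambda>p. v |\<in>| snd p) ps) + of_bool b)"
    using r Qr by auto
  let ?qs = "map (\<lambda>p. (fimage \<pi> (fst p), fimage (fimage \<pi>) (snd p))) ps"
  have "map (map_elt \<pi>) ts = map (\<lambda>p. EGs (fst p) (snd p)) ?qs @ [EHs (fimage \<pi> v) b]"
    unfolding ts(1) by simp
  moreover have "map fst ?qs @ [fimage \<pi> v] = map (fimage \<pi>) (map fst ps @ [v])" by simp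
  then have "full_simplex n (map fst ?qs @ [fimage \<pi> v])" using full_simplex_map[OF \<pi> ts(3)] by (simp only:)
  moreover have "length (filter (\<lambda>p. fimage \<pi> v |\<in>| snd p) ?qs) = length (filter (\<lambda>p. v |\<in>| snd p) ps)"
    unfolding filter_map length_map comp_def snd_conv mem ..
  ultimately show ?thesis
    unfolding Qr elt_rel.simps using ts(2,4)
    by (intro exI[of _ ?qs] exI[of _ "fimage \<pi> v"] exI[of _ b] conjI) (simp_all only: length_map)
next
  case Mem
  then show ?thesis using r \<pi> by auto
next
  case Eval
  then obtain \<gamma> u where "ts = [EG \<gamma>, EK u, EH (u |\<in>| \<gamma>)]" using r by auto
  then have "map (map_elt \<pi>) ts = [EG (fimage (fimage \<pi>) \<gamma>), EK (fimage \<pi> u),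
      EH (fimage \<pi> u |\<in>| fimage (fimage \<pi>) \<gamma>)]"
    by (simp only: list.map elt.map mem)
  then show ?thesis using Eval by simp
next
  case Supp
  then obtain \<gamma> u where "ts = [EG \<gamma>, EK u]" "u |\<in>| \<gamma>" using r by auto
  then have "map (map_elt \<pi>) ts = [EG (fimage (fimage \<pi>) \<gamma>), EK (fimage \<pi> u)]"
      "fimage \<pi> u |\<in>| fimage (fimage \<pi>) \<gamma>"
    by (simp_all only: list.map elt.map mem)
  then show ?thesis using Supp by (simp only: elt_rel.simps) blast
qed (use r in \<open>auto simp: fimage_sdiff[OF inj_fimage[OF \<pi>]]\<close>)
qed

lemma map_elt_inv: "bij \<pi> \<Longrightarrow> map_elt \<pi> (map_elt (inv \<pi>) t) = t" "bij \<pi> \<Longrightarrow> map_elt (inv \<pi>) (map_elt \<pi> t) = t"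
  by (simp_all add: elt.map_comp comp_def bij_is_surj surj_f_inv_f bij_is_inj inv_f_f elt.map_ident)

lemma elt_rel_map_iff:
  fixes \<pi> :: "'a \<Rightarrow> 'a"
  assumes "bij \<pi>"
  shows "elt_rel n R (map (map_elt \<pi>) ts) \<longleftrightarrow> elt_rel n R ts"
proof
  assume "elt_rel n R (map (map_elt \<pi>) ts)"
  then have "elt_rel n R (map (map_elt (inv \<pi>)) (map (map_elt \<pi>) ts))"
    by (rule elt_rel_map[rotated]) (use assms bij_imp_bij_inv bij_is_inj in blast)
  moreover have "map (map_elt (inv \<pi>)) (map (map_elt \<pi>) ts) = ts"
    by (simp add: map_elt_inv[OF assms] comp_def)
  ultimately show "elt_rel n R ts" by (simp only:)
qed (use assms elt_rel_map bij_is_inj in blast)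

context coding
begin

text \<open>The renaming transported along the coding. Its values are meaningful on codes only, and
  the carriers of standard models consist of codes.\<close>

definition lift :: "('a \<Rightarrow> 'a) \<Rightarrow> 'a \<Rightarrow> 'a" where
  "lift \<pi> x = e (map_elt \<pi> (inv e x))"

lemma lift_e [simp]: "lift \<pi> (e t) = e (map_elt \<pi> t)"
  by (simp add: lift_def inj)

lemma map_elts: "bij \<pi> \<Longrightarrow> \<pi> ` I \<subseteq> J \<Longrightarrow> t \<in> elts n I \<Longrightarrow> map_elt \<pi> t \<in> elts n J"
  by (auto simp: elts_def well_sized_map bij_is_inj elt.set_map)

lemma elts_mono: "I \<subseteq> J \<Longrightarrow> elts n I \<subseteq> elts n J"
  by (auto simp: elts_def)

lemma inj_lift: "bij \<pi> \<Longrightarrow> inj_on (lift \<pi>) (e ` elts n I)"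
  by (rule inj_onI) (auto, metis map_elt_inv(2))

lemma rel_lift:
  assumes "bij \<pi>" "\<pi> ` I \<subseteq> J" "set xs \<subseteq> carrier (std I)"
  shows "rel (std I) R xs \<longleftrightarrow> rel (std J) R (map (lift \<pi>) xs)"
proof -
  obtain ts where ts: "xs = map e ts" "set ts \<subseteq> elts n I"
    using list_in_image assms(3) unfolding carrier_std by blast
  have "map (lift \<pi>) xs = map e (map (map_elt \<pi>) ts)" using ts by simp
  moreover have "set (map (map_elt \<pi>) ts) \<subseteq> elts n J" using ts(2) map_elts[OF assms(1,2)] by auto
  ultimately show ?thesis
    using ts rel_std_map elt_rel_map_iff[OF assms(1)] by (simp only:)
qed

lemma lift_bij:
  assumes "bij \<pi>" "\<pi> ` I = I"
  shows "bij_betw (lift \<pi>) (carrier (std I)) (carrier (std I))"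
  unfolding bij_betw_def carrier_std
proof (intro conjI inj_lift[OF assms(1)] equalityI subsetI)
  fix x assume "x \<in> lift \<pi> ` e ` elts n I"
  then show "x \<in> e ` elts n I" using map_elts[OF assms(1), of I I] assms(2) by auto
next
  fix x assume "x \<in> e ` elts n I"
  then obtain t where t: "t \<in> elts n I" "x = e t" by blast
  have "inv \<pi> ` I = I" using assms by (metis bij_is_inj image_inv_f_f)
  then have "map_elt (inv \<pi>) t \<in> elts n I"
    using t map_elts[of "inv \<pi>" I I] assms(1) bij_imp_bij_inv by blast
  moreover have "lift \<pi> (e (map_elt (inv \<pi>) t)) = x" using t assms by (simp add: map_elt_inv)
  ultimately show "x \<in> lift \<pi> ` e ` elts n I" by (metis imageI)
qed

text \<open>The back-and-forth system consists of the permutations of \<open>J\<close>, each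
  restricted to the whole carrier of \<open>std I\<close>. So the forward step has nothing to
  extend; the backward step re-chooses the permutation, using that every element depends on finitely
  many indices and that these can be moved into \<open>I\<close>.\<close>

lemma std_elem_sub:
  assumes I: "infinite I" "I \<subseteq> J"
  shows "elem_sub (std I) (std J)"
  unfolding elem_sub_def
proof (intro conjI allI impI)
  show sub: "carrier (std I) \<subseteq> carrier (std J)"
    using elts_mono[OF I(2)] by (auto simp: carrier_std)
  fix \<phi> :: "hsym fm" and s :: "nat \<Rightarrow> 'a"
  assume \<phi>: "Lfm \<phi>" and s: "range s \<subseteq> carrier (std I)"
  let ?F = "{(X, h). X = carrier (std I) \<and> (\<exists>\<pi>. bij \<pi> \<and> \<pi> ` J = J \<and> h = lift \<pi>)}"
  have FE: thesis if "(X, h) \<in> ?F"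
    and "\<And>\<pi>. bij \<pi> \<Longrightarrow> \<pi> ` J = J \<Longrightarrow> X = carrier (std I) \<Longrightarrow> h = lift \<pi> \<Longrightarrow> thesis" for X h thesis
  proof -
    have X: "X = carrier (std I)" and "\<exists>\<pi>. bij \<pi> \<and> \<pi> ` J = J \<and> h = lift \<pi>" using that(1) by simp_all
    then obtain \<pi> where "bij \<pi> \<and> \<pi> ` J = J \<and> h = lift \<pi>" by (elim exE)
    then show thesis using that(2)[of \<pi>] X by simp
  qed
  have sub': "\<pi> ` I \<subseteq> J" if "\<pi> ` J = J" for \<pi> using that I(2) by blast
  have "sat (std I) \<phi> s \<longleftrightarrow> sat (std J) \<phi> (lift id \<circ> s)"
  proof (rule back_and_forth[where F = ?F and X = "carrier (std I)"])
    show "inj_on h X \<and> (\<forall>R xs. set xs \<subseteq> X \<longrightarrow> (rel (std I) R xs \<longleftrightarrow> rel (std J) R (map h xs)))"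
      if Xh: "(X, h) \<in> ?F" for X h
    proof -
      obtain \<pi> where \<pi>: "bij \<pi>" "\<pi> ` J = J" "X = carrier (std I)" "h = lift \<pi>" by (rule FE[OF Xh])
      show ?thesis
        unfolding \<pi>(3,4)
      proof (intro conjI allI impI)
        show "inj_on (lift \<pi>) (carrier (std I))" unfolding carrier_std by (rule inj_lift[OF \<pi>(1)])
      qed (rule rel_lift[OF \<pi>(1) sub'[OF \<pi>(2)]])
    qed
    show "\<exists>X' h'. (X', h') \<in> ?F \<and> insert a Y \<subseteq> X' \<and> (\<forall>y \<in> Y. h' y = h y) \<and> h' a \<in> carrier (std J)"
      if Xh: "(X, h) \<in> ?F" and Y: "Y \<subseteq> X" and a: "a \<in> carrier (std I)" for X h Y a
    proof (intro exI conjI)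
      show "(X, h) \<in> ?F" by (rule Xh)
      obtain \<pi> where \<pi>: "bij \<pi>" "\<pi> ` J = J" "X = carrier (std I)" "h = lift \<pi>" by (rule FE[OF Xh])
      obtain t where t: "a = e t" "t \<in> elts n I" using a unfolding carrier_std by blast
      show "h a \<in> carrier (std J)"
        using map_elts[OF \<pi>(1) sub'[OF \<pi>(2)] t(2)] unfolding \<pi>(4) t(1) carrier_std by simp
      show "insert a Y \<subseteq> X" using Y a \<pi>(3) by blast
    qed simp
    show "\<exists>X' h' a. (X', h') \<in> ?F \<and> insert a Y \<subseteq> X' \<and> (\<forall>y \<in> Y. h' y = h y) \<and>
        a \<in> carrier (std I) \<and> h' a = b"
      if F: "(X, h) \<in> ?F" and Y: "finite Y" "Y \<subseteq> X" and b: "b \<in> carrier (std J)" for X h Y b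
    proof -
      obtain \<pi> where \<pi>: "bij \<pi>" "\<pi> ` J = J" "X = carrier (std I)" "h = lift \<pi>" by (rule FE[OF F])
      obtain t where t: "b = e t" "t \<in> elts n J" using b by (auto simp: carrier_std)
      \<comment> \<open>The indices on which the finitely many elements to be respected
        depend.\<close>
      let ?E = "\<Union>y \<in> Y. set_elt (inv e y)"
      have "set_elt (inv e y) \<subseteq> I" if "y \<in> Y" for y
      proof -
        have "y \<in> e ` elts n I" using that Y(2) \<pi>(3) carrier_std by blast
        then obtain t' where "y = e t'" "t' \<in> elts n I" by blast
        then show ?thesis by (simp add: inv_f_f[OF inj] elts_def)
      qed
      then have E: "finite ?E" "?E \<subseteq> I" using Y(1) finite_set_elt by auto
      have inv: "inv \<pi> ` J = J" using \<pi> by (metis bij_is_inj image_inv_f_f)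
      have "inv \<pi> ` set_elt t \<subseteq> J" using t(2) inv unfolding elts_def by blast
      then have "\<exists>\<rho>. bij \<rho> \<and> \<rho> ` J = J \<and> (\<forall>x \<in> ?E. \<rho> x = x) \<and> \<rho> ` inv \<pi> ` set_elt t \<subseteq> I"
        by (rule permutation_moving_into[OF I E finite_imageI[OF finite_set_elt]])
      then obtain \<rho> where \<rho>: "bij \<rho>" "\<rho> ` J = J" "\<forall>x \<in> ?E. \<rho> x = x" "\<rho> ` inv \<pi> ` set_elt t \<subseteq> I"
        by (elim exE conjE)
      \<comment> \<open>Since \<rho> fixes \<open>?E\<close>, the new permutation acts on
        \<open>Y\<close> as \<pi> does. Since \<rho> carries the indices of the \<pi>-preimage of
        \<open>b\<close> into \<open>I\<close>, the preimage of \<open>b\<close> under the new map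
        lies in \<open>std I\<close>.\<close>
      let ?\<pi>' = "\<pi> \<circ> inv \<rho>" and ?t = "map_elt \<rho> (map_elt (inv \<pi>) t)"
      have "inv \<rho> ` J = J" using \<rho> by (metis bij_is_inj image_inv_f_f)
      then have "?\<pi>' ` J = J" unfolding image_comp[symmetric] by (simp only: \<pi>(2))
      moreover have "bij ?\<pi>'" using \<pi>(1) \<rho>(1) by (simp add: bij_comp bij_imp_bij_inv)
      ultimately have \<pi>': "bij ?\<pi>'" "?\<pi>' ` J = J" by blast+
      have "?t \<in> elts n I"
        using t(2) \<rho>(1,4) \<pi>(1) by (auto simp: elts_def elt.set_map well_sized_map bij_is_inj bij_imp_bij_inv)
      moreover have "map_elt ?\<pi>' ?t = t"
        using \<rho>(1) \<pi>(1) by (simp add: elt.map_comp[symmetric] map_elt_inv)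
      moreover have "lift ?\<pi>' y = h y" if y: "y \<in> Y" for y
      proof -
        have "map_elt ?\<pi>' (inv e y) = map_elt \<pi> (inv e y)"
        proof (rule elt.map_cong0)
          fix x assume "x \<in> set_elt (inv e y)"
          then have "\<rho> x = x" using \<rho>(3) y by blast
          then have "inv \<rho> x = x" using \<rho>(1) by (metis bij_is_inj inv_f_f)
          then show "?\<pi>' x = \<pi> x" by simp
        qed
        then show ?thesis unfolding \<pi>(4) lift_def by simp
      qed
      moreover have "(carrier (std I), lift ?\<pi>') \<in> ?F" using \<pi>' by blast
      ultimately show ?thesis
        using Y(2) unfolding \<pi>(3) t(1)
        by (intro exI[of _ "carrier (std I)"] exI[of _ "lift ?\<pi>'"] exI[of _ "e ?t"])
          (simp add: carrier_std)
    qed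
    have "bij (id :: 'a \<Rightarrow> 'a) \<and> id ` J = J \<and> lift id = lift id" by (simp only: bij_id image_id id_apply simp_thms)
    then show "(carrier (std I), lift id) \<in> ?F" by blast
  qed (use \<phi> s in \<open>auto simp: Lfm_def\<close>)
  also have "lift id \<circ> s = s"
  proof
    fix i
    have "s i \<in> e ` elts n I" using s unfolding carrier_std by blast
    then obtain t where "s i = e t" by blast
    then show "(lift id \<circ> s) i = s i" by (simp add: elt.map_id)
  qed
  finally show "sat (std I) \<phi> s \<longleftrightarrow> sat (std J) \<phi> s" .
qed

end

section \<open>The size of standard models and the existence of a coding\<close>

lemma card_of_elts:
  assumes I: "infinite (I :: 'a set)"
  shows "|{t. set_elt t \<subseteq> I}| \<le>o |I|"
proof -
  let ?P = "{u. fset u \<subseteq> I}" and ?PP = "{\<gamma>. \<forall>u \<in> fset \<gamma>. fset u \<subseteq> I}"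
  have fs: "|{u. fset u \<subseteq> B}| \<le>o |B|" if "infinite B" for B :: "'b set"
  proof -
    have "{u. fset u \<subseteq> B} = Abs_fset ` {s. finite s \<and> s \<subseteq> B}" (is "?L = ?R")
    proof (intro equalityI subsetI)
      fix u assume "u \<in> ?L"
      then show "u \<in> ?R" by (intro image_eqI[of _ _ "fset u"]) (auto simp: fset_inverse)
    qed (auto simp: Abs_fset_inverse)
    also have "|\<dots>| \<le>o |{s. finite s \<and> s \<subseteq> B}|" by (rule card_of_image)
    also have "|{s. finite s \<and> s \<subseteq> B}| \<le>o |B|" by (rule card_of_finite_subsets[OF that])
    finally show ?thesis .
  qed
  have P: "|?P| \<le>o |I|" by (rule fs[OF I])
  have "infinite ?P"
  proof
    assume "finite ?P"
    moreover have "(\<lambda>i. {|i|}) ` I \<subseteq> ?P" by auto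
    ultimately have "finite ((\<lambda>i. {|i|}) ` I)" using finite_subset by blast
    then show False using I by (auto dest!: finite_imageD simp: inj_on_def)
  qed
  then have "|{\<gamma>. fset \<gamma> \<subseteq> ?P}| \<le>o |?P|" by (rule fs)
  then have "|{\<gamma>. fset \<gamma> \<subseteq> ?P}| \<le>o |I|" using P by (rule ordLeq_transitive)
  moreover have "{\<gamma>. fset \<gamma> \<subseteq> ?P} = ?PP" by auto
  ultimately have PP: "|?PP| \<le>o |I|" by simp
  have B: "|UNIV :: bool set| \<le>o |I|"
    by (rule ordLess_imp_ordLeq, rule finite_ordLess_infinite[OF card_of_Well_order card_of_Well_order])
      (use I in \<open>simp_all add: Field_card_of\<close>)
  have times: "|A \<times> B'| \<le>o |I|" if "|A| \<le>o |I|" "|B'| \<le>o |I|" for A :: "'b set" and B' :: "'c set"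
    using card_of_Sigma_ordLeq_infinite[OF I that(1), of "\<lambda>_. B'"] that(2) by blast
  have im: "|f ` A| \<le>o |I|" if "|A| \<le>o |I|" for f :: "'b \<Rightarrow> 'c" and A
    using card_of_image that ordLeq_transitive by blast
  have un: "|A \<union> B'| \<le>o |I|" if "|A| \<le>o |I|" "|B'| \<le>o |I|" for A B' :: "'b set"
    by (intro card_of_Un_ordLeq_infinite_Field[OF _ that card_of_Card_order])
      (use I in \<open>simp add: Field_card_of\<close>)
  have "{t. set_elt t \<subseteq> I} \<subseteq> EI ` I \<union> (EK ` ?P \<union> (range EH \<union> (EG ` ?PP \<union>
      ((\<lambda>(u, \<gamma>). EGs u \<gamma>) ` (?P \<times> ?PP) \<union> (\<lambda>(u, b). EHs u b) ` (?P \<times> UNIV)))))" (is "_ \<subseteq> ?U")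
  proof
    fix t assume "t \<in> {t. set_elt t \<subseteq> I}"
    then show "t \<in> ?U" by (cases t) (auto simp: image_iff)
  qed
  then have "|{t. set_elt t \<subseteq> I}| \<le>o |?U|" by (rule card_of_mono1)
  also have "|?U| \<le>o |I|"
    by (intro un im times P PP B card_of_mono1[OF subset_refl])
  finally show ?thesis .
qed

text \<open>A symbolic element is finite data over \<open>'a\<close>, so over an infinite type there
  are no more symbols than points.\<close>

lemma inj_elt_exists:
  assumes "infinite (UNIV :: 'a set)"
  shows "\<exists>e :: 'a elt \<Rightarrow> 'a. inj e"
  using card_of_elts[OF assms] card_of_ordLeq[of "UNIV :: 'a elt set" "UNIV :: 'a set"] by auto

context coding
begin

lemma Klam_std:
  assumes "isAleph k I"
  shows "Klam n k (std I)"
proof -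
  have I: "infinite I" using assms isAleph_infinite by blast
  have "|carrier (std I)| \<le>o |elts n I|" unfolding carrier_std by (rule card_of_image)
  also have "|elts n I| \<le>o |{t. set_elt t \<subseteq> I}|" by (rule card_of_mono1) (auto simp: elts_def)
  also have "|{t. set_elt t \<subseteq> I}| \<le>o |I|" by (rule card_of_elts[OF I])
  finally have "|carrier (std I)| \<le>o |I|" .
  moreover have "|I| \<le>o |carrier (std I)|"
    by (rule card_of_ordLeqI[of "\<lambda>i. e (EI i)"]) (auto simp: inj_on_def carrier_std)
  ultimately have "|I| =o |carrier (std I)|" using ordIso_iff_ordLeq by blast
  then show ?thesis
    unfolding Klam_def hs_model_iff using hs_std isAleph_cong[OF assms] by blast
qed

end

section \<open>Inequivalent amalgams\<close>

context
  fixes n :: nat and A P :: "'a hstr" and f :: "'a \<Rightarrow> 'a" and zA oA zP oP :: 'a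
  assumes A: "hs n A zA oA" and P: "hs n P zP oP" and f: "embedding f A P"
begin

interpretation A: hs n A zA oA by (rule A)
interpretation P: hs n P zP oP by (rule P)

lemma embedding_srt: "x \<in> carrier A \<Longrightarrow> f x \<in> srt P S \<longleftrightarrow> x \<in> srt A S"
  using f unfolding embedding_def srt_def by (auto dest!: spec[of _ S] spec[of _ "[x]"])

lemma embedding_srtI: "x \<in> srt A S \<Longrightarrow> f x \<in> srt P S"
  using embedding_srt A.srt_carrier by blast

lemma embedding_rel: "set xs \<subseteq> carrier A \<Longrightarrow> rel P R (map f xs) \<longleftrightarrow> rel A R xs"
  using f unfolding embedding_def by blast

text \<open>Preservation of membership gives only one inclusion. Equality follows because both sides
  have n elements, so an index gains no members in the larger model.\<close>

lemma embedding_memset: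
  assumes u: "u \<in> srt A SK"
  shows "memset P (f u) = f ` memset A u"
proof -
  have sub: "f ` memset A u \<subseteq> memset P (f u)"
  proof
    fix y assume "y \<in> f ` memset A u"
    then obtain i where i: "y = f i" "rel A Mem [i, u]" unfolding memset_def by blast
    then have "rel P Mem (map f [i, u])" using A.rel_carrier embedding_rel[of "[i, u]"] by auto
    then show "y \<in> memset P (f u)" using i unfolding memset_def by simp
  qed
  have fu: "f u \<in> srt P SK" using u embedding_srtI by blast
  have "memset A u \<subseteq> carrier A" using A.memset_sub[OF u] A.srt_carrier by blast
  then have "inj_on f (memset A u)" using f inj_on_subset unfolding embedding_def by blast
  then have "card (f ` memset A u) = n" using A.memset_card[OF u] by (simp add: card_image)
  then show ?thesis
    using card_subset_eq[OF P.memset_finite[OF fu] sub] P.memset_card[OF fu] by simp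
qed

lemma embedding_piG: "x \<in> srt A SGs \<Longrightarrow> piG P (f x) = f (piG A x)"
  using A.PiG_piG[of x] A.rel_carrier embedding_rel[of "[x, piG A x]"] P.piG_eq by auto

lemma embedding_piH: "x \<in> srt A SHs \<Longrightarrow> piH P (f x) = f (piH A x)"
  using A.PiH_piH[of x] A.rel_carrier embedding_rel[of "[x, piH A x]"] P.piH_eq by auto

text \<open>Elements of the image live over sets of indices from the image. A twist that is trivial
  over those sets therefore cannot be detected with parameters from the image.\<close>

lemma embedding_stalk:
  assumes x: "x \<in> carrier A"
  shows "P.stalk (f x) \<subseteq> f ` srt A SI"
proof -
  consider "x \<in> srt A SGs" | "x \<notin> srt A SGs" "x \<in> srt A SHs" | "x \<notin> srt A SGs" "x \<notin> srt A SHs"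
    by blast
  then show ?thesis
  proof cases
    case 1
    then have "P.stalk (f x) = f ` memset A (piG A x)"
      using embedding_srt[OF x] embedding_piG embedding_memset A.piG_K by (simp add: P.stalk_def)
    then show ?thesis using A.memset_sub[OF A.piG_K[OF 1]] by auto
  next
    case 2
    then have "P.stalk (f x) = f ` memset A (piH A x)"
      using embedding_srt[OF x] embedding_piH embedding_memset A.piH_K by (simp add: P.stalk_def)
    then show ?thesis using A.memset_sub[OF A.piH_K[OF 2(2)]] by auto
  next
    case 3
    then show ?thesis using embedding_srt[OF x] by (simp add: P.stalk_def)
  qed
qed

text \<open>Supplies base points inside the image of N or of M1, where any equivalence of amalgams
  has to agree.\<close>

lemma embedding_Gs_exists:
  assumes B: "B \<subseteq> f ` srt A SI" "finite B" "card B = n"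
  shows "\<exists>x \<in> srt A SGs. memset P (piG P (f x)) = B"
proof -
  obtain B' where B': "B' \<subseteq> srt A SI" "B = f ` B'" using B(1) by (rule subset_imageE)
  have inj: "inj_on f B'" using f B'(1) A.srt_carrier unfolding embedding_def by (meson inj_on_subset subset_iff)
  have "finite B'" "card B' = n"
    using B(2,3) card_image[OF inj] finite_image_iff[OF inj] unfolding B'(2) by simp_all
  then obtain u where u: "u \<in> srt A SK" "memset A u = B'" using A.memset_obtain B'(1) by blast
  obtain x where x: "x \<in> srt A SGs" "piG A x = u" using A.PiG_onto u(1) by blast
  have "memset P (piG P (f x)) = B" using embedding_piG[OF x(1)] embedding_memset[OF u(1)] x u B'(2) by simp
  then show ?thesis using x(1) by blast
qed

lemma sat_twist_range:
  assumes n: "2 \<le> n" and c: "\<And>w v. w \<subseteq> f ` srt A SI \<Longrightarrow> \<not> c w v"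
    and \<phi>: "finite (fv \<phi>)" and s: "range s \<subseteq> f ` carrier A"
  shows "sat P \<phi> s \<longleftrightarrow> sat (twist n c P) \<phi> s"
proof (rule P.sat_twist[OF n \<phi>])
  have "f ` carrier A \<subseteq> carrier P" using f unfolding embedding_def by blast
  then show "s ` fv \<phi> \<subseteq> carrier P" using s by blast
  show "P.stalk (s i) \<subseteq> f ` srt A SI" for i
  proof -
    obtain x where "x \<in> carrier A" "s i = f x" using s by blast
    then show ?thesis using embedding_stalk by simp
  qed
qed (rule c)

end

lemma (in hs) compatibleI:
  assumes w: "w \<subseteq> srt M SI" "finite w" "card w = Suc n"
    and us: "distinct (map (memset M) us)" "set (map (memset M) us) = {A. A \<subseteq> w \<and> card A = n}"
  shows "compatible n M us"
proof -
  have "distinct us" using us(1) by (simp add: distinct_map)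
  moreover have "memset M ` set us = {A. A \<subseteq> w \<and> card A = n}" using us(2) by simp
  ultimately show ?thesis unfolding compatible_def using w by blast
qed

text \<open>Regularity makes the action free: the zero of G also fixes \<open>x\<close>, so
  \<open>g\<close> is that zero.\<close>

lemma (in hs) act_trivial:
  assumes x: "x \<in> srt M SGs" and g: "rel M ActG [g, x, x]" and u: "u \<in> srt M SK"
  shows "ev M g u = z"
proof -
  obtain g0 where g0: "g0 \<in> srt M SG" "\<forall>u \<in> srt M SK. ev M g0 u \<noteq> z \<longleftrightarrow> memset M u \<in> {}"
    using G_of_support[of "{}"] by blast
  then have "rel M ActG [g0, x, x]" using ActG_zero x by blast
  moreover have "g \<in> srt M SG" using g ActG_sorts by blast
  ultimately have "g = g0" using ActG_regular x g g0(1) by blast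
  then show ?thesis using g0(2) u by blast
qed

text \<open>The choice of base points matters. A set \<open>A\<close> that does not contain both p
  and q lies in the index image of N or of M1, so \<open>x A\<close> can be taken in that image,
  where \<open>ga\<close> and \<open>gb\<close> agree; the translation from \<open>ga (x A)\<close>
  to \<open>gb (x A)\<close> is then zero. The base points of H* are not controlled, and their
  displacement is the term \<open>par\<close> of the parity argument.\<close>

lemma twist_not_equivalent:
  fixes N M1 P S :: "'a hstr" and f1 f2 ga gb :: "'a \<Rightarrow> 'a" and p q i0 i1 :: 'a
  defines "c \<equiv> \<lambda>w v. p \<in> w \<and> q \<in> w \<and> i1 \<in> w \<and> v = w - {i1}"
  assumes n: "3 \<le> n"
    and N: "hs n N zN oN" and M1: "hs n M1 zM oM" and P: "hs n P zP oP" and S: "hs n S z one"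
    and f1: "embedding f1 N P" and f2: "embedding f2 M1 P"
    and ga: "embedding ga P S" and gb: "embedding gb (twist n c P) S"
    and agree1: "\<And>x. x \<in> carrier N \<Longrightarrow> ga (f1 x) = gb (f1 x)"
    and agree2: "\<And>x. x \<in> carrier M1 \<Longrightarrow> ga (f2 x) = gb (f2 x)"
    and X1: "insert p X \<subseteq> f1 ` srt N SI" and X2: "insert q X \<subseteq> f2 ` srt M1 SI"
    and pq: "p \<notin> X" "q \<notin> X" "p \<noteq> q"
    and i: "i0 \<in> X" "i1 \<in> X" "i0 \<noteq> i1" and X: "isAleph (n - 3) (X - {i0, i1})"
  shows False
proof -
  interpret N: hs n N zN oN by (rule N)
  interpret M1: hs n M1 zM oM by (rule M1)
  interpret P: hs n P zP oP by (rule P)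
  interpret S: hs n S z one by (rule S)
  let ?T = "twist n c P"
  have T: "hs n ?T zP oP" by (rule P.twist_hs)
  interpret T: hs n ?T zP oP by (rule T)
  let ?Y = "insert p (insert q X)"
  let ?sub = "\<lambda>A. A \<subseteq> ?Y \<and> finite A \<and> card A = n"
  have Y: "?Y \<subseteq> srt P SI"
  proof -
    have "f1 ` srt N SI \<subseteq> srt P SI" "f2 ` srt M1 SI \<subseteq> srt P SI"
      using embedding_srtI[OF N P f1] embedding_srtI[OF M1 P f2] by auto
    then have "insert p X \<subseteq> srt P SI" "insert q X \<subseteq> srt P SI"
      using X1 X2 by (simp_all only: subset_trans)
    then show ?thesis by simp
  qed
  have gY: "ga y = gb y" if "y \<in> ?Y" for y
  proof -
    have "y \<in> insert p X \<or> y \<in> insert q X" using that by auto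
    then have "y \<in> f1 ` srt N SI \<or> y \<in> f2 ` srt M1 SI" using subsetD[OF X1] subsetD[OF X2] by metis
    then show ?thesis using agree1[OF N.srt_carrier] agree2[OF M1.srt_carrier] by auto
  qed
  have inj: "inj_on ga ?Y"
  proof (rule inj_on_subset)
    show "inj_on ga (carrier P)" using ga unfolding embedding_def by (elim conjE)
    show "?Y \<subseteq> carrier P" using Y by (rule subset_trans) (auto simp: P.srt_carrier)
  qed
  have "\<exists>x \<in> srt P SGs. memset P (piG P x) = A \<and> (\<not> {p, q} \<subseteq> A \<longrightarrow> ga x = gb x)" if A: "?sub A" for A
  proof -
    consider "A \<subseteq> insert p X" | "A \<subseteq> insert q X" | "{p, q} \<subseteq> A" using A by blast
    then show ?thesis
    proof cases
      case 1
      then have "A \<subseteq> f1 ` srt N SI" using X1 by (rule subset_trans)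
      then obtain x where x: "x \<in> srt N SGs" "memset P (piG P (f1 x)) = A"
        using embedding_Gs_exists[OF N P f1, of A] A by metis
      then show ?thesis
        using embedding_srtI[OF N P f1] agree1 N.srt_carrier by (intro bexI[of _ "f1 x"]) auto
    next
      case 2
      then have "A \<subseteq> f2 ` srt M1 SI" using X2 by (rule subset_trans)
      then obtain x where x: "x \<in> srt M1 SGs" "memset P (piG P (f2 x)) = A"
        using embedding_Gs_exists[OF M1 P f2, of A] A by metis
      then show ?thesis
        using embedding_srtI[OF M1 P f2] agree2 M1.srt_carrier by (intro bexI[of _ "f2 x"]) auto
    next
      case 3
      have "A \<subseteq> srt P SI" using A Y by (metis subset_trans)
      then obtain u where u: "u \<in> srt P SK" "memset P u = A" using P.memset_obtain A by blast
      then obtain x where "x \<in> srt P SGs" "piG P x = u" using P.PiG_onto by blast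
      then show ?thesis using u 3 by blast
    qed
  qed
  then have "\<forall>A. \<exists>x. ?sub A \<longrightarrow> x \<in> srt P SGs \<and> memset P (piG P x) = A \<and> (\<not> {p, q} \<subseteq> A \<longrightarrow> ga x = gb x)"
    by blast
  then obtain x where x0: "\<forall>A. ?sub A \<longrightarrow> x A \<in> srt P SGs \<and> memset P (piG P (x A)) = A \<and>
      (\<not> {p, q} \<subseteq> A \<longrightarrow> ga (x A) = gb (x A))"
    unfolding choice_iff by (elim exE)
  have x: "x A \<in> srt P SGs" "memset P (piG P (x A)) = A" "\<not> {p, q} \<subseteq> A \<Longrightarrow> ga (x A) = gb (x A)"
    if "?sub A" for A using x0 that by blast+
  have "\<exists>y \<in> srt P SHs. memset P (piH P y) = A" if A: "?sub A" for A
  proof -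
    have "A \<subseteq> srt P SI" using A Y by (metis subset_trans)
    then obtain u where u: "u \<in> srt P SK" "memset P u = A" using P.memset_obtain A by blast
    then obtain y where "y \<in> srt P SHs" "piH P y = u" using P.PiH_onto by blast
    then show ?thesis using u by blast
  qed
  then have "\<forall>A. \<exists>y. ?sub A \<longrightarrow> y \<in> srt P SHs \<and> memset P (piH P y) = A" by blast
  then obtain y where y0: "\<forall>A. ?sub A \<longrightarrow> y A \<in> srt P SHs \<and> memset P (piH P (y A)) = A"
    unfolding choice_iff by (elim exE)
  have y: "y A \<in> srt P SHs" "memset P (piH P (y A)) = A" if "?sub A" for A using y0 that by blast+
  have gimg: "ga ` A = gb ` A" if "A \<subseteq> ?Y" for A
    using gY that by (intro image_cong) auto
  have gx: "ga (x A) \<in> srt S SGs" "gb (x A) \<in> srt S SGs" "memset S (piG S (ga (x A))) = ga ` A"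
      "piG S (gb (x A)) = piG S (ga (x A))" if A: "?sub A" for A
  proof -
    note xA = x(1,2)[OF A]
    show a: "ga (x A) \<in> srt S SGs" by (rule embedding_srtI[OF P S ga xA(1)])
    have xT: "x A \<in> srt ?T SGs" using xA(1) by simp
    show b: "gb (x A) \<in> srt S SGs" by (rule embedding_srtI[OF T S gb xT])
    have 1: "memset S (piG S (ga (x A))) = ga ` A"
      using embedding_piG[OF P S ga xA(1)] embedding_memset[OF P S ga P.piG_K[OF xA(1)]] xA(2) by simp
    then show "memset S (piG S (ga (x A))) = ga ` A" .
    have "memset S (piG S (gb (x A))) = gb ` A"
      using embedding_piG[OF T S gb xT] embedding_memset[OF T S gb T.piG_K[OF xT]] xA(2) by simp
    then have "memset S (piG S (gb (x A))) = memset S (piG S (ga (x A)))" using 1 gimg A by simp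
    then show "piG S (gb (x A)) = piG S (ga (x A))"
      using S.memset_inj S.piG_K a b by (meson inj_onD)
  qed
  have gy: "ga (y A) \<in> srt S SHs" "gb (y A) \<in> srt S SHs" "memset S (piH S (ga (y A))) = ga ` A"
      "piH S (gb (y A)) = piH S (ga (y A))" if A: "?sub A" for A
  proof -
    note yA = y(1,2)[OF A]
    show a: "ga (y A) \<in> srt S SHs" by (rule embedding_srtI[OF P S ga yA(1)])
    have yT: "y A \<in> srt ?T SHs" using yA(1) by simp
    show b: "gb (y A) \<in> srt S SHs" by (rule embedding_srtI[OF T S gb yT])
    have 1: "memset S (piH S (ga (y A))) = ga ` A"
      using embedding_piH[OF P S ga yA(1)] embedding_memset[OF P S ga P.piH_K[OF yA(1)]] yA(2) by simp
    then show "memset S (piH S (ga (y A))) = ga ` A" .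
    have "memset S (piH S (gb (y A))) = gb ` A"
      using embedding_piH[OF T S gb yT] embedding_memset[OF T S gb T.piH_K[OF yT]] yA(2) by simp
    then have "memset S (piH S (gb (y A))) = memset S (piH S (ga (y A)))" using 1 gimg A by simp
    then show "piH S (gb (y A)) = piH S (ga (y A))"
      using S.memset_inj S.piH_K a b by (meson inj_onD)
  qed
  have "\<exists>g. g \<in> srt S SG \<and> rel S ActG [g, ga (x A), gb (x A)]" if "?sub A" for A
    using S.ActG_regular gx[OF that] by metis
  then have "\<forall>A. \<exists>g. ?sub A \<longrightarrow> g \<in> srt S SG \<and> rel S ActG [g, ga (x A), gb (x A)]" by blast
  then obtain g where g0: "\<forall>A. ?sub A \<longrightarrow> g A \<in> srt S SG \<and> rel S ActG [g A, ga (x A), gb (x A)]"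
    unfolding choice_iff by (elim exE)
  have g: "g A \<in> srt S SG" "rel S ActG [g A, ga (x A), gb (x A)]" if "?sub A" for A using g0 that by blast+
  have "\<exists>m. m \<in> srt S SH \<and> rel S ActH [m, ga (y A), gb (y A)]" if "?sub A" for A
    using S.ActH_regular gy[OF that] by metis
  then have "\<forall>A. \<exists>m. ?sub A \<longrightarrow> m \<in> srt S SH \<and> rel S ActH [m, ga (y A), gb (y A)]" by blast
  then obtain m where m0: "\<forall>A. ?sub A \<longrightarrow> m A \<in> srt S SH \<and> rel S ActH [m A, ga (y A), gb (y A)]"
    unfolding choice_iff by (elim exE)
  have m: "m A \<in> srt S SH" "rel S ActH [m A, ga (y A), gb (y A)]" if "?sub A" for A using m0 that by blast+
  define D where "D A = {B. ?sub A \<and> ?sub B \<and> ev S (g A) (piH S (ga (y B))) \<noteq> z}" for A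
  have finD: "finite (D A)" for A
  proof (cases "?sub A")
    case True
    have "inj_on (\<lambda>B. piH S (ga (y B))) (D A)"
    proof (rule inj_onI)
      fix B C assume "B \<in> D A" "C \<in> D A" and e: "piH S (ga (y B)) = piH S (ga (y C))"
      then have BC: "?sub B" "?sub C" unfolding D_def by blast+
      then have "ga ` B = ga ` C" using gy(3) e by metis
      then show "B = C" using inj_on_image_eq_iff[OF inj] BC by blast
    qed
    moreover have "finite ((\<lambda>B. piH S (ga (y B))) ` D A)"
    proof (rule finite_subset)
      show "(\<lambda>B. piH S (ga (y B))) ` D A \<subseteq> {u \<in> srt S SK. ev S (g A) u \<noteq> z}"
        using gy(1) S.piH_K unfolding D_def by blast
      show "finite {u \<in> srt S SK. ev S (g A) u \<noteq> z}" using S.G_finite g(1)[OF True] by blast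
    qed
    ultimately show ?thesis by (rule finite_imageD[rotated])
  next
    case False
    then have "D A = {}" unfolding D_def by blast
    then show ?thesis by simp
  qed
  have mixed: "p \<in> A \<and> q \<in> A" if "D A \<noteq> {}" for A
  proof (rule ccontr)
    assume neg: "\<not> (p \<in> A \<and> q \<in> A)"
    obtain B where B: "?sub A" "?sub B" "ev S (g A) (piH S (ga (y B))) \<noteq> z"
      using \<open>D A \<noteq> {}\<close> unfolding D_def by blast
    have "ga (x A) = gb (x A)" using x(3)[OF B(1)] neg by blast
    then have "rel S ActG [g A, ga (x A), ga (x A)]" using g(2)[OF B(1)] by simp
    then show False using S.act_trivial gx(1)[OF B(1)] S.piH_K gy(1)[OF B(2)] B(3) by blast
  qed
  have eq: "c w v \<longleftrightarrow> odd (card {A. A \<subseteq> w \<and> card A = n \<and> A \<noteq> v \<and> v \<in> D A} + (if m v = z then 0 else 1))"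
    if w: "w \<subseteq> ?Y" "finite w" "card w = Suc n" and v: "v \<subseteq> w" "card v = n" for w v
  proof -
    let ?U = "{A. A \<subseteq> w \<and> card A = n}"
    have sub: "?sub A" if "A \<in> ?U" for A
      using that w(1,2) finite_subset by blast
    have vU: "v \<in> ?U" using v by blast
    have finU: "finite ?U" using w(2) by (auto intro: finite_subset[of _ "Pow w"])
    have cU: "card ?U = Suc n" using n_subsets[OF w(2), of n] w(3) by simp
    \<comment> \<open>The n-subsets of \<open>w\<close> other than \<open>v\<close> in some order;
      with \<open>v\<close> last they form the stalk indices of a single instance of Q.\<close>
    obtain As where As: "set As = ?U - {v}" "distinct As"
      using finite_distinct_list[of "?U - {v}"] finU by blast
    have len: "length As = n" using distinct_card[OF As(2)] As(1) cU vU finU by simp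
    have d: "distinct (As @ [v])" "set (As @ [v]) = ?U" using As vU by auto
    have sA: "?sub A" if "A \<in> set As" for A
    proof -
      have "A \<in> ?U" using that unfolding As(1) by (rule DiffD1)
      then show ?thesis by (rule sub)
    qed
    have sv: "?sub v" by (rule sub[OF vU])
    let ?xs = "map x As" and ?us = "map (piG P) (map x As) @ [piH P (y v)]"
    let ?us' = "map (piG S) (map ga (map x As)) @ [piH S (ga (y v))]"
    have mus: "map (memset P) ?us = As @ [v]"
      using x(2)[OF sA] y(2)[OF sv] by (simp add: map_idI)
    have mus': "map (memset S) ?us' = map (image ga) (As @ [v])"
      using gx(3)[OF sA] gy(3)[OF sv] by simp
    have wP: "w \<subseteq> srt P SI" using w(1) Y by (rule subset_trans)
    have cP: "compatible n P ?us"
      by (rule P.compatibleI[OF wP w(2,3)]; unfold mus; rule d)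
    have injw: "inj_on ga w" using inj w(1) by (rule inj_on_subset)
    have cS: "compatible n S ?us'"
    proof (rule S.compatibleI)
      show "ga ` w \<subseteq> srt S SI" using wP embedding_srtI[OF P S ga] by blast
      show "finite (ga ` w)" "card (ga ` w) = Suc n" using w card_image[OF injw] by simp_all
      have "inj_on (image ga) (Pow w)" using injw by (rule inj_on_image_Pow)
      then have "inj_on (image ga) (set (As @ [v]))" unfolding d(2) by (rule inj_on_subset) blast
      then show "distinct (map (memset S) ?us')" unfolding mus' using d(1) by (simp add: distinct_map)
      show "set (map (memset S) ?us') = {A. A \<subseteq> ga ` w \<and> card A = n}"
        unfolding mus' set_map d(2) subsets_image[OF injw] ..
    qed
    have xs: "length ?xs = n" "set ?xs \<subseteq> srt P SGs" using len x(1)[OF sA] by auto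
    have ww: "\<Union>(memset P ` set ?us) = w"
    proof -
      have "memset P ` set ?us = ?U" using arg_cong[OF mus, of set] d(2) by (simp only: set_map)
      then show ?thesis using Union_subsets_card[OF w(2,3)] n by simp
    qed
    have 1: "rel ?T Qr (?xs @ [y v]) \<longleftrightarrow> (rel P Qr (?xs @ [y v]) \<longleftrightarrow> \<not> c w v)"
      unfolding rel_twist_Qr ww y(2)[OF sv] using xs y(1)[OF sv] cP by blast
    have carr: "set (?xs @ [y v]) \<subseteq> carrier P" using xs(2) y(1)[OF sv] P.srt_carrier by auto
    have 2: "rel S Qr (map ga ?xs @ [ga (y v)]) \<longleftrightarrow> rel P Qr (?xs @ [y v])"
      using embedding_rel[OF P S ga carr, of Qr] by simp
    have 3: "rel S Qr (map gb ?xs @ [gb (y v)]) \<longleftrightarrow> rel ?T Qr (?xs @ [y v])"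
      using embedding_rel[OF T S gb, of "?xs @ [y v]" Qr] carr by simp
    have 4: "(rel S Qr (map ga ?xs @ [ga (y v)]) \<longleftrightarrow> rel S Qr (map gb ?xs @ [gb (y v)])) \<longleftrightarrow>
        even (card {l. l < n \<and> ev S (map g As ! l) (piH S (ga (y v))) \<noteq> z} + (if m v = z then 0 else 1))"
    proof (rule S.Q_twist[rule_format])
      show "set (map ga ?xs) \<subseteq> srt S SGs" using gx(1)[OF sA] by auto
      show "set (map g As) \<subseteq> srt S SG" using g(1)[OF sA] by auto
      show "rel S ActG [map g As ! l, map ga ?xs ! l, map gb ?xs ! l]" if "l < n" for l
        using g(2)[OF sA, of "As ! l"] that len by simp
    qed (use len gy[OF sv] m[OF sv] cS in simp_all)
    have 5: "card {l. l < n \<and> ev S (map g As ! l) (piH S (ga (y v))) \<noteq> z} =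
        card {A. A \<subseteq> w \<and> card A = n \<and> A \<noteq> v \<and> v \<in> D A}"
    proof -
      have "v \<in> D (As ! l) \<longleftrightarrow> ev S (map g As ! l) (piH S (ga (y v))) \<noteq> z" if "l < n" for l
        using sA[of "As ! l"] sv that len unfolding D_def by simp
      then have "{l. l < n \<and> ev S (map g As ! l) (piH S (ga (y v))) \<noteq> z} = {l. l < length As \<and> v \<in> D (As ! l)}"
        using len by auto
      also have "card \<dots> = length (filter (\<lambda>A. v \<in> D A) As)" by (simp add: length_filter_conv_card)
      also have "\<dots> = card (set (filter (\<lambda>A. v \<in> D A) As))"
        using As(2) by (simp only: distinct_card distinct_filter)
      also have "set (filter (\<lambda>A. v \<in> D A) As) = {A. A \<subseteq> w \<and> card A = n \<and> A \<noteq> v \<and> v \<in> D A}"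
        using As(1) by auto
      finally show ?thesis .
    qed
    \<comment> \<open>Through \<open>ga\<close> the common extension reads Q of \<open>P\<close>,
      through \<open>gb\<close> the twisted Q; these differ exactly where \<open>c\<close>
      holds.\<close>
    have "c w v \<longleftrightarrow> \<not> (rel S Qr (map ga ?xs @ [ga (y v)]) \<longleftrightarrow> rel S Qr (map gb ?xs @ [gb (y v)]))"
      using 1 2 3 by blast
    then show ?thesis unfolding 4 5 .
  qed
  show False
    by (rule no_parity_solution[where D = D and par = "\<lambda>v. if m v = z then 0 else 1", OF n X i pq finD mixed])
      (use eq in \<open>auto simp: c_def\<close>)
qed

section \<open>Amalgams under twists and automorphisms\<close>

lemma elem_emb_twist:
  assumes A: "hs n A zA oA" and P: "hs n P zP oP" and n: "2 \<le> n" and f: "elem_emb f A P"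
    and c: "\<And>w v. w \<subseteq> f ` srt A SI \<Longrightarrow> \<not> c w v"
  shows "elem_emb f A (twist n c P)"
  unfolding elem_emb_def
proof (intro conjI allI impI)
  have emb: "embedding f A P" using elem_emb_embedding[OF f] hs.carrier_nonempty[OF A] by blast
  show "f ` carrier A \<subseteq> carrier (twist n c P)" using f unfolding elem_emb_def by simp
  fix \<phi> :: "hsym fm" and s :: "nat \<Rightarrow> 'a" assume \<phi>: "Lfm \<phi>" and s: "range s \<subseteq> carrier A"
  have "sat A \<phi> s \<longleftrightarrow> sat P \<phi> (f \<circ> s)" using f \<phi> s unfolding elem_emb_def by blast
  also have "\<dots> \<longleftrightarrow> sat (twist n c P) \<phi> (f \<circ> s)"
    using s \<phi> by (intro sat_twist_range[OF A P emb n c]) (auto simp: Lfm_def)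
  finally show "sat A \<phi> s \<longleftrightarrow> sat (twist n c P) \<phi> (f \<circ> s)" .
qed

text \<open>\<open>nonfork\<close> speaks of the image of M1 as a submodel and not of the map, so
  elementarity has to be carried over to the twist in this form as well.\<close>

lemma elem_sub_img_twist:
  assumes A: "hs n A zA oA" and P: "hs n P zP oP" and n: "2 \<le> n" and f: "embedding f A P"
    and sub: "elem_sub (img f A) P" and c: "\<And>w v. w \<subseteq> f ` srt A SI \<Longrightarrow> \<not> c w v"
  shows "elem_sub (img f A) (twist n c P)"
  unfolding elem_sub_def
proof (intro conjI allI impI)
  show "carrier (img f A) \<subseteq> carrier (twist n c P)" using sub unfolding elem_sub_def by simp
  fix \<phi> :: "hsym fm" and s :: "nat \<Rightarrow> 'a" assume \<phi>: "Lfm \<phi>" and s: "range s \<subseteq> carrier (img f A)"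
  have "sat (img f A) \<phi> s \<longleftrightarrow> sat P \<phi> s" using sub \<phi> s unfolding elem_sub_def by blast
  also have "\<dots> \<longleftrightarrow> sat (twist n c P) \<phi> s"
    using s \<phi> by (intro sat_twist_range[OF A P f n c]) (auto simp: Lfm_def img_def)
  finally show "sat (img f A) \<phi> s \<longleftrightarrow> sat (twist n c P) \<phi> s" .
qed

text \<open>An automorphism of M1 rearranges its image without changing the image as a structure, so
  the nonforking condition is literally the same.\<close>

lemma amalgam_automorphism:
  assumes am: "amalgam n k M N a M1 f1 f2 P"
    and \<sigma>: "bij_betw \<sigma> (carrier M1) (carrier M1)"
    and rel: "\<And>R xs. set xs \<subseteq> carrier M1 \<Longrightarrow> rel M1 R xs \<longleftrightarrow> rel M1 R (map \<sigma> xs)"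
    and fix_M: "fixes_on \<sigma> M"
  shows "amalgam n k M N a M1 f1 (f2 \<circ> \<sigma>) P"
proof -
  have im: "\<sigma> ` carrier M1 = carrier M1" using \<sigma> by (simp add: bij_betw_def)
  have "img (f2 \<circ> \<sigma>) M1 = img f2 M1"
  proof -
    have "(\<exists>xs. set xs \<subseteq> carrier M1 \<and> ys = map (f2 \<circ> \<sigma>) xs \<and> rel M1 R xs) \<longleftrightarrow>
        (\<exists>xs. set xs \<subseteq> carrier M1 \<and> ys = map f2 xs \<and> rel M1 R xs)" (is "?L \<longleftrightarrow> ?R") for R ys
    proof
      assume ?L
      then obtain xs where "set xs \<subseteq> carrier M1" "ys = map (f2 \<circ> \<sigma>) xs" "rel M1 R xs" by blast
      then have "set (map \<sigma> xs) \<subseteq> carrier M1" "ys = map f2 (map \<sigma> xs)" "rel M1 R (map \<sigma> xs)"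
        using im rel by auto
      then show ?R by blast
    next
      assume ?R
      then obtain xs where xs: "set xs \<subseteq> carrier M1" "ys = map f2 xs" "rel M1 R xs" by blast
      then obtain xs' where xs': "xs = map \<sigma> xs'" "set xs' \<subseteq> carrier M1"
        using list_in_image[of xs \<sigma> "carrier M1"] im by auto
      then have "rel M1 R xs'" using rel[OF xs'(2)] xs(3) by simp
      then show ?L using xs xs' by (intro exI[of _ xs']) simp
    qed
    moreover have "(f2 \<circ> \<sigma>) ` carrier M1 = f2 ` carrier M1" unfolding image_comp[symmetric] im ..
    ultimately show ?thesis unfolding img_def by simp
  qed
  moreover have "elem_emb (f2 \<circ> \<sigma>) M1 P"
    unfolding elem_emb_def
  proof (intro conjI allI impI)
    have f2: "elem_emb f2 M1 P" using am unfolding amalgam_def by blast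
    show "(f2 \<circ> \<sigma>) ` carrier M1 \<subseteq> carrier P"
      unfolding image_comp[symmetric] im using f2 unfolding elem_emb_def by (elim conjE)
    fix \<phi> :: "hsym fm" and s :: "nat \<Rightarrow> 'a" assume \<phi>: "Lfm \<phi>" and s: "range s \<subseteq> carrier M1"
    have "sat M1 \<phi> s \<longleftrightarrow> sat M1 \<phi> (\<sigma> \<circ> s)"
      by (rule sat_isomorphism[OF \<sigma> rel]) (use \<phi> s in \<open>auto simp: Lfm_def\<close>)
    also have "range (\<sigma> \<circ> s) \<subseteq> carrier M1" using s im by auto
    then have "sat M1 \<phi> (\<sigma> \<circ> s) \<longleftrightarrow> sat P \<phi> (f2 \<circ> (\<sigma> \<circ> s))"
      using f2 \<phi> unfolding elem_emb_def by blast
    finally show "sat M1 \<phi> s \<longleftrightarrow> sat P \<phi> (f2 \<circ> \<sigma> \<circ> s)" by (simp add: comp_assoc)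
  qed
  ultimately show ?thesis
    using am fix_M unfolding amalgam_def fixes_on_def by simp
qed

context coding
begin

text \<open>If \<open>f2 b\<close> were in the image of \<open>N\<close>, then exchanging \<open>b\<close> and \<open>b'\<close> would produce a second amalgam,
  inequivalent to the first one because equivalences are fixed on \<open>N\<close>.\<close>
lemma swap_amalgam_inequivalent:
  assumes ab: "b \<in> J" "b' \<in> J" "b \<noteq> b'" "b \<notin> I" "b' \<notin> I"
    and uniq: "\<And>fa1 fa2 Na fb1 fb2 Nb. amalgam n k (std I) N a (std J) fa1 fa2 Na \<Longrightarrow>
      amalgam n k (std I) N a (std J) fb1 fb2 Nb \<Longrightarrow> amalgam_equiv n k N (std J) fa1 fa2 Na fb1 fb2 Nb"
    and am: "amalgam n k (std I) N a (std J) f1 f2 P"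
  shows "f2 (e (EI b)) \<notin> f1 ` carrier N"
proof
  assume "f2 (e (EI b)) \<in> f1 ` carrier N"
  then obtain d where d: "d \<in> carrier N" "f2 (e (EI b)) = f1 d" by blast
  let ?\<tau> = "transpose b b'"
  have \<tau>: "bij ?\<tau>" by simp
  have \<tau>J: "?\<tau> ` J = J" using permutes_swap_id[OF ab(1,2)] permutes_image by blast
  have "fixes_on (lift ?\<tau>) (std I)"
    unfolding fixes_on_def carrier_std
  proof (clarsimp)
    fix t assume t: "t \<in> elts n I"
    have "map_elt ?\<tau> t = map_elt id t"
      using t ab(4,5) by (intro elt.map_cong0) (auto simp: elts_def transpose_def)
    then show "map_elt ?\<tau> t = t" by (simp add: elt.map_id)
  qed
  then have "amalgam n k (std I) N a (std J) f1 (f2 \<circ> lift ?\<tau>) P"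
    by (intro amalgam_automorphism[OF am lift_bij[OF \<tau> \<tau>J] rel_lift[OF \<tau>]]) (simp_all add: \<tau>J)
  then have "amalgam_equiv n k N (std J) f1 f2 P f1 (f2 \<circ> lift ?\<tau>) P" by (rule uniq[OF am])
  then obtain S ga gb where S: "elem_emb gb P S" "\<forall>x \<in> carrier N. ga (f1 x) = gb (f1 x)"
      "\<forall>x \<in> carrier (std J). ga (f2 x) = gb ((f2 \<circ> lift ?\<tau>) x)"
    unfolding amalgam_equiv_def by (elim exE conjE)
  have f2: "elem_emb f2 (std J) P" using am unfolding amalgam_def by (elim conjE)
  have bJ: "e (EI b) \<in> carrier (std J)" "e (EI b') \<in> carrier (std J)"
    using ab by (simp_all add: carrier_std)
  then have "carrier (std J) \<noteq> {}" by blast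
  with f2 have f2': "embedding f2 (std J) P" by (rule elem_emb_embedding)
  then have b: "f2 (e (EI b)) \<in> carrier P" "f2 (e (EI b')) \<in> carrier P"
    using bJ unfolding embedding_def by blast+
  then have "carrier P \<noteq> {}" by blast
  with S(1) have gb: "inj_on gb (carrier P)" using elem_emb_embedding unfolding embedding_def by blast
  \<comment> \<open>The shared point is an image from N, where the two maps agree; as an image from
    M1 it is sent by \<open>ga\<close> to where \<open>gb\<close> sends the image of
    \<open>b'\<close>. Injectivity then identifies \<open>b\<close> with \<open>b'\<close>.\<close>
  have "gb (f2 (e (EI b))) = ga (f2 (e (EI b)))" using S(2) d by simp
  also have "\<dots> = gb (f2 (e (EI b')))" using S(3) bJ(1) by (simp add: transpose_def)
  finally have "f2 (e (EI b)) = f2 (e (EI b'))" using gb b by (meson inj_onD)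
  then have "e (EI b) = e (EI b')" using f2' bJ unfolding embedding_def by (meson inj_onD)
  then show False using ab(3) by simp
qed

text \<open>N and d are arbitrary, because weak success only promises some triple of the given type.
  That d is an index is extracted from nonforking in an amalgam, and the first amalgam comes from
  the existence half of the definition of uniqueness triple.\<close>

lemma no_uniqueness_triple:
  assumes n3: "3 \<le> n" and A: "isAleph (n - 3) A" and abb: "a \<in> A" "b \<in> A" "b' \<in> A" "a \<noteq> b" "a \<noteq> b'" "b \<noteq> b'"
  shows "\<not> uniq_triple n (n - 3) d (std (A - {a, b, b'})) N"
proof
  let ?k = "n - 3"
  let ?I = "A - {a, b, b'}" and ?J = "A - {a}"
  let ?M = "std ?I" and ?M1 = "std ?J"
  assume u: "uniq_triple n ?k d ?M N"
  have I: "isAleph ?k ?I" and J: "isAleph ?k ?J" using isAleph_Diff_finite[OF A] by simp_all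
  have KM1: "Klam n ?k ?M1" by (rule Klam_std[OF J])
  have MM1: "elem_sub ?M ?M1" by (rule std_elem_sub[OF isAleph_infinite[OF I]]) auto
  have KN: "Klam n ?k N" and MN: "elem_sub ?M N" and dN: "d \<in> carrier N"
    and am_ex: "\<exists>f1 f2 P. amalgam n ?k ?M N d ?M1 f1 f2 P"
    and uniq: "\<And>fa1 fa2 Na fb1 fb2 Nb. amalgam n ?k ?M N d ?M1 fa1 fa2 Na \<Longrightarrow>
      amalgam n ?k ?M N d ?M1 fb1 fb2 Nb \<Longrightarrow> amalgam_equiv n ?k N ?M1 fa1 fa2 Na fb1 fb2 Nb"
    using u KM1 MM1 unfolding uniq_triple_def by simp_all
  obtain f1 f2 P where am: "amalgam n ?k ?M N d ?M1 f1 f2 P" using am_ex by (elim exE)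
  \<comment> \<open>Nonforking keeps the image of \<open>d\<close> away from M1, but nothing in the
    definition of amalgam keeps the image of \<open>b\<close> away from N; only uniqueness
    does.\<close>
  have q1: "f2 (e (EI b)) \<notin> f1 ` carrier N"
  proof (rule swap_amalgam_inequivalent[OF _ _ abb(6) _ _ _ am])
    show "b \<in> ?J" "b' \<in> ?J" "b \<notin> ?I" "b' \<notin> ?I" using abb by auto
  qed (rule uniq)
  have KP: "Klam n ?k P" and f1: "elem_emb f1 N P" and f2: "elem_emb f2 ?M1 P"
    and fix1: "fixes_on f1 ?M" and fix2: "fixes_on f2 ?M" and nf: "nonfork n ?k ?M (img f2 ?M1) P (f1 d)"
    using am by (simp_all only: amalgam_def)
  obtain zN oN where N: "hs n N zN oN" using KN unfolding Klam_def hs_model_iff by blast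
  obtain zP oP where P: "hs n P zP oP" using KP unfolding Klam_def hs_model_iff by blast
  note M = hs_std[of ?I] and M1 = hs_std[of ?J]
  have e1: "embedding f1 N P" by (rule elem_emb_embedding[OF f1 hs.carrier_nonempty[OF N]])
  have e2: "embedding f2 ?M1 P" by (rule elem_emb_embedding[OF f2 hs.carrier_nonempty[OF M1]])
  have eN: "embedding (\<lambda>x. x) ?M N"
    using MN elem_emb_embedding hs.carrier_nonempty[OF M] unfolding elem_sub_iff_elem_emb by blast
  have eM1: "embedding (\<lambda>x. x) ?M ?M1"
    using MM1 elem_emb_embedding hs.carrier_nonempty[OF M] unfolding elem_sub_iff_elem_emb by blast
  define X where "X = srt ?M SI"
  define p where "p = f1 d"
  define q where "q = f2 (e (EI b))"
  have fixed: "f1 x = x" "f2 x = x" if "x \<in> X" for x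
    using that fix1 fix2 hs.srt_carrier[OF M] unfolding fixes_on_def X_def by blast+
  have pP: "p \<in> srt P SI" and pM: "p \<notin> srt (img f2 ?M1) SI"
    using nf unfolding nonfork_def p_def by blast+
  \<comment> \<open>Embeddings reflect sorts, so \<open>d\<close> is an index in N because its image
    is one in \<open>P\<close>.\<close>
  have dI: "d \<in> srt N SI" using pP embedding_srt[OF N P e1 dN] unfolding p_def by simp
  have bI: "e (EI b) \<in> srt ?M1 SI" using abb by simp
  have X1: "insert p X \<subseteq> f1 ` srt N SI"
  proof -
    have "x \<in> f1 ` srt N SI" if "x \<in> X" for x
      using embedding_srtI[OF M N eN, of x SI] that fixed(1)[OF that] unfolding X_def by (metis imageI)
    then show ?thesis using dI unfolding p_def by blast
  qed
  have X2: "insert q X \<subseteq> f2 ` srt ?M1 SI"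
  proof -
    have "x \<in> f2 ` srt ?M1 SI" if "x \<in> X" for x
      using embedding_srtI[OF M M1 eM1, of x SI] that fixed(2)[OF that] unfolding X_def by (metis imageI)
    then show ?thesis using bI unfolding q_def by blast
  qed
  have img: "f2 ` srt ?M1 SI \<subseteq> srt (img f2 ?M1) SI"
  proof
    fix y assume "y \<in> f2 ` srt ?M1 SI"
    then obtain x where x: "y = f2 x" "x \<in> carrier ?M1" "rel ?M1 SI [x]" unfolding srt_def by blast
    then have "\<exists>xs. set xs \<subseteq> carrier ?M1 \<and> [y] = map f2 xs \<and> rel ?M1 SI xs"
      by (intro exI[of _ "[x]"]) simp
    then show "y \<in> srt (img f2 ?M1) SI" using x unfolding srt_def img_def by simp
  qed
  have p2: "p \<notin> f2 ` srt ?M1 SI" using pM img by blast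
  have q1': "q \<notin> f1 ` srt N SI" using q1 hs.srt_carrier[OF N] unfolding q_def by blast
  have pq: "p \<notin> X" "q \<notin> X" "p \<noteq> q" using X1 X2 p2 q1' by auto
  have X: "isAleph ?k X"
  proof (rule isAleph_cong[OF I])
    have "bij_betw (\<lambda>i. e (EI i)) ?I X" unfolding X_def srt_std by (auto simp: bij_betw_def inj_on_def)
    then show "|?I| =o |X|" using card_of_ordIso by blast
  qed
  have infX: "infinite X" by (rule isAleph_infinite[OF X])
  obtain i0 where i0: "i0 \<in> X" using infinite_imp_nonempty[OF infX] by blast
  have "infinite (X - {i0})" using infX by simp
  then have "X - {i0} \<noteq> {}" by (rule infinite_imp_nonempty)
  then obtain i1 where i1: "i1 \<in> X" "i0 \<noteq> i1" by blast
  let ?c = "\<lambda>w v. p \<in> w \<and> q \<in> w \<and> i1 \<in> w \<and> v = w - {i1}"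
  let ?T = "twist n ?c P"
  have n2: "2 \<le> n" using n3 by simp
  \<comment> \<open>Sets inside the image of N miss q, and sets inside the image of M1 miss p, so
    the flip is void over either image.\<close>
  have c1: "\<not> ?c w v" if "w \<subseteq> f1 ` srt N SI" for w v using that q1' by blast
  have c2: "\<not> ?c w v" if "w \<subseteq> f2 ` srt ?M1 SI" for w v using that p2 by blast
  have KT: "Klam n ?k ?T"
    using KP hs.twist_hs[OF P, of ?c] unfolding Klam_def hs_model_iff carrier_twist by blast
  have "amalgam n ?k ?M N d ?M1 f1 f2 ?T"
    unfolding amalgam_def
  proof (intro conjI KT fix1 fix2)
    show "elem_emb f1 N ?T" by (rule elem_emb_twist[OF N P n2 f1 c1])
    show "elem_emb f2 ?M1 ?T" by (rule elem_emb_twist[OF M1 P n2 f2 c2])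
    have "elem_sub (img f2 ?M1) P" using nf unfolding nonfork_def by (elim conjE)
    then have "elem_sub (img f2 ?M1) ?T" by (rule elem_sub_img_twist[OF M1 P n2 e2 _ c2])
    \<comment> \<open>Nonforking mentions the twisted structure through its index sort and
      elementarity only, and the twist keeps the index sort.\<close>
    then show "nonfork n ?k ?M (img f2 ?M1) ?T (f1 d)"
      using nf KT unfolding nonfork_def by simp
  qed
  from uniq[OF am this] obtain S ga gb where S: "Klam n ?k S" "elem_emb ga P S" "elem_emb gb ?T S"
      "\<forall>x \<in> carrier N. ga (f1 x) = gb (f1 x)" "\<forall>x \<in> carrier ?M1. ga (f2 x) = gb (f2 x)"
    unfolding amalgam_equiv_def by (elim exE conjE)
  obtain zS oS where hS: "hs n S zS oS" using S(1) unfolding Klam_def hs_model_iff by blast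
  have ga: "embedding ga P S" by (rule elem_emb_embedding[OF S(2) hs.carrier_nonempty[OF P]])
  have gb: "embedding gb ?T S"
    by (rule elem_emb_embedding[OF S(3) hs.carrier_nonempty[OF hs.twist_hs[OF P]]])
  show False
    by (rule twist_not_equivalent[OF n3 N M1 P hS e1 e2 ga gb _ _ X1 X2 pq i0 i1 isAleph_Diff_finite[OF X]])
      (use S(4,5) in simp_all)
qed

end

text \<open>All models live in the type \<open>'a\<close>. The second assumption says that it has
  room for models of size aleph_(n-3); over a smaller type there would be none, and weak success
  would hold vacuously.\<close>

theorem theorem6p6:
  fixes n :: nat
  assumes "3 \<le> n"
    and "\<exists>A :: 'a set. isAleph (n - 3) A"
  shows "\<not> weakly_successful n (n - 3) TYPE('a)"
proof
  assume ws: "weakly_successful n (n - 3) TYPE('a)"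
  obtain A :: "'a set" where A: "isAleph (n - 3) A" using assms(2) by (elim exE)
  have inf: "infinite A" by (rule isAleph_infinite[OF A])
  obtain B where B: "finite B" "card B = 3" "B \<subseteq> A" using infinite_arbitrarily_large[OF inf] by metis
  then obtain a b b' where abb: "B = {a, b, b'}" "a \<noteq> b" "b \<noteq> b'" "a \<noteq> b'"
    unfolding card_3_iff by (elim exE conjE)
  then have abA: "a \<in> A" "b \<in> A" "b' \<in> A" using B(3) by auto
  have "infinite (UNIV :: 'a set)" using inf by (rule infinite_super[rotated]) simp
  from inj_elt_exists[OF this] obtain e :: "'a elt \<Rightarrow> 'a" where "inj e" by (elim exE)
  then interpret coding e n using assms(1) by unfold_locales simp_all
  \<comment> \<open>The index \<open>a\<close> provides a basic type over the small model to which
    weak success can be applied; \<open>b\<close> and \<open>b'\<close> are reserved for the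
    extension M1.\<close>
  let ?M = "std (A - {a, b, b'})" and ?N = "std (A - {b, b'})"
  have M: "isAleph (n - 3) (A - {a, b, b'})" and N: "isAleph (n - 3) (A - {b, b'})"
    using isAleph_Diff_finite[OF A] by simp_all
  have "elem_sub ?M ?N" by (rule std_elem_sub[OF isAleph_infinite[OF M]]) auto
  moreover have "e (EI a) \<in> srt ?N SI - srt ?M SI" using abb abA by simp
  ultimately have "\<exists>N' d. uniq_triple n (n - 3) d ?M N'"
    using ws Klam_std[OF M] Klam_std[OF N] unfolding weakly_successful_def by metis
  then show False using no_uniqueness_triple[OF assms(1) A abA] abb by metis
qed

end
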